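(* Let $V\subset(\mathbb C^* )^n$ be a smooth algebraic hypersurface, $L=\operatorname{Log}|_V$, $\Sigma=\operatorname{Crit}(L)$ and $\mathcal{CA}_V=L(\Sigma)$. Assume that for every $p\in\mathcal{CA}_V$ the local properness and finite-fiber hypotheses hold: there are a neighborhood $W$ of $p$ in $\mathbb R^n$ and an open neighborhood $\Omega$ of the compact set $\Sigma\cap L^{-1}(p)$ such that the restriction $L:\Sigma\cap\Omega\to W$ is proper, and $\Sigma\cap L^{-1}(p)$ is finite. Let $E_{\mathrm{deg}},E_{\mathrm{mult}}\subset\mathbb R_{>0}^n$ be the elimination sets defined in the context. Then $$\operatorname{Sing}(\mathcal{CA}_V)\subset\Big\{\tfrac12(\log R_1,\dots,\log R_n)\ \Big|\ R\in E_{\mathrm{deg}}\cup E_{\mathrm{mult}}\Big\}.$$ Suppose in addition that: (a) every nondegenerate multiple fiber produces at least two distinct local image hypersurface germs, that is, for every $p\in\mathcal{CA}_V$ such that $\Sigma\cap L^{-1}(p)$ contains at least two points and all its points are nondegenerate, the germs at $p$ of the local images $L(U_q)$ ($q\in\Sigma\cap L^{-1}(p)$, $U_q$ a small neighborhood of $q$ in $\Sigma$) are not all equal; and (b) every point of the exact degenerate projection has a singular image germ, that is, for every $R\in E_{\mathrm{deg}}^{\mathrm{ex}}$ the germ of $\mathcal{CA}_V$ at $\tfrac12(\log R_1,\dots,\log R_n)$ is not a smooth embedded hypersurface germ. Then equality holds after replacing the algebraic elimination closures by the exact semialgebraic projections: $$\operatorname{Sing}(\mathcal{CA}_V)=\Big\{\tfrac12(\log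 R_1,\dots,\log R_n)\ \Big|\ R\in E_{\mathrm{deg}}^{\mathrm{ex}}\cup E_{\mathrm{mult}}^{\mathrm{ex}}\Big\}.$$
   Context: Setting. $V=\{f=0\}\subset(\mathbb C^* )^n$ with $f$ a Laurent polynomial whose partial derivatives do not vanish simultaneously at any point of $V$; $\operatorname{Log}(z)=(\log|z_1|,\dots,\log|z_n|)$; $\operatorname{Crit}(L)$ is the set of points of $V$ where the real differential of $L=\operatorname{Log}|_V:V\to\mathbb R^n$ is not surjective. $\mathcal{CA}_V=L(\Sigma)$ is the contour of the amoeba. A point $p\in\mathcal{CA}_V$ is regular if there is a neighborhood $W$ of $p$ in $\mathbb R^n$ such that $\mathcal{CA}_V\cap W$ is a smooth embedded real hypersurface; otherwise it is singular, and $\operatorname{Sing}(\mathcal{CA}_V)$ is the set of singular points. A critical lift of $p$ is a point $q\in\Sigma$ with $L(q)=p$; it is nondegenerate if $\Sigma$ is smooth (a smooth embedded real submanifold) near $q$ and $\operatorname{rank}d(L|_\Sigma)_q=n-1$. Critical equations. Write $z_j=x_j+iy_j$, $X=(x_1,y_1,\dots,x_n,y_n)$, $F_j=z_j\partial f/\partial z_j$, $U_\ell=\{F_\ell\neq0\}\subset(\mathbb C^* )^n$. With $u=\operatorname{Re}f$, $v=\operatorname{Im}f$ and $\operatorname{Im}(F_j\overline{F_\ell})$, $j\ne\ell$ (in a chosen order), as components, let $G_\ell:U_\ell\to\mathbb R^{n+1}$; then $\Sigma\cap U_\ell=G_\ell^{-1}(0)$. $DG_\ell$ is its $(n+1)\times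 2n$ real Jacobian, and $D\operatorname{Log}$ is the $n\times2n$ real Jacobian of $\operatorname{Log}$ on $(\mathbb C^* )^n$. All expressions are made polynomial in the real coordinates by multiplying by powers of the factors $x_j^2+y_j^2$, which do not vanish on $(\mathbb C^* )^n$ (a fixed choice is made). Ideals. $I_{\Sigma,\ell}\subset\mathbb R[X]$ is generated by the (denominator-cleared) components of $G_\ell$. $I_{\mathrm{sing},\ell}$ is generated by $I_{\Sigma,\ell}$ and all $(n+1)\times(n+1)$ minors of $DG_\ell$. $I_{\mathrm{imm},\ell}$ is generated by $I_{\Sigma,\ell}$ and all $2n\times2n$ minors of $\begin{pmatrix}DG_\ell\\ D\operatorname{Log}\end{pmatrix}$. Both are then saturated by $|F_\ell|^2=F_\ell\overline{F_\ell}$. For indices $\ell,m$ and a second copy $X'=(x_1',y_1',\dots,x_n',y_n')$ of the variables, $I_{\mathrm{mult},\ell m}$ is generated by $I_{\Sigma,\ell}(X)$, $I_{\Sigma,m}(X')$ and $x_j^2+y_j^2-(x_j')^2-(y_j')^2$ ($1\le j\le n$), saturated by the chart polynomials $|F_\ell(X)|^2$, $|F_m(X')|^2$, and $I_{\mathrm{mult},\ell m}^{\mathrm{off}}=I_{\mathrm{mult},\ell m}:\langle\delta\rangle^\infty$, where $\delta=\sum_j\big((x_j-x_j')^2+(y_j-y_j')^2\big)$. Elimination sets. Adjoin variables $R_1,\dots,R_n$ and the equations $R_j-x_j^2-y_j^2=0$, and eliminate $X$ (respectively $X,X'$). $E_{\mathrm{deg}}\subset\mathbb R_{>0}^n$ is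 the union over $\ell$ of the zero sets in $\mathbb R_{>0}^n$ of the elimination ideals in $\mathbb R[R_1,\dots,R_n]$ obtained from $I_{\mathrm{sing},\ell}$ and from $I_{\mathrm{imm},\ell}$. $E_{\mathrm{mult}}\subset\mathbb R_{>0}^n$ is the union over $\ell,m$ of the zero sets in $\mathbb R_{>0}^n$ of the elimination ideals obtained from $I_{\mathrm{mult},\ell m}^{\mathrm{off}}$. Exact semialgebraic projections. For $q\in(\mathbb C^* )^n$ let $\mathcal R(q)=(|z_1|^2,\dots,|z_n|^2)$. $E_{\mathrm{deg}}^{\mathrm{ex}}$ is the set of all $\mathcal R(q)$ such that, for some $\ell$, $q\in U_\ell$, $G_\ell(q)=0$, and either $\operatorname{rank}DG_\ell(q)<n+1$ or $\operatorname{rank}\begin{pmatrix}DG_\ell(q)\\ D\operatorname{Log}(q)\end{pmatrix}<2n$. $E_{\mathrm{mult}}^{\mathrm{ex}}$ is the set of all $R$ such that $R=\mathcal R(q)=\mathcal R(q')$ for two distinct points $q\ne q'$ of $\Sigma$. *)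

theory Defs
  imports "HOL-Analysis.Analysis" "HOL-Library.Poly_Mapping"
begin

section \<open>Smooth maps and embedded submanifolds of Euclidean spaces\<close>

text \<open>Only meaningful for open \<open>S\<close>.\<close>

fun Ck_on :: "nat \<Rightarrow> ('a::real_normed_vector \<Rightarrow> 'b::real_normed_vector) \<Rightarrow> 'a set \<Rightarrow> bool" where
  "Ck_on 0 f S \<longleftrightarrow> continuous_on S f"
| "Ck_on (Suc k) f S \<longleftrightarrow>
     (\<forall>x\<in>S. f differentiable (at x)) \<and> (\<forall>v. Ck_on k (\<lambda>x. frechet_derivative f (at x) v) S)"

definition smooth_on :: "'a::real_normed_vector set \<Rightarrow> ('a \<Rightarrow> 'b::real_normed_vector) \<Rightarrow> bool" where
  "smooth_on S f \<longleftrightarrow> (\<forall>k. Ck_on k f S)"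

text \<open>Slice charts: near each of its points, \<open>S\<close> is carried onto an open piece of a
  \<open>d\<close>-dimensional linear subspace by a diffeomorphism of open subsets of the ambient space.\<close>

definition embedded_submanifold :: "nat \<Rightarrow> 'a::euclidean_space set \<Rightarrow> bool" where
  "embedded_submanifold d S \<longleftrightarrow>
     (\<forall>x\<in>S. \<exists>U U' \<phi> \<psi> E.
        open (U :: 'a set) \<and> x \<in> U \<and> open (U' :: 'a set) \<and>
        homeomorphism U U' \<phi> \<psi> \<and> smooth_on U \<phi> \<and> smooth_on U' \<psi> \<and>
        subspace E \<and> dim E = d \<and> \<phi> ` (S \<inter> U) = U' \<inter> E)"

text \<open>Velocities of smooth curves in \<open>S\<close> through \<open>q\<close>; the usual tangent space wherever \<open>S\<close> is
  an embedded submanifold near \<open>q\<close>.\<close>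

definition tangent_space :: "'a::euclidean_space set \<Rightarrow> 'a \<Rightarrow> 'a set" where
  "tangent_space S q =
     {v. \<exists>\<gamma> e. e > 0 \<and> smooth_on {-e<..<e} \<gamma> \<and> \<gamma> ` {-e<..<e::real} \<subseteq> S \<and> \<gamma> 0 = q \<and>
         (\<gamma> has_vector_derivative v) (at 0)}"

text \<open>Image of the differential at \<open>q\<close> of the restriction of \<open>h\<close> to \<open>S\<close>.\<close>

definition differential_image ::
    "('a::euclidean_space \<Rightarrow> 'b::euclidean_space) \<Rightarrow> 'a set \<Rightarrow> 'a \<Rightarrow> 'b set" where
  "differential_image h S q = frechet_derivative h (at q) ` tangent_space S q"

definition smooth_hypersurface_germ :: "'a::euclidean_space set \<Rightarrow> 'a \<Rightarrow> bool" where
  "smooth_hypersurface_germ S p \<longleftrightarrow>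
     (\<exists>W. open W \<and> p \<in> W \<and> embedded_submanifold (DIM('a) - 1) (S \<inter> W))"

definition germ_eq :: "'a::topological_space \<Rightarrow> 'a set \<Rightarrow> 'a set \<Rightarrow> bool" where
  "germ_eq p A B \<longleftrightarrow> (\<forall>\<^sub>F x in nhds p. x \<in> A \<longleftrightarrow> x \<in> B)"


section \<open>The hypersurface, the logarithmic map and the contour of the amoeba\<close>

type_synonym 'n laurent = "(int ^ 'n) \<Rightarrow>\<^sub>0 complex"

definition laurent_eval :: "'n::finite laurent \<Rightarrow> complex ^ 'n \<Rightarrow> complex" where
  "laurent_eval f z = (\<Sum>\<alpha>\<in>Poly_Mapping.keys f. Poly_Mapping.lookup f \<alpha> * (\<Prod>j\<in>UNIV. z $ j powi (\<alpha> $ j)))"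

definition partial_deriv :: "'n::finite \<Rightarrow> (complex ^ 'n \<Rightarrow> complex) \<Rightarrow> complex ^ 'n \<Rightarrow> complex" where
  "partial_deriv j g z = deriv (\<lambda>w. g (\<chi> i. if i = j then w else z $ i)) (z $ j)"

definition torus :: "(complex ^ 'n::finite) set" where
  "torus = {z. \<forall>j. z $ j \<noteq> 0}"

definition hypersurface :: "'n::finite laurent \<Rightarrow> (complex ^ 'n) set" where
  "hypersurface f = {z \<in> torus. laurent_eval f z = 0}"

definition smooth_hypersurface :: "'n::finite laurent \<Rightarrow> bool" where
  "smooth_hypersurface f \<longleftrightarrow> (\<forall>z\<in>hypersurface f. \<exists>j. partial_deriv j (laurent_eval f) z \<noteq> 0)"

definition Log :: "complex ^ 'n::finite \<Rightarrow> real ^ 'n" where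
  "Log z = (\<chi> j. ln (cmod (z $ j)))"

definition Crit :: "'n::finite laurent \<Rightarrow> (complex ^ 'n) set" where
  "Crit f = {q \<in> hypersurface f. differential_image Log (hypersurface f) q \<noteq> UNIV}"

definition contour :: "'n::finite laurent \<Rightarrow> (real ^ 'n) set" where
  "contour f = Log ` Crit f"

definition Sing_contour :: "'n::finite laurent \<Rightarrow> (real ^ 'n) set" where
  "Sing_contour f = {p \<in> contour f. \<not> smooth_hypersurface_germ (contour f) p}"

definition critical_lifts :: "'n::finite laurent \<Rightarrow> real ^ 'n \<Rightarrow> (complex ^ 'n) set" where
  "critical_lifts f p = {q \<in> Crit f. Log q = p}"

definition nondegenerate_lift :: "'n::finite laurent \<Rightarrow> complex ^ 'n \<Rightarrow> bool" where
  "nondegenerate_lift f q \<longleftrightarrow>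
     (\<exists>U d. open U \<and> q \<in> U \<and> embedded_submanifold d (Crit f \<inter> U)) \<and>
     dim (differential_image Log (Crit f) q) = CARD('n) - 1"

definition locally_proper :: "'n::finite laurent \<Rightarrow> real ^ 'n \<Rightarrow> bool" where
  "locally_proper f p \<longleftrightarrow>
     (\<exists>W \<Omega>. open W \<and> p \<in> W \<and> open \<Omega> \<and> critical_lifts f p \<subseteq> \<Omega> \<and>
        proper_map (top_of_set (Crit f \<inter> \<Omega>)) (top_of_set W) Log)"

text \<open>The set \<open>A\<close> represents the germ at \<open>Log q\<close> of the image of every sufficiently small
  neighbourhood of \<open>q\<close> in the critical set.  For a nondegenerate lift in a finite fibre this germ
  does not depend on the neighbourhood, so that a representative exists and is unique as a germ.\<close>

definition local_image_germ :: "'n::finite laurent \<Rightarrow> complex ^ 'n \<Rightarrow> (real ^ 'n) set \<Rightarrow> bool" where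
  "local_image_germ f q A \<longleftrightarrow>
     (\<exists>U\<^sub>0. open U\<^sub>0 \<and> q \<in> U\<^sub>0 \<and>
        (\<forall>U. open U \<and> q \<in> U \<and> U \<subseteq> U\<^sub>0 \<longrightarrow> germ_eq (Log q) (Log ` (Crit f \<inter> U)) A))"

definition multiple_fibers_separate :: "'n::finite laurent \<Rightarrow> bool" where
  "multiple_fibers_separate f \<longleftrightarrow>
     (\<forall>p\<in>contour f.
        (\<exists>q\<in>critical_lifts f p. \<exists>q'\<in>critical_lifts f p. q \<noteq> q') \<and>
        (\<forall>q\<in>critical_lifts f p. nondegenerate_lift f q)
        \<longrightarrow> \<not> (\<exists>A. \<forall>q\<in>critical_lifts f p. local_image_germ f q A))"


section \<open>Critical equations\<close>

text \<open>Real coordinates: \<open>Inl j\<close> is the index of \<open>x\<^sub>j\<close> and \<open>Inr j\<close> that of \<open>y\<^sub>j\<close>.\<close>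

definition real_coords :: "complex ^ 'n::finite \<Rightarrow> real ^ ('n + 'n)" where
  "real_coords z = (\<chi> i. case i of Inl j \<Rightarrow> Re (z $ j) | Inr j \<Rightarrow> Im (z $ j))"

definition of_real_coords :: "real ^ ('n + 'n) \<Rightarrow> complex ^ 'n::finite" where
  "of_real_coords X = (\<chi> j. Complex (X $ Inl j) (X $ Inr j))"

definition real_jacobian ::
    "(complex ^ 'n::finite \<Rightarrow> real ^ 'm::finite) \<Rightarrow> complex ^ 'n \<Rightarrow> real ^ ('n + 'n) ^ 'm" where
  "real_jacobian h z = jacobian (\<lambda>X. h (of_real_coords X)) (at (real_coords z))"

definition F :: "'n::finite laurent \<Rightarrow> 'n \<Rightarrow> complex ^ 'n \<Rightarrow> complex" where
  "F f j z = z $ j * partial_deriv j (laurent_eval f) z"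

definition chart :: "'n::finite laurent \<Rightarrow> 'n \<Rightarrow> (complex ^ 'n) set" where
  "chart f l = {z \<in> torus. F f l z \<noteq> 0}"

text \<open>The \<open>n + 1\<close> components are indexed by \<open>'n option\<close>.  There is no equation
  \<open>Im (F\<^sub>l * cnj F\<^sub>l)\<close> in the chart \<open>l\<close>, so the slot \<open>Some l\<close> is free and carries \<open>Im f\<close>.\<close>

definition G :: "'n::finite laurent \<Rightarrow> 'n \<Rightarrow> complex ^ 'n \<Rightarrow> real ^ ('n option)" where
  "G f l z = (\<chi> i. case i of
       None \<Rightarrow> Re (laurent_eval f z)
     | Some j \<Rightarrow> if j = l then Im (laurent_eval f z) else Im (F f j z * cnj (F f l z)))"

definition DG :: "'n::finite laurent \<Rightarrow> 'n \<Rightarrow> complex ^ 'n \<Rightarrow> real ^ ('n + 'n) ^ ('n option)" where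
  "DG f l = real_jacobian (G f l)"

definition DG_DLog ::
    "'n::finite laurent \<Rightarrow> 'n \<Rightarrow> complex ^ 'n \<Rightarrow> real ^ ('n + 'n) ^ ('n option + 'n)" where
  "DG_DLog f l z = (\<chi> i. case i of Inl a \<Rightarrow> DG f l z $ a | Inr j \<Rightarrow> real_jacobian Log z $ j)"

text \<open>The minors of size \<open>CARD('k)\<close> of a matrix-valued function; every choice of rows and columns
  is listed with all orderings, which only repeats minors up to sign.\<close>

definition minors ::
    "'k::finite itself \<Rightarrow> ('z \<Rightarrow> real ^ 'c::finite ^ 'r::finite) \<Rightarrow> ('z \<Rightarrow> real) set" where
  "minors _ M = {(\<lambda>z. det (\<chi> i j. M z $ \<rho> i $ \<sigma> j)) | (\<rho> :: 'k \<Rightarrow> 'r) (\<sigma> :: 'k \<Rightarrow> 'c). inj \<rho> \<and> inj \<sigma>}"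


section \<open>Real polynomials and ideals\<close>

type_synonym 'v rpoly = "('v \<Rightarrow>\<^sub>0 nat) \<Rightarrow>\<^sub>0 real"

definition rpoly_eval :: "'v::finite rpoly \<Rightarrow> real ^ 'v \<Rightarrow> real" where
  "rpoly_eval P a = (\<Sum>m\<in>Poly_Mapping.keys P. Poly_Mapping.lookup P m * (\<Prod>v\<in>UNIV. a $ v ^ Poly_Mapping.lookup m v))"

definition Var :: "'v \<Rightarrow> 'v rpoly" where
  "Var v = Poly_Mapping.single (Poly_Mapping.single v 1) 1"

definition rename_monom :: "('v \<Rightarrow> 'w) \<Rightarrow> ('v \<Rightarrow>\<^sub>0 nat) \<Rightarrow> ('w \<Rightarrow>\<^sub>0 nat)" where
  "rename_monom h m = (\<Sum>v\<in>Poly_Mapping.keys m. Poly_Mapping.single (h v) (Poly_Mapping.lookup m v))"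

definition rename :: "('v \<Rightarrow> 'w) \<Rightarrow> 'v rpoly \<Rightarrow> 'w rpoly" where
  "rename h P = (\<Sum>m\<in>Poly_Mapping.keys P. Poly_Mapping.single (rename_monom h m) (Poly_Mapping.lookup P m))"

text \<open>The ideal generated by a set: its span in the ring regarded as a module over itself.\<close>

definition ideal_gen :: "'a::comm_ring_1 set \<Rightarrow> 'a set" where
  "ideal_gen S = module.span (*) S"

lemma module_mult_self: "module ((*) :: 'a::comm_ring_1 \<Rightarrow> 'a \<Rightarrow> 'a)"
  by unfold_locales (simp_all add: algebra_simps)

definition saturate :: "'a::comm_ring_1 set \<Rightarrow> 'a \<Rightarrow> 'a set" where
  "saturate I h = {p. \<exists>k. h ^ k * p \<in> I}"

definition positive_zeros :: "'n::finite rpoly set \<Rightarrow> (real ^ 'n) set" where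
  "positive_zeros I = {R. (\<forall>j. R $ j > 0) \<and> (\<forall>P\<in>I. rpoly_eval P R = 0)}"

text \<open>Adjoin variables \<open>R\<^sub>j\<close> (index \<open>Inr j\<close>) with the equations \<open>R\<^sub>j = N j\<close> to the ideal \<open>I\<close>,
  and eliminate the original variables (indices \<open>Inl v\<close>).\<close>

definition elimination_ideal :: "('n \<Rightarrow> 'v rpoly) \<Rightarrow> 'v rpoly set \<Rightarrow> 'n rpoly set" where
  "elimination_ideal N I =
     {P. rename Inr P \<in> ideal_gen (rename Inl ` I \<union> range (\<lambda>j. Var (Inr j) - rename Inl (N j)))}"


section \<open>Elimination sets\<close>

text \<open>On the torus, \<open>P\<close> is \<open>g\<close> times a product of powers of the factors \<open>x\<^sub>j\<^sup>2 + y\<^sub>j\<^sup>2\<close>.\<close>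

definition clears :: "('n + 'n) rpoly \<Rightarrow> (complex ^ 'n::finite \<Rightarrow> real) \<Rightarrow> bool" where
  "clears P g \<longleftrightarrow>
     (\<exists>k :: 'n \<Rightarrow> nat. \<forall>z\<in>torus.
        rpoly_eval P (real_coords z) = (\<Prod>j\<in>UNIV. ((Re (z $ j))\<^sup>2 + (Im (z $ j))\<^sup>2) ^ k j) * g z)"

text \<open>A choice of denominator clearing for all expressions that admit one.\<close>

definition clearing_choice :: "((complex ^ 'n::finite \<Rightarrow> real) \<Rightarrow> ('n + 'n) rpoly) \<Rightarrow> bool" where
  "clearing_choice c \<longleftrightarrow> (\<forall>g. (\<exists>P. clears P g) \<longrightarrow> clears (c g) g)"

type_synonym 'n clearing = "(complex ^ 'n \<Rightarrow> real) \<Rightarrow> ('n + 'n) rpoly"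

definition norm_sq_poly :: "'n \<Rightarrow> ('n + 'n) rpoly" where
  "norm_sq_poly j = Var (Inl j) ^ 2 + Var (Inr j) ^ 2"

definition chart_poly :: "'n::finite clearing \<Rightarrow> 'n laurent \<Rightarrow> 'n \<Rightarrow> ('n + 'n) rpoly" where
  "chart_poly c f l = c (\<lambda>z. (cmod (F f l z))\<^sup>2)"

definition I_Sigma :: "'n::finite clearing \<Rightarrow> 'n laurent \<Rightarrow> 'n \<Rightarrow> ('n + 'n) rpoly set" where
  "I_Sigma c f l = ideal_gen (range (\<lambda>i. c (\<lambda>z. G f l z $ i)))"

definition I_sing :: "'n::finite clearing \<Rightarrow> 'n laurent \<Rightarrow> 'n \<Rightarrow> ('n + 'n) rpoly set" where
  "I_sing c f l =
     saturate (ideal_gen (I_Sigma c f l \<union> c ` minors TYPE('n option) (DG f l))) (chart_poly c f l)"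

definition I_imm :: "'n::finite clearing \<Rightarrow> 'n laurent \<Rightarrow> 'n \<Rightarrow> ('n + 'n) rpoly set" where
  "I_imm c f l =
     saturate (ideal_gen (I_Sigma c f l \<union> c ` minors TYPE('n + 'n) (DG_DLog f l))) (chart_poly c f l)"

text \<open>Below, the variables \<open>X\<close> and \<open>X'\<close> have the indices \<open>Inl i\<close> and \<open>Inr i\<close>.\<close>

definition I_mult ::
    "'n::finite clearing \<Rightarrow> 'n laurent \<Rightarrow> 'n \<Rightarrow> 'n \<Rightarrow> (('n + 'n) + ('n + 'n)) rpoly set" where
  "I_mult c f l m =
     saturate
       (saturate
         (ideal_gen
           (rename Inl ` I_Sigma c f l \<union> rename Inr ` I_Sigma c f m \<union>
            range (\<lambda>j. rename Inl (norm_sq_poly j) - rename Inr (norm_sq_poly j))))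
         (rename Inl (chart_poly c f l)))
       (rename Inr (chart_poly c f m))"

definition delta :: "(('n::finite + 'n) + ('n + 'n)) rpoly" where
  "delta = (\<Sum>j\<in>UNIV. (Var (Inl (Inl j)) - Var (Inr (Inl j))) ^ 2 +
                      (Var (Inl (Inr j)) - Var (Inr (Inr j))) ^ 2)"

definition I_mult_off ::
    "'n::finite clearing \<Rightarrow> 'n laurent \<Rightarrow> 'n \<Rightarrow> 'n \<Rightarrow> (('n + 'n) + ('n + 'n)) rpoly set" where
  "I_mult_off c f l m = saturate (I_mult c f l m) delta"

definition E_deg :: "'n::finite clearing \<Rightarrow> 'n laurent \<Rightarrow> (real ^ 'n) set" where
  "E_deg c f =
     (\<Union>l. positive_zeros (elimination_ideal norm_sq_poly (I_sing c f l)) \<union>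
          positive_zeros (elimination_ideal norm_sq_poly (I_imm c f l)))"

definition E_mult :: "'n::finite clearing \<Rightarrow> 'n laurent \<Rightarrow> (real ^ 'n) set" where
  "E_mult c f =
     (\<Union>l m. positive_zeros
               (elimination_ideal (\<lambda>j. rename Inl (norm_sq_poly j)) (I_mult_off c f l m)))"

definition abs_squares :: "complex ^ 'n::finite \<Rightarrow> real ^ 'n" where
  "abs_squares q = (\<chi> j. (cmod (q $ j))\<^sup>2)"

definition E_deg_ex :: "'n::finite laurent \<Rightarrow> (real ^ 'n) set" where
  "E_deg_ex f =
     {abs_squares q | q. \<exists>l. q \<in> chart f l \<and> G f l q = 0 \<and>
        (rank (DG f l q) < CARD('n) + 1 \<or> rank (DG_DLog f l q) < 2 * CARD('n))}"

definition E_mult_ex :: "'n::finite laurent \<Rightarrow> (real ^ 'n) set" where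
  "E_mult_ex f = {R. \<exists>q\<in>Crit f. \<exists>q'\<in>Crit f. q \<noteq> q' \<and> R = abs_squares q \<and> R = abs_squares q'}"

definition half_log :: "real ^ 'n::finite \<Rightarrow> real ^ 'n" where
  "half_log R = (\<chi> j. ln (R $ j) / 2)"

end

theory Submission
  imports Defs
begin

text \<open>
  Let \<open>q\<close> be a critical point in the chart \<open>l\<close>.  Near \<open>q\<close> the critical set \<open>\<Sigma> = Crit f\<close> is the zero set
  of \<open>G f l\<close> (\<open>Crit_chart_iff\<close>).  If \<open>DG f l q\<close> has full rank \<open>n + 1\<close>, then \<open>\<Sigma>\<close> is a submanifold of
  dimension \<open>n - 1\<close> near \<open>q\<close> whose tangent space is the kernel of the derivative of \<open>G f l\<close>, and if
  \<open>DG_DLog f l q\<close> has full rank \<open>2 n\<close>, then the derivative of \<open>Log\<close> is injective on this kernel.  So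
  \<open>Log\<close> immerses \<open>\<Sigma>\<close> at \<open>q\<close>, and arbitrarily small pieces of \<open>\<Sigma>\<close> around \<open>q\<close> are mapped onto embedded
  hypersurface patches through \<open>Log q\<close> (\<open>immersed_level_set_image\<close>).

  A regular point is obtained from this as follows.  The critical set is closed in the torus and
  \<open>Log\<close> is a proper map on the torus, so near \<open>p\<close> the contour consists of images of
  points of \<open>\<Sigma>\<close> close to the lifts of \<open>p\<close> (\<open>contour_locally_image\<close>).  If \<open>p\<close> has a single lift and
  this lift has full rank, the contour near \<open>p\<close> is one hypersurface patch and \<open>p\<close> is regular.  Every
  singular point therefore has a rank deficient lift or two lifts, that is, it comes from
  \<open>E_deg_ex\<close> or \<open>E_mult_ex\<close> (\<open>Sing_contour_subset_exact\<close>).  These exact projections lie in the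
  elimination sets, because every polynomial of the ideals involved vanishes at the real
  coordinates of the points that are projected; saturation is harmless since the chart polynomials
  and \<open>delta\<close> do not vanish there.  For this the denominators of all generators, minors included,
  must be clearable, which holds because they belong to the ring of regular functions that is
  generated by the coordinates \<open>x\<^sub>j\<close>, \<open>y\<^sub>j\<close> and the inverses of \<open>x\<^sub>j\<^sup>2 + y\<^sub>j\<^sup>2\<close> and closed under
  differentiation.

  For the converse, points of \<open>E_deg_ex\<close> are singular by assumption.  Let \<open>p\<close> come from \<open>E_mult_ex\<close> but
  not from \<open>E_deg_ex\<close>: then all its lifts have full rank.  If the contour were a smooth hypersurface
  near \<open>p\<close>, each local image would be an \<open>(n - 1)\<close>-dimensional patch inside an
  \<open>(n - 1)\<close>-dimensional manifold, hence open in it by invariance of domain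
  (\<open>equidimensional_patch_open\<close>).  All local images would then have the germ of the contour itself,
  against the assumption that the germs over a multiple nondegenerate fibre differ.
\<close>


section \<open>Calculus of \<open>C\<^sup>k\<close> maps\<close>

lemma Ck_on_cong:
  assumes "open S" "\<And>x. x \<in> S \<Longrightarrow> f x = g x" "Ck_on k f S"
  shows "Ck_on k g S"
  using assms(2,3)
proof (induction k arbitrary: f g)
  case 0
  then show ?case using continuous_on_cong by force
next
  case (Suc k)
  have g: "(g has_derivative frechet_derivative f (at x)) (at x)" if x: "x \<in> S" for x
  proof -
    have "(f has_derivative frechet_derivative f (at x)) (at x)"
      using Suc.prems(2) frechet_derivative_works x by auto
    then show ?thesis
      by (rule has_derivative_transform_within_open[OF _ \<open>open S\<close> x Suc.prems(1)])
  qed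
  then have "frechet_derivative f (at x) v = frechet_derivative g (at x) v" if "x \<in> S" for x v
    using frechet_derivative_at[OF g[OF that]] by metis
  then have "Ck_on k (\<lambda>x. frechet_derivative g (at x) v) S" for v
    using Suc.IH[of "\<lambda>x. frechet_derivative f (at x) v" "\<lambda>x. frechet_derivative g (at x) v"] Suc.prems(2)
    by (metis Ck_on.simps(2))
  then show ?case using g by (auto simp: differentiable_def)
qed

lemma Ck_on_SucI:
  assumes "open S" "\<And>x. x \<in> S \<Longrightarrow> (f has_derivative f' x) (at x)"
    and "\<And>v. Ck_on k (\<lambda>x. f' x v) S"
  shows "Ck_on (Suc k) f S"
proof -
  have "f' x v = frechet_derivative f (at x) v" if "x \<in> S" for x v
    using frechet_derivative_at[OF assms(2)[OF that]] by simp
  then have "Ck_on k (\<lambda>x. frechet_derivative f (at x) v) S" for v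
    using Ck_on_cong[OF assms(1) _ assms(3)[of v]] by simp
  then show ?thesis using assms(2) by (auto simp: differentiable_def)
qed

lemma Ck_on_SucD:
  assumes "Ck_on (Suc k) f S"
  shows "x \<in> S \<Longrightarrow> (f has_derivative frechet_derivative f (at x)) (at x)"
    and "Ck_on k (\<lambda>x. frechet_derivative f (at x) v) S"
  using assms frechet_derivative_works by auto

lemma Ck_on_subset: "Ck_on k f S \<Longrightarrow> T \<subseteq> S \<Longrightarrow> Ck_on k f T"
proof (induction k arbitrary: f)
  case 0
  then show ?case using continuous_on_subset by auto
next
  case (Suc k)
  then show ?case by (metis Ck_on.simps(2) subsetD)
qed

lemma Ck_on_Suc_imp: "Ck_on (Suc k) f S \<Longrightarrow> Ck_on k f S"
proof (induction k arbitrary: f)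
  case 0
  then show ?case
    by (metis Ck_on.simps continuous_at_imp_continuous_on differentiable_imp_continuous_within)
next
  case (Suc k)
  then show ?case by (metis Ck_on.simps(2))
qed

lemma Ck_on_const: "open S \<Longrightarrow> Ck_on k (\<lambda>x. c) S"
proof (induction k arbitrary: c)
  case (Suc k)
  then show ?case by (intro Ck_on_SucI[where f' = "\<lambda>x v. 0"]) auto
qed auto

lemma Ck_on_add:
  "open S \<Longrightarrow> Ck_on k f S \<Longrightarrow> Ck_on k g S \<Longrightarrow> Ck_on k (\<lambda>x. f x + g x) S"
proof (induction k arbitrary: f g)
  case 0
  then show ?case by (auto intro: continuous_intros)
next
  case (Suc k)
  show ?case
    by (rule Ck_on_SucI[OF Suc.prems(1)])
       (auto intro!: has_derivative_add Suc.IH Suc.prems(1) Ck_on_SucD[OF Suc.prems(2)] Ck_on_SucD[OF Suc.prems(3)])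
qed

lemma Ck_on_bounded_linear:
  assumes L: "bounded_linear L" and "open S"
  shows "Ck_on k f S \<Longrightarrow> Ck_on k (\<lambda>x. L (f x)) S"
proof (induction k arbitrary: f)
  case 0
  then show ?case using linear_continuous_on_compose
    using L bounded_linear.continuous_on by auto
next
  case (Suc k)
  show ?case
    by (rule Ck_on_SucI[OF \<open>open S\<close>])
       (auto intro!: bounded_linear.has_derivative[OF L] Suc.IH Ck_on_SucD[OF Suc.prems])
qed

lemma Ck_on_bilinear:
  assumes L: "bounded_bilinear L" and "open S"
  shows "Ck_on k f S \<Longrightarrow> Ck_on k g S \<Longrightarrow> Ck_on k (\<lambda>x. L (f x) (g x)) S"
proof (induction k arbitrary: f g)
  case 0
  then show ?case using bounded_bilinear.continuous_on[OF L] by auto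
next
  case (Suc k)
  show ?case
  proof (rule Ck_on_SucI[OF \<open>open S\<close>])
    fix x assume "x \<in> S"
    then show "((\<lambda>x. L (f x) (g x)) has_derivative
        (\<lambda>v. L (f x) (frechet_derivative g (at x) v) + L (frechet_derivative f (at x) v) (g x))) (at x)"
      by (intro bounded_bilinear.FDERIV[OF L] Ck_on_SucD(1)[OF Suc.prems(1)] Ck_on_SucD(1)[OF Suc.prems(2)])
  next
    show "Ck_on k (\<lambda>x. L (f x) (frechet_derivative g (at x) v) + L (frechet_derivative f (at x) v) (g x)) S" for v
      by (intro Ck_on_add \<open>open S\<close> Suc.IH Ck_on_SucD(2)[OF Suc.prems(1)] Ck_on_SucD(2)[OF Suc.prems(2)]
          Ck_on_Suc_imp[OF Suc.prems(1)] Ck_on_Suc_imp[OF Suc.prems(2)])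
  qed
qed

lemmas Ck_on_scaleR = Ck_on_bilinear[OF bounded_bilinear_scaleR]
lemmas Ck_on_minus = Ck_on_bounded_linear[OF bounded_linear_minus[OF bounded_linear_ident]]

lemma Ck_on_sum:
  assumes "open S" "\<And>i. i \<in> I \<Longrightarrow> Ck_on k (f i) S"
  shows "Ck_on k (\<lambda>x. \<Sum>i\<in>I. f i x) S"
  using assms(2)
proof (induction I rule: infinite_finite_induct)
  case (insert i I)
  then show ?case by (simp add: Ck_on_add[OF assms(1)])
qed (auto simp: Ck_on_const[OF assms(1)])

lemma Ck_on_ident: "open S \<Longrightarrow> Ck_on k (\<lambda>x. x) S"
proof (cases k)
  case (Suc m)
  assume "open S"
  then show ?thesis unfolding Suc
    by (intro Ck_on_SucI[where f' = "\<lambda>x v. v"] Ck_on_const has_derivative_ident)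
qed (simp add: continuous_on_id)

lemma linear_expand_Basis:
  fixes A :: "'a::euclidean_space \<Rightarrow> 'b::real_vector"
  assumes "linear A"
  shows "A w = (\<Sum>b\<in>Basis. (w \<bullet> b) *\<^sub>R A b)"
  by (metis (no_types, lifting) assms euclidean_representation linear_cmul linear_sum sum.cong)

text \<open>A product rule for a family of linear maps applied to a moving vector; expanding the vector in the
  basis reduces it to products with scalar functions.\<close>

lemma Ck_on_linear_apply:
  fixes A :: "'x::real_normed_vector \<Rightarrow> 'a::euclidean_space \<Rightarrow> 'b::real_normed_vector"
  assumes "open S" "\<And>x. x \<in> S \<Longrightarrow> linear (A x)" "\<And>v. Ck_on k (\<lambda>x. A x v) S" "Ck_on k w S"
  shows "Ck_on k (\<lambda>x. A x (w x)) S"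
proof -
  have "Ck_on k (\<lambda>x. \<Sum>b\<in>Basis. (w x \<bullet> b) *\<^sub>R A x b) S"
    by (intro Ck_on_sum Ck_on_scaleR assms Ck_on_bounded_linear[OF bounded_linear_inner_left])
  then show ?thesis
    by (rule Ck_on_cong[OF assms(1), rotated]) (metis assms(2) linear_expand_Basis)
qed

lemma Ck_on_compose:
  fixes f :: "'x::real_normed_vector \<Rightarrow> 'a::euclidean_space"
  assumes "open S" "open T" "f ` S \<subseteq> T"
  shows "Ck_on k f S \<Longrightarrow> Ck_on k g T \<Longrightarrow> Ck_on k (\<lambda>x. g (f x)) S"
proof (induction k arbitrary: g)
  case 0
  then show ?case using assms(3) continuous_on_compose2 by auto
next
  case (Suc k)
  show ?case
  proof (rule Ck_on_SucI[OF \<open>open S\<close>])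
    fix x assume x: "x \<in> S"
    show "((\<lambda>x. g (f x)) has_derivative
        (\<lambda>v. frechet_derivative g (at (f x)) (frechet_derivative f (at x) v))) (at x)"
      using assms(3) x
      by (intro has_derivative_compose[OF Ck_on_SucD(1)[OF Suc.prems(1) x]] Ck_on_SucD(1)[OF Suc.prems(2)]) auto
  next
    show "Ck_on k (\<lambda>x. frechet_derivative g (at (f x)) (frechet_derivative f (at x) v)) S" for v
    proof (rule Ck_on_linear_apply[OF \<open>open S\<close>])
      show "linear (frechet_derivative g (at (f x)))" if "x \<in> S" for x
        using that assms(3) Suc.prems(2) by (intro linear_frechet_derivative) auto
    qed (use Suc.IH[OF Ck_on_Suc_imp[OF Suc.prems(1)] Ck_on_SucD(2)[OF Suc.prems(2)]] Ck_on_SucD(2)[OF Suc.prems(1)] in simp_all)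
  qed
qed

text \<open>From \<open>A x (B x v - B x0 v) = - (A x - A x0) (B x0 v)\<close> the increment of the inverse is
  controlled by that of \<open>A\<close>, once \<open>A x\<close> is known to be bounded below near
  \<open>x0\<close> by half the bound of \<open>A x0\<close>.\<close>

lemma continuous_on_linear_inverse:
  fixes A B :: "'x::real_normed_vector \<Rightarrow> 'a::euclidean_space \<Rightarrow> 'a"
  assumes S: "open S" and lin: "\<And>x. x \<in> S \<Longrightarrow> linear (A x)" "\<And>x. x \<in> S \<Longrightarrow> linear (B x)"
    and inv: "\<And>x v. x \<in> S \<Longrightarrow> A x (B x v) = v" "\<And>x v. x \<in> S \<Longrightarrow> B x (A x v) = v"
    and cont: "\<And>v. continuous_on S (\<lambda>x. A x v)"
  shows "continuous_on S (\<lambda>x. B x v)"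
proof (rule continuous_at_imp_continuous_on, rule)
  fix x0 assume x0: "x0 \<in> S"
  define w where "w = B x0 v"
  obtain c where c: "c > 0" "\<And>u. norm (B x0 u) \<le> c * norm u"
    using lin(2)[OF x0] by (metis linear_bounded_pos)
  \<comment> \<open>\<open>\<eta> x\<close> dominates the operator norm of \<open>A x - A x0\<close>\<close>
  define \<eta> where "\<eta> x = (\<Sum>b\<in>Basis. norm (A x b - A x0 b))" for x
  have Abnd: "norm (A x u - A x0 u) \<le> \<eta> x * norm u" if "x \<in> S" for x u
  proof -
    have "A x u - A x0 u = (\<Sum>b\<in>Basis. (u \<bullet> b) *\<^sub>R (A x b - A x0 b))"
      using linear_expand_Basis[OF lin(1)[OF that], of u] linear_expand_Basis[OF lin(1)[OF x0], of u]
      by (simp add: sum_subtractf scaleR_diff_right)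
    also have "norm \<dots> \<le> (\<Sum>b\<in>Basis. norm u * norm (A x b - A x0 b))"
      by (rule sum_norm_le) (simp add: Basis_le_norm mult_right_mono)
    finally show ?thesis by (simp add: \<eta>_def sum_distrib_left mult.commute)
  qed
  have At: "((\<lambda>x. A x u) \<longlongrightarrow> A x0 u) (at x0)" for u
    using cont[of u] x0 S continuous_on_eq_continuous_at isCont_def by blast
  have "(\<eta> \<longlongrightarrow> (\<Sum>b\<in>(Basis::'a set). norm (A x0 b - A x0 b))) (at x0)"
    unfolding \<eta>_def by (intro tendsto_intros At)
  then have \<eta>0: "(\<eta> \<longlongrightarrow> 0) (at x0)" by simp
  then have "\<forall>\<^sub>F x in at x0. \<eta> x < 1 / (2 * c)"
    using c by (intro order_tendstoD(2)[where a = "1/(2*c)"]) auto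
  moreover have "\<forall>\<^sub>F x in at x0. x \<in> S"
    using S x0 eventually_at_in_open' by blast
  ultimately have "\<forall>\<^sub>F x in at x0. norm (B x v - w) \<le> 2 * c * (\<eta> x * norm w)"
  proof eventually_elim
    case (elim x)
    define d where "d = B x v - w"
    have eq: "A x d = - (A x w - A x0 w)"
      using elim x0 by (simp add: d_def w_def inv linear_diff lin)
    have "norm d = norm (B x0 (A x0 d))" using inv x0 by simp
    also have "\<dots> \<le> c * norm (A x0 d)" using c by blast
    also have "\<dots> \<le> c * (norm (A x d) + norm (A x d - A x0 d))"
      using c by (intro mult_left_mono) (metis norm_minus_commute norm_triangle_sub, simp)
    also have "\<dots> \<le> c * (\<eta> x * norm w + 1 / (2*c) * norm d)"
    proof (intro mult_left_mono add_mono)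
      show "norm (A x d) \<le> \<eta> x * norm w"
        using Abnd[OF elim(2), of w] eq by (simp add: norm_minus_commute)
      show "norm (A x d - A x0 d) \<le> 1 / (2*c) * norm d"
        using Abnd[OF elim(2), of d] elim(1) by (smt (verit) mult_right_mono norm_ge_zero)
    qed (use c in simp)
    finally have "norm d \<le> c * (\<eta> x * norm w) + norm d / 2"
      using c by (simp add: field_simps)
    then show ?case by (simp add: d_def)
  qed
  moreover have "((\<lambda>x. 2 * c * (\<eta> x * norm w)) \<longlongrightarrow> 0) (at x0)"
    using \<eta>0 by (auto intro!: tendsto_eq_intros)
  ultimately have "((\<lambda>x. B x v - w) \<longlongrightarrow> 0) (at x0)"
    by (rule Lim_null_comparison)
  then show "isCont (\<lambda>x. B x v) x0"
    unfolding isCont_def w_def by (rule LIM_zero_cancel)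
qed

text \<open>The second factor need only be continuous because the first one vanishes at the point: this is what
  makes inverses of differentiable families of linear maps differentiable, before anything beyond
  continuity of the inverse is known.\<close>

lemma has_derivative_scaleR_vanishing:
  fixes r :: "'x::real_normed_vector \<Rightarrow> real" and c :: "'x \<Rightarrow> 'b::real_normed_vector"
  assumes r: "(r has_derivative r') (at x0)" and "r x0 = 0" and c: "isCont c x0"
  shows "((\<lambda>x. r x *\<^sub>R c x) has_derivative (\<lambda>v. r' v *\<^sub>R c x0)) (at x0)"
proof -
  have 1: "((\<lambda>x. (r x) *\<^sub>R c x0) has_derivative (\<lambda>v. r' v *\<^sub>R c x0)) (at x0)"
    by (intro has_derivative_scaleR_left r)
  have "((\<lambda>x. r x *\<^sub>R (c x - c x0)) has_derivative (\<lambda>v. 0)) (at x0)"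
  proof -
    obtain K where K: "\<And>v. norm (r' v) \<le> norm v * K" "K > 0"
      using has_derivative_bounded_linear[OF r] bounded_linear.pos_bounded by blast
    have q: "((\<lambda>x. norm (r x - r x0 - r' (x - x0)) / norm (x - x0)) \<longlongrightarrow> 0) (at x0)"
      using r by (simp add: has_derivative_iff_norm)
    have c0: "((\<lambda>x. norm (c x - c x0)) \<longlongrightarrow> 0) (at x0)"
      using c unfolding isCont_def by (simp add: LIM_zero tendsto_norm_zero)
    have lim: "((\<lambda>x. (norm (r x - r x0 - r' (x - x0)) / norm (x - x0) + K) * norm (c x - c x0)) \<longlongrightarrow> 0) (at x0)"
      using tendsto_mult[OF tendsto_add[OF q tendsto_const[of K]] c0] by simp
    have "((\<lambda>x. norm (r x *\<^sub>R (c x - c x0)) / norm (x - x0)) \<longlongrightarrow> 0) (at x0)"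
    proof (rule Lim_null_comparison[OF _ lim])
      show "\<forall>\<^sub>F x in at x0. norm (norm (r x *\<^sub>R (c x - c x0)) / norm (x - x0))
          \<le> (norm (r x - r x0 - r' (x - x0)) / norm (x - x0) + K) * norm (c x - c x0)"
      proof (rule eventually_at_filter[THEN iffD2], rule always_eventually, intro allI impI)
        fix x assume "x \<noteq> x0"
        then have pos: "norm (x - x0) > 0" by simp
        have "\<bar>r x\<bar> \<le> norm (r x - r x0 - r' (x - x0)) + norm (x - x0) * K"
          using K(1)[of "x - x0"] \<open>r x0 = 0\<close> by simp
        then have "\<bar>r x\<bar> / norm (x - x0) \<le> norm (r x - r x0 - r' (x - x0)) / norm (x - x0) + K"
          using pos by (simp add: field_simps)
        then have "\<bar>r x\<bar> / norm (x - x0) * norm (c x - c x0) \<le> (norm (r x - r x0 - r' (x - x0)) / norm (x - x0) + K) * norm (c x - c x0)"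
          by (intro mult_right_mono) auto
        then show "norm (norm (r x *\<^sub>R (c x - c x0)) / norm (x - x0))
          \<le> (norm (r x - r x0 - r' (x - x0)) / norm (x - x0) + K) * norm (c x - c x0)"
          by simp
      qed
    qed
    then show ?thesis
      by (simp add: has_derivative_iff_norm \<open>r x0 = 0\<close>)
  qed
  from has_derivative_add[OF 1 this] show ?thesis by (simp add: algebra_simps)
qed

text \<open>The identity \<open>D (B x v) u = - B x ((D A x u) (B x v))\<close> for the derivative of the
  inverse raises the order of differentiability by one.\<close>

lemma Ck_on_linear_inverse:
  fixes A B :: "'x::real_normed_vector \<Rightarrow> 'a::euclidean_space \<Rightarrow> 'a"
  assumes S: "open S" and lin: "\<And>x. x \<in> S \<Longrightarrow> linear (A x)" "\<And>x. x \<in> S \<Longrightarrow> linear (B x)"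
    and inv: "\<And>x v. x \<in> S \<Longrightarrow> A x (B x v) = v" "\<And>x v. x \<in> S \<Longrightarrow> B x (A x v) = v"
  shows "(\<And>v. Ck_on k (\<lambda>x. A x v) S) \<Longrightarrow> Ck_on k (\<lambda>x. B x v) S"
proof (induction k arbitrary: v)
  case 0
  then show ?case using continuous_on_linear_inverse[OF S lin inv] by simp
next
  case (Suc k)
  have Bk: "Ck_on k (\<lambda>x. B x v) S" for v
    using Suc Ck_on_Suc_imp by blast
  have Bcont: "isCont (\<lambda>x. B x v) x" if "x \<in> S" for x v
  proof -
    have "continuous_on S (\<lambda>x. B x v)"
    proof (rule continuous_on_linear_inverse[OF S lin inv])
      show "continuous_on S (\<lambda>x. A x v)" for v
        using Ck_on_SucD(1)[OF Suc.prems] has_derivative_continuous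
        by (blast intro: continuous_at_imp_continuous_on)
    qed
    then show ?thesis using S that continuous_on_eq_continuous_at by blast
  qed
  let ?A' = "\<lambda>x w u. frechet_derivative (\<lambda>x. A x w) (at x) u"
  let ?B' = "\<lambda>x u. - (\<Sum>b\<in>Basis. (?A' x (B x v) u \<bullet> b) *\<^sub>R B x b)"
  show ?case
  proof (rule Ck_on_SucI[OF S])
    fix x0 assume x0: "x0 \<in> S"
    define w where "w = B x0 v"
    have "((\<lambda>x. A x w) has_derivative ?A' x0 w) (at x0)"
      using Suc.prems x0 Ck_on_SucD(1) by blast
    then have *: "((\<lambda>x. ((A x w - v) \<bullet> b)) has_derivative (\<lambda>u. ?A' x0 w u \<bullet> b)) (at x0)" for b
      by (auto intro!: derivative_eq_intros)
    have "((\<lambda>x. w - (\<Sum>b\<in>Basis. ((A x w - v) \<bullet> b) *\<^sub>R B x b)) has_derivative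
        (\<lambda>u. 0 - (\<Sum>b\<in>Basis. (?A' x0 w u \<bullet> b) *\<^sub>R B x0 b))) (at x0)"
      using x0 inv by (intro has_derivative_diff has_derivative_const has_derivative_sum
         has_derivative_scaleR_vanishing * Bcont) (auto simp: w_def)
    moreover have "w - (\<Sum>b\<in>Basis. ((A x w - v) \<bullet> b) *\<^sub>R B x b) = B x v" if "x \<in> S" for x
      using that by (simp add: linear_expand_Basis[OF lin(2)[OF that], symmetric] linear_diff lin inv)
    ultimately show "((\<lambda>x. B x v) has_derivative ?B' x0) (at x0)"
      using has_derivative_transform_within_open[OF _ S x0] unfolding w_def by fastforce
  next
    fix u
    have "Ck_on k (\<lambda>x. ?A' x (B x v) u) S"
    proof (rule Ck_on_cong[OF S])
      let ?g = "\<lambda>x. \<Sum>b\<in>Basis. (B x v \<bullet> b) *\<^sub>R ?A' x b u"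
      show "Ck_on k ?g S"
        using Suc.prems by (intro Ck_on_sum Ck_on_scaleR S Ck_on_bounded_linear[OF bounded_linear_inner_left] Bk Ck_on_SucD(2))
      show "?g x = ?A' x (B x v) u" if x: "x \<in> S" for x
      proof -
        have "((\<lambda>y. \<Sum>b\<in>Basis. (B x v \<bullet> b) *\<^sub>R A y b) has_derivative (\<lambda>u. \<Sum>b\<in>Basis. (B x v \<bullet> b) *\<^sub>R ?A' x b u)) (at x)"
          using Suc.prems x by (intro has_derivative_sum has_derivative_scaleR_right Ck_on_SucD(1))
        then have "((\<lambda>y. A y (B x v)) has_derivative (\<lambda>u. \<Sum>b\<in>Basis. (B x v \<bullet> b) *\<^sub>R ?A' x b u)) (at x)"
          by (rule has_derivative_transform_within_open[OF _ S x]) (simp add: linear_expand_Basis[OF lin(1), symmetric])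
        from fun_cong[OF frechet_derivative_at[OF this], of u] show ?thesis .
      qed
    qed
    then show "Ck_on k (\<lambda>x. ?B' x u) S"
      by (intro Ck_on_minus Ck_on_sum Ck_on_scaleR S Ck_on_bounded_linear[OF bounded_linear_inner_left] Bk)
  qed
qed

lemma smooth_on_frechet:
  assumes "smooth_on S f"
  shows "x \<in> S \<Longrightarrow> (f has_derivative frechet_derivative f (at x)) (at x)"
    and "smooth_on S (\<lambda>x. frechet_derivative f (at x) v)"
  using assms Ck_on_SucD unfolding smooth_on_def by blast+

lemma smooth_on_imp_continuous_on: "smooth_on S f \<Longrightarrow> continuous_on S f"
  unfolding smooth_on_def by (metis Ck_on.simps(1))

lemma smooth_on_subset: "smooth_on S f \<Longrightarrow> T \<subseteq> S \<Longrightarrow> smooth_on T f"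
  unfolding smooth_on_def using Ck_on_subset by blast

lemma smooth_on_cong:
  assumes "open S" "\<And>x. x \<in> S \<Longrightarrow> f x = g x" "smooth_on S f"
  shows "smooth_on S g"
  using assms Ck_on_cong unfolding smooth_on_def by blast

lemma smooth_on_const: "open S \<Longrightarrow> smooth_on S (\<lambda>x. c)"
  by (simp add: smooth_on_def Ck_on_const)

lemma smooth_on_ident: "open S \<Longrightarrow> smooth_on S (\<lambda>x. x)"
  by (simp add: smooth_on_def Ck_on_ident)

lemma smooth_on_add: "open S \<Longrightarrow> smooth_on S f \<Longrightarrow> smooth_on S g \<Longrightarrow> smooth_on S (\<lambda>x. f x + g x)"
  by (simp add: smooth_on_def Ck_on_add)

lemma smooth_on_linear:
  fixes L :: "'b::euclidean_space \<Rightarrow> 'c::real_normed_vector"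
  assumes "linear L" "open S" "smooth_on S f"
  shows "smooth_on S (\<lambda>x. L (f x))"
  using assms Ck_on_bounded_linear linear_conv_bounded_linear unfolding smooth_on_def by blast

lemma smooth_on_compose:
  fixes f :: "'x::real_normed_vector \<Rightarrow> 'a::euclidean_space"
  assumes "open S" "open T" "f ` S \<subseteq> T" "smooth_on S f" "smooth_on T g"
  shows "smooth_on S (\<lambda>x. g (f x))"
  using assms Ck_on_compose unfolding smooth_on_def by blast

text \<open>The \<open>C\<^sup>1\<close> inverse function theorem provides a differentiable inverse
  \<open>g\<close> whose derivative at \<open>y\<close> is the inverse of the derivative of
  \<open>f\<close> at \<open>g y\<close>. So if \<open>g\<close> is of class
  \<open>C\<^sup>k\<close>, its derivative is too.\<close>

theorem smooth_inverse_function_theorem: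
  fixes f :: "'a::euclidean_space \<Rightarrow> 'a"
  assumes S: "open S" "x0 \<in> S" and f: "smooth_on S f"
    and D: "(f has_derivative D) (at x0)" "\<And>v. D v = 0 \<Longrightarrow> v = 0"
  obtains U V g g' where "open U" "x0 \<in> U" "U \<subseteq> S" "open V" "homeomorphism U V f g"
    "smooth_on U f" "smooth_on V g"
    "(g has_derivative g') (at (f x0))" "\<And>v. g' (D v) = v"
proof -
  define f' where "f' x = Blinfun (frechet_derivative f (at x))" for x
  have f'_apply: "blinfun_apply (f' x) = frechet_derivative f (at x)" if "x \<in> S" for x
    using smooth_on_frechet(1)[OF f that] has_derivative_bounded_linear
    unfolding f'_def by (blast intro: bounded_linear_Blinfun_apply)
  have cont: "continuous_on S f'"
  proof (rule continuous_on_blinfun_componentwise)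
    fix i :: 'a
    have "continuous_on S (\<lambda>x. frechet_derivative f (at x) i)"
      using smooth_on_frechet(2)[OF f] smooth_on_imp_continuous_on by blast
    then show "continuous_on S (\<lambda>x. blinfun_apply (f' x) i)"
      using f'_apply continuous_on_cong by force
  qed
  have Deq: "frechet_derivative f (at x0) = D"
    using frechet_derivative_at[OF D(1)] by simp
  have linD: "linear D" using D(1) has_derivative_linear by blast
  have injD: "inj D" using linD D(2) linear_injective_0 by blast
  obtain D' where D': "linear D'" "D' \<circ> D = id"
    using linear_injective_left_inverse[OF linD injD] by blast
  have "Blinfun D' o\<^sub>L f' x0 = id_blinfun"
  proof (rule blinfun_eqI)
    fix v
    have "bounded_linear D'" using D' linear_conv_bounded_linear by blast
    then show "blinfun_apply (Blinfun D' o\<^sub>L f' x0) v = blinfun_apply id_blinfun v"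
      using D'(2) Deq f'_apply[OF S(2)]
      by (simp add: bounded_linear_Blinfun_apply) (metis comp_apply id_apply)
  qed
  then obtain U V g g' where *: "open U" "U \<subseteq> S" "x0 \<in> U" "open V" "f x0 \<in> V" "homeomorphism U V f g"
    "\<And>y. y \<in> V \<Longrightarrow> (g has_derivative (g' y)) (at y)"
    "\<And>y. y \<in> V \<Longrightarrow> g' y = inv (blinfun_apply (f'(g y)))"
    "\<And>y. y \<in> V \<Longrightarrow> bij (blinfun_apply (f'(g y)))"
    using inverse_function_theorem[OF S(1) _ cont S(2)] f'_apply smooth_on_frechet(1)[OF f] by metis
  have gV: "g y \<in> U" if "y \<in> V" for y using *(6) that by (metis homeomorphism_def imageI)
  define A where "A y = frechet_derivative f (at (g y))" for y
  have A: "blinfun_apply (f' (g y)) = A y" if "y \<in> V" for y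
    using f'_apply gV[OF that] *(2) unfolding A_def by blast
  have g'A: "g' y (A y v) = v" "A y (g' y v) = v" if "y \<in> V" for y v
    using *(8,9)[OF that] A[OF that] by (simp_all add: bij_is_inj bij_is_surj surj_f_inv_f)
  have linA: "linear (A y)" if "y \<in> V" for y
    unfolding A[OF that, symmetric]
    using blinfun.bounded_linear_right linear_conv_bounded_linear by blast
  have "Ck_on k g V" for k
  proof (induction k)
    case 0
    then show ?case using *(6) homeomorphism_def by simp blast
  next
    case (Suc k)
    show ?case
    proof (rule Ck_on_SucI[OF *(4,7)])
      fix v
      show "Ck_on k (\<lambda>x. g' x v) V"
      proof (rule Ck_on_linear_inverse[OF *(4) linA])
        show "linear (g' y)" if "y \<in> V" for y using *(7)[OF that] has_derivative_linear by blast
        show "Ck_on k (\<lambda>x. A x v) V" for v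
          unfolding A_def
        proof (rule Ck_on_compose[OF *(4) *(1) _ Suc])
          show "g ` V \<subseteq> U" using gV by blast
          show "Ck_on k (\<lambda>x. frechet_derivative f (at x) v) U"
            using smooth_on_frechet(2)[OF f] *(2) Ck_on_subset unfolding smooth_on_def by blast
        qed
      qed (use g'A in auto)
    qed
  qed
  then have "smooth_on V g" by (simp add: smooth_on_def)
  moreover have "g' (f x0) (D v) = v" for v
    using g'A(1)[OF *(5), of v] *(3,6) Deq unfolding A_def by (simp add: homeomorphism_def)
  ultimately show thesis
    using that[OF *(1,3,2,4,6) smooth_on_subset[OF f *(2)]] *(5,7) by blast
qed

section \<open>Level sets and their immersed images\<close>

lemma orthogonal_projection_exists:
  fixes K :: "'a::euclidean_space set"
  assumes "subspace K"
  obtains P where "linear P" "\<And>x. P x \<in> K" "\<And>x. x \<in> K \<Longrightarrow> P x = x" "\<And>x k. k \<in> K \<Longrightarrow> (x - P x) \<bullet> k = 0"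
proof -
  obtain B where B: "B \<subseteq> K" "pairwise orthogonal B" "\<And>x. x \<in> B \<Longrightarrow> norm x = 1"
    "independent B" "span B = K"
    using orthonormal_basis_subspace[OF assms] by metis
  have fin: "finite B" using B(4) independent_imp_finite by blast
  define P where "P x = (\<Sum>b\<in>B. (x \<bullet> b) *\<^sub>R b)" for x
  have lin: "linear P" unfolding P_def
    by (rule linearI) (simp_all add: inner_add_left scaleR_add_left sum.distrib scaleR_sum_right)
  have PK: "P x \<in> K" for x
    unfolding P_def using B(1) assms by (intro subspace_sum subspace_scale) auto
  have bb: "b \<bullet> b' = (if b = b' then 1 else 0)" if "b \<in> B" "b' \<in> B" for b b'
    using B(2,3) that by (auto simp: pairwise_def orthogonal_def norm_eq_1)
  have Pb: "P x \<bullet> b = x \<bullet> b" if "b \<in> B" for x b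
  proof -
    have "P x \<bullet> b = (\<Sum>b'\<in>B. (x \<bullet> b') * (b' \<bullet> b))" by (simp add: P_def inner_sum_left)
    also have "\<dots> = (\<Sum>b'\<in>B. if b' = b then x \<bullet> b' else 0)"
      by (rule sum.cong) (auto simp: bb that)
    finally show ?thesis using fin that by simp
  qed
  have orth: "(x - P x) \<bullet> k = 0" if "k \<in> K" for x k
  proof -
    have "k \<in> span B" using that B(5) by simp
    then show ?thesis
      by (induction rule: span_induct_alt) (simp_all add: Pb inner_add_right inner_diff_left)
  qed
  have "P x = x" if "x \<in> K" for x
  proof -
    have "x - P x \<in> K" using that PK assms subspace_diff by blast
    from orth[OF this, of x] show ?thesis by simp
  qed
  then show thesis using that lin PK orth by blast
qed

lemma subspace_kernel: "linear D \<Longrightarrow> subspace {v. D v = 0}"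
  by (rule linear_subspace_kernel)

text \<open>Rank and nullity: the kernel is the orthogonal complement of the range of the adjoint, which has the
  dimension of the target because the adjoint of a surjective map is injective.\<close>

lemma dim_kernel_surj:
  fixes D :: "'a::euclidean_space \<Rightarrow> 'b::euclidean_space"
  assumes "linear D" "surj D"
  shows "dim {v. D v = 0} + DIM('b) = DIM('a)"
proof -
  let ?K = "{v. D v = 0}" and ?R = "range (adjoint D)"
  have adj: "adjoint D y \<bullet> x = y \<bullet> D x" for x y
    using adjoint_works[OF assms(1)] by (simp add: inner_commute)
  have "inj (adjoint D)"
  proof (rule linear_injective_0[THEN iffD2, OF adjoint_linear[OF assms(1)]], intro allI impI)
    fix y assume "adjoint D y = 0"
    moreover obtain x where "D x = y" using assms(2) by (metis surjD)
    ultimately show "y = 0" using adj[of y x] by simp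
  qed
  then have dimR: "dim ?R = DIM('b)"
    using dim_image_eq[OF adjoint_linear[OF assms(1)], of UNIV] by (simp add: dim_UNIV)
  have "{v \<in> UNIV. \<forall>x\<in>?R. orthogonal x v} = ?K"
  proof safe
    fix v assume "\<forall>x\<in>?R. orthogonal x v"
    then have "adjoint D (D v) \<bullet> v = 0" by (auto simp: orthogonal_def)
    then show "D v = 0" using adj by simp
  qed (auto simp: orthogonal_def adj)
  moreover have "subspace ?R" by (rule linear_subspace_image[OF adjoint_linear[OF assms(1)] subspace_UNIV])
  ultimately have "dim ?K + dim ?R = dim (UNIV :: 'a set)"
    using dim_subspace_orthogonal_to_vectors[of ?R UNIV] by (metis subspace_UNIV subset_UNIV)
  then show ?thesis using dimR by (simp only: dim_UNIV)
qed

text \<open>With \<open>P\<close> the orthogonal projection onto the kernel of \<open>D\<close> and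
  \<open>D\<^sup>T\<close> the adjoint, the map \<open>x \<mapsto> D\<^sup>T (g x) + P (x -
  q)\<close> has the invertible derivative \<open>D\<^sup>T D + P\<close> at \<open>q\<close>. It
  straightens the zero set of \<open>g\<close>, because its component orthogonal to the kernel is
  \<open>D\<^sup>T (g x)\<close> and \<open>D\<^sup>T\<close> is injective. Since the derivative is
  the identity on the kernel, so is that of the inverse chart.\<close>

lemma smooth_level_set_chart:
  fixes g :: "'a::euclidean_space \<Rightarrow> 'b::euclidean_space"
  assumes S: "open S" "q \<in> S" and g: "smooth_on S g" "g q = 0"
    and D: "(g has_derivative D) (at q)" "surj D"
  obtains U V \<phi> \<psi> \<psi>' where "open U" "q \<in> U" "U \<subseteq> S" "open V" "homeomorphism U V \<phi> \<psi>"
    "smooth_on U \<phi>" "smooth_on V \<psi>" "\<phi> q = 0"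
    "\<phi> ` {x \<in> U. g x = 0} = V \<inter> {v. D v = 0}"
    "(\<psi> has_derivative \<psi>') (at 0)" "\<And>v. D v = 0 \<Longrightarrow> \<psi>' v = v"
proof -
  have lin: "linear D" using D(1) has_derivative_linear by blast
  let ?K = "{v. D v = 0}"
  obtain P where P: "linear P" "\<And>x. P x \<in> ?K" "\<And>x. x \<in> ?K \<Longrightarrow> P x = x" "\<And>x k. k \<in> ?K \<Longrightarrow> (x - P x) \<bullet> k = 0"
    using orthogonal_projection_exists[OF subspace_kernel[OF lin]] by blast
  let ?B = "adjoint D"
  have linB: "linear ?B" using adjoint_linear[OF lin] .
  have adj: "?B y \<bullet> x = y \<bullet> D x" for x y
    using adjoint_works[OF lin] by (simp add: inner_commute)
  have Binj: "y = 0" if "D (?B y) = 0" for y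
  proof -
    have "?B y \<bullet> ?B y = 0" using adj[of y "?B y"] that by simp
    then have "?B y = 0" by simp
    moreover obtain x where "D x = y" using D(2) by (metis surjD)
    ultimately show "y = 0" using adj[of y x] by simp
  qed
  define \<phi> where "\<phi> x = ?B (g x) + P (x - q)" for x
  define E where "E v = ?B (D v) + P v" for v
  have smooth: "smooth_on S \<phi>"
    unfolding \<phi>_def
    using smooth_on_add[OF S(1) smooth_on_linear[OF linB S(1) g(1)]
      smooth_on_linear[OF P(1) S(1) smooth_on_add[OF S(1) smooth_on_ident[OF S(1)] smooth_on_const[OF S(1), of "-q"]]]]
    by simp
  have der: "(\<phi> has_derivative E) (at q)"
    unfolding \<phi>_def E_def
    using bounded_linear.has_derivative[OF linB[unfolded linear_conv_bounded_linear] D(1)]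
      bounded_linear.has_derivative[OF P(1)[unfolded linear_conv_bounded_linear]
        has_derivative_diff[OF has_derivative_ident has_derivative_const[of q]]]
    by (intro has_derivative_add) auto
  have Einj: "v = 0" if "E v = 0" for v
  proof -
    have "D (E v) = D (?B (D v))" using P(2)[of v] lin by (simp add: E_def linear_add)
    then have "D v = 0" using Binj that lin by (simp add: linear_0)
    then show ?thesis using that P(3)[of v] linB by (simp add: E_def linear_0)
  qed
  have \<phi>q: "\<phi> q = 0" using g(2) linB P(1) by (simp add: \<phi>_def linear_0)
  obtain U V \<psi> \<psi>' where *: "open U" "q \<in> U" "U \<subseteq> S" "open V" "homeomorphism U V \<phi> \<psi>"
    "smooth_on U \<phi>" "smooth_on V \<psi>" "(\<psi> has_derivative \<psi>') (at (\<phi> q))" "\<And>v. \<psi>' (E v) = v"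
    using smooth_inverse_function_theorem[OF S smooth der Einj] by metis
  have eq: "g x = 0 \<longleftrightarrow> D (\<phi> x) = 0" for x
  proof -
    have "D (\<phi> x) = D (?B (g x))" using P(2)[of "x - q"] lin by (simp add: \<phi>_def linear_add)
    then show ?thesis using Binj linB lin by (metis linear_0)
  qed
  have "\<phi> ` {x \<in> U. g x = 0} = V \<inter> ?K"
  proof (intro set_eqI iffI)
    fix y assume "y \<in> V \<inter> ?K"
    then have "\<psi> y \<in> U" "\<phi> (\<psi> y) = y" "D y = 0" using *(5) by (auto simp: homeomorphism_def)
    then show "y \<in> \<phi> ` {x \<in> U. g x = 0}" using eq by (metis (mono_tags, lifting) image_eqI mem_Collect_eq)
  next
    fix y assume "y \<in> \<phi> ` {x \<in> U. g x = 0}"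
    then obtain x where "x \<in> U" "g x = 0" "y = \<phi> x" by blast
    then show "y \<in> V \<inter> ?K" using eq[of x] homeomorphism_image1[OF *(5)] by blast
  qed
  moreover have "\<psi>' v = v" if "D v = 0" for v
    using *(9)[of v] that P(3)[of v] linB by (simp add: E_def linear_0)
  ultimately show thesis using that[OF *(1-7) \<phi>q _ *(8)[unfolded \<phi>q]] by blast
qed

text \<open>Curves in the zero set have velocities in the kernel by the chain rule; conversely the straight line
  through a kernel vector is bent into the level set by the inverse chart.\<close>

lemma tangent_space_level_set:
  fixes g :: "'a::euclidean_space \<Rightarrow> 'b::euclidean_space"
  assumes S: "open S" "q \<in> S" and g: "smooth_on S g" "M \<inter> S = {x \<in> S. g x = 0}" "q \<in> M"
    and D: "(g has_derivative D) (at q)" "surj D"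
  shows "tangent_space M q = {v. D v = 0}"
proof (intro set_eqI iffI)
  fix v assume "v \<in> tangent_space M q"
  then obtain \<gamma> e where \<gamma>: "e > 0" "smooth_on {-e<..<e} \<gamma>" "\<gamma> ` {-e<..<e::real} \<subseteq> M" "\<gamma> 0 = q"
    "(\<gamma> has_vector_derivative v) (at 0)"
    unfolding tangent_space_def by blast
  have "((\<lambda>t. g (\<gamma> t)) has_derivative (\<lambda>t. D (t *\<^sub>R v))) (at 0)"
    using has_derivative_compose[of \<gamma> "\<lambda>t. t *\<^sub>R v" 0 UNIV g D] \<gamma>(4,5) D(1)
    by (simp add: has_vector_derivative_def)
  moreover have "((\<lambda>t. g (\<gamma> t)) has_derivative (\<lambda>t. 0)) (at 0)"
  proof -
    have "isCont \<gamma> 0" using \<gamma>(5) has_vector_derivative_continuous by blast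
    then obtain N where N: "open N" "0 \<in> N" "\<And>t. t \<in> N \<Longrightarrow> \<gamma> t \<in> S"
      unfolding continuous_at_open using S \<gamma>(4) by metis
    show ?thesis
    proof (rule has_derivative_transform_within_open[OF has_derivative_const[of 0]])
      show "open (N \<inter> {-e<..<e})" using N(1) by (simp add: open_Int)
      show "0 \<in> N \<inter> {-e<..<e}" using N(2) \<gamma>(1) by simp
      show "0 = g (\<gamma> t)" if "t \<in> N \<inter> {-e<..<e}" for t
      proof -
        have "\<gamma> t \<in> M \<inter> S" using that N(3)[of t] \<gamma>(3) by (simp add: image_subset_iff)
        then show ?thesis unfolding g(2) by simp
      qed
    qed
  qed
  ultimately have "D (1 *\<^sub>R v) = 0" using has_derivative_unique by metis
  then show "v \<in> {v. D v = 0}" by simp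
next
  fix v assume "v \<in> {v. D v = 0}"
  then have Dv: "D v = 0" by simp
  have lin: "linear D" using D(1) has_derivative_linear by blast
  have gq: "g q = 0" using g(2,3) S(2) by blast
  obtain U V \<phi> \<psi> \<psi>' where *: "open U" "q \<in> U" "U \<subseteq> S" "open V" "homeomorphism U V \<phi> \<psi>"
    "smooth_on U \<phi>" "smooth_on V \<psi>" "\<phi> q = 0"
    "\<phi> ` {x \<in> U. g x = 0} = V \<inter> {v. D v = 0}"
    "(\<psi> has_derivative \<psi>') (at 0)" "\<And>v. D v = 0 \<Longrightarrow> \<psi>' v = v"
    by (rule smooth_level_set_chart[OF S g(1) gq D]) (rule that)
  have V0: "0 \<in> V" using *(2,5,8) by (metis homeomorphism_def image_eqI)
  have "open ((\<lambda>t::real. t *\<^sub>R v) -` V)"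
    using *(4) by (intro open_vimage) (auto intro!: continuous_intros)
  then obtain e where e: "e > 0" "ball 0 e \<subseteq> (\<lambda>t::real. t *\<^sub>R v) -` V"
    using V0 by (metis openE scaleR_zero_left vimage_eq)
  have inV: "t *\<^sub>R v \<in> V" if "t \<in> {-e<..<e}" for t
    using e(2) that by (auto simp: ball_def dist_real_def subset_iff abs_less_iff)
  define \<gamma> where "\<gamma> t = \<psi> (t *\<^sub>R v)" for t :: real
  have "smooth_on {-e<..<e} \<gamma>"
    unfolding \<gamma>_def
  proof (rule smooth_on_compose[OF _ *(4) _ _ *(7)])
    show "smooth_on {-e<..<e} (\<lambda>t. t *\<^sub>R v)"
      by (rule smooth_on_linear[OF bounded_linear.linear[OF bounded_linear_scaleR_left]])
         (simp_all add: smooth_on_ident)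
  qed (use inV in auto)
  moreover have "\<gamma> ` {-e<..<e} \<subseteq> M"
  proof
    fix x assume "x \<in> \<gamma> ` {-e<..<e}"
    then obtain t where t: "t \<in> {-e<..<e}" "x = \<psi> (t *\<^sub>R v)" by (auto simp: \<gamma>_def)
    have "t *\<^sub>R v \<in> V \<inter> {v. D v = 0}" using inV[OF t(1)] Dv lin by (simp add: linear_cmul)
    then have "t *\<^sub>R v \<in> \<phi> ` {x \<in> U. g x = 0}" using *(9) by simp
    then obtain y where y: "y \<in> U" "g y = 0" "\<phi> y = t *\<^sub>R v" by auto
    then have "x = y" using t(2) homeomorphism_apply1[OF *(5) y(1)] by simp
    moreover have "y \<in> {x \<in> S. g x = 0}" using y *(3) by blast
    ultimately show "x \<in> M" unfolding g(2)[symmetric] by simp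
  qed
  moreover have "\<gamma> 0 = q" using *(2,5,8) homeomorphism_apply1[OF *(5) *(2)] by (simp add: \<gamma>_def)
  moreover have "(\<gamma> has_vector_derivative v) (at 0)"
  proof -
    have 1: "((\<lambda>t::real. t *\<^sub>R v) has_derivative (\<lambda>t. t *\<^sub>R v)) (at 0)"
      by (auto intro!: derivative_eq_intros)
    have "(\<gamma> has_derivative (\<lambda>t. \<psi>' (t *\<^sub>R v))) (at 0)"
      unfolding \<gamma>_def using has_derivative_compose[OF 1, of \<psi> \<psi>'] *(10) by simp
    moreover have "\<psi>' (t *\<^sub>R v) = t *\<^sub>R v" for t
      using *(11) Dv lin by (simp add: linear_cmul)
    ultimately show ?thesis by (simp add: has_vector_derivative_def)
  qed
  ultimately show "v \<in> tangent_space M q" unfolding tangent_space_def mem_Collect_eq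
    by (intro exI[of _ \<gamma>] exI[of _ e] conjI e(1))
qed

lemma embedded_submanifold_single_chart:
  fixes U U' :: "'a::euclidean_space set"
  assumes "open U" "S \<subseteq> U" "open U'" "homeomorphism U U' \<phi> \<psi>" "smooth_on U \<phi>" "smooth_on U' \<psi>"
    "subspace E" "\<phi> ` S = U' \<inter> E"
  shows "embedded_submanifold (dim E) S"
proof -
  have "open U \<and> x \<in> U \<and> open U' \<and> homeomorphism U U' \<phi> \<psi> \<and> smooth_on U \<phi> \<and> smooth_on U' \<psi> \<and>
      subspace E \<and> dim E = dim E \<and> \<phi> ` (S \<inter> U) = U' \<inter> E" if "x \<in> S" for x
    using assms that by (auto simp: Int_absorb2)
  note chart = this
  show ?thesis unfolding embedded_submanifold_def
  proof
    fix x assume "x \<in> S"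
    from chart[OF this] show "\<exists>U U' \<phi> \<psi> Ea. open (U :: 'a set) \<and> x \<in> U \<and> open (U' :: 'a set) \<and> homeomorphism U U' \<phi> \<psi> \<and>
        smooth_on U \<phi> \<and> smooth_on U' \<psi> \<and> subspace Ea \<and> dim Ea = dim E \<and> \<phi> ` (S \<inter> U) = U' \<inter> Ea"
      by (intro exI)
  qed
qed

lemma embedded_submanifold_Int_open:
  fixes S :: "'a::euclidean_space set"
  assumes S: "embedded_submanifold d S" and W: "open W"
  shows "embedded_submanifold d (S \<inter> W)"
  unfolding embedded_submanifold_def
proof
  fix x assume x: "x \<in> S \<inter> W"
  then obtain U U' \<phi> \<psi> E where *: "open (U :: 'a set)" "x \<in> U" "open (U' :: 'a set)"
        "homeomorphism U U' \<phi> \<psi>" "smooth_on U \<phi>" "smooth_on U' \<psi>"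
        "subspace E" "dim E = d" "\<phi> ` (S \<inter> U) = U' \<inter> E"
    using S unfolding embedded_submanifold_def by (metis IntD1)
  let ?U = "U \<inter> W" and ?U' = "U' \<inter> \<psi> -` W"
  have op: "open ?U'"
    using *(3,6) W by (simp add: continuous_open_preimage smooth_on_imp_continuous_on)
  have h: "\<And>x. x \<in> U \<Longrightarrow> \<phi> x \<in> U' \<and> \<psi> (\<phi> x) = x" "\<And>y. y \<in> U' \<Longrightarrow> \<psi> y \<in> U \<and> \<phi> (\<psi> y) = y"
    using *(4) by (auto simp: homeomorphism_def)
  have im: "\<phi> ` ?U = ?U'"
  proof (intro set_eqI iffI)
    fix y assume "y \<in> ?U'"
    then show "y \<in> \<phi> ` ?U" using h(2)[of y] by (intro image_eqI[of _ _ "\<psi> y"]) auto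
  qed (use h(1) in auto)
  have hom: "homeomorphism ?U ?U' \<phi> \<psi>"
    using homeomorphism_of_subsets[OF *(4), of ?U ?U'] im by auto
  have "\<phi> ` (S \<inter> W \<inter> ?U) = ?U' \<inter> E"
  proof (intro set_eqI iffI)
    fix y assume y: "y \<in> ?U' \<inter> E"
    then have "y \<in> \<phi> ` (S \<inter> U)" using *(9) by blast
    then obtain s where s: "s \<in> S" "s \<in> U" "y = \<phi> s" by blast
    then show "y \<in> \<phi> ` (S \<inter> W \<inter> ?U)" using y h(1)[of s] by auto
  next
    fix y assume "y \<in> \<phi> ` (S \<inter> W \<inter> ?U)"
    then show "y \<in> ?U' \<inter> E" using *(9) im by auto
  qed
  then have "open ?U \<and> x \<in> ?U \<and> open ?U' \<and> homeomorphism ?U ?U' \<phi> \<psi> \<and> smooth_on ?U \<phi> \<and> smooth_on ?U' \<psi> \<and>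
      subspace E \<and> dim E = d \<and> \<phi> ` (S \<inter> W \<inter> ?U) = ?U' \<inter> E"
    using op hom *(1,2,5-8) W x by (auto intro: smooth_on_subset[of U] smooth_on_subset[of U'])
  then show "\<exists>U U' \<phi> \<psi> E. open (U :: 'a set) \<and> x \<in> U \<and> open (U' :: 'a set) \<and>
        homeomorphism U U' \<phi> \<psi> \<and> smooth_on U \<phi> \<and> smooth_on U' \<psi> \<and>
        subspace E \<and> dim E = d \<and> \<phi> ` (S \<inter> W \<inter> U) = U' \<inter> E"
    by (intro exI)
qed

lemma embedded_submanifold_level_set:
  fixes g :: "'a::euclidean_space \<Rightarrow> 'b::euclidean_space"
  assumes S: "open S" "q \<in> S" and g: "smooth_on S g" "M \<inter> S = {x \<in> S. g x = 0}" "q \<in> M"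
    and D: "(g has_derivative D) (at q)" "surj D"
  obtains U where "open U" "q \<in> U" "U \<subseteq> S" "embedded_submanifold (dim {v. D v = 0}) (M \<inter> U)"
proof -
  have lin: "linear D" using D(1) has_derivative_linear by blast
  have gq: "g q = 0" using g(2,3) S(2) by blast
  obtain U V \<phi> \<psi> \<psi>' where *: "open U" "q \<in> U" "U \<subseteq> S" "open V" "homeomorphism U V \<phi> \<psi>"
    "smooth_on U \<phi>" "smooth_on V \<psi>" "\<phi> q = 0"
    "\<phi> ` {x \<in> U. g x = 0} = V \<inter> {v. D v = 0}"
    "(\<psi> has_derivative \<psi>') (at 0)" "\<And>v. D v = 0 \<Longrightarrow> \<psi>' v = v"
    by (rule smooth_level_set_chart[OF S g(1) gq D]) (rule that)
  have "M \<inter> U = {x \<in> U. g x = 0}" using g(2) *(3) by blast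
  then have "embedded_submanifold (dim {v. D v = 0}) (M \<inter> U)"
    using embedded_submanifold_single_chart[OF *(1) _ *(4-7) subspace_kernel[OF lin] *(9)] by auto
  then show thesis using that * by blast
qed

text \<open>The image is straightened inside the target space. Let \<open>H = Dh ` ker D\<close>, let
  \<open>P\<close> be the orthogonal projection onto \<open>H\<close> and \<open>A\<close> the map
  that first projects to \<open>H\<close> and then inverts \<open>Dh\<close> on the kernel. If
  \<open>\<psi>\<close> parametrises the level set over the kernel, then \<open>\<Psi> y = h (\<psi>
  (A y)) + (y - P y)\<close> has the identity as derivative at \<open>0\<close> and restricts on
  \<open>H\<close> to a parametrisation of the image. A single chart covers the whole image of the
  small piece \<open>M \<inter> U\<close>.\<close>

lemma immersed_level_set_image:
  fixes g :: "'a::euclidean_space \<Rightarrow> 'b::euclidean_space" and h :: "'a \<Rightarrow> 'c::euclidean_space"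
  assumes S: "open S" "q \<in> S" and g: "smooth_on S g" "M \<inter> S = {x \<in> S. g x = 0}" "q \<in> M"
    and D: "(g has_derivative D) (at q)" "surj D"
    and h: "smooth_on S h" "(h has_derivative Dh) (at q)"
    and inj: "\<And>v. D v = 0 \<Longrightarrow> Dh v = 0 \<Longrightarrow> v = 0"
    and N: "open N" "q \<in> N"
  obtains U W W' \<phi> \<psi> and H :: "'c set" where "open U" "q \<in> U" "U \<subseteq> N" "open W" "open W'" "homeomorphism W W' \<phi> \<psi>"
    "smooth_on W \<phi>" "smooth_on W' \<psi>" "subspace H" "dim H = dim {v. D v = 0}"
    "h ` (M \<inter> U) \<subseteq> W" "\<phi> ` (h ` (M \<inter> U)) = W' \<inter> H"
proof -
  have lin: "linear D" using D(1) has_derivative_linear by blast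
  have linh: "linear Dh" using h(2) has_derivative_linear by blast
  have gq: "g q = 0" using g(2,3) S(2) by blast
  let ?K = "{v. D v = 0}"
  have subK: "subspace ?K" by (rule subspace_kernel[OF lin])
  obtain U V \<phi> \<psi> \<psi>' where *: "open U" "q \<in> U" "U \<subseteq> S" "open V" "homeomorphism U V \<phi> \<psi>"
    "smooth_on U \<phi>" "smooth_on V \<psi>" "\<phi> q = 0"
    "\<phi> ` {x \<in> U. g x = 0} = V \<inter> ?K"
    "(\<psi> has_derivative \<psi>') (at 0)" "\<And>v. D v = 0 \<Longrightarrow> \<psi>' v = v"
    by (rule smooth_level_set_chart[OF S g(1) gq D]) (rule that)
  have hom: "\<And>x. x \<in> U \<Longrightarrow> \<phi> x \<in> V \<and> \<psi> (\<phi> x) = x" "\<And>y. y \<in> V \<Longrightarrow> \<psi> y \<in> U \<and> \<phi> (\<psi> y) = y"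
    using *(5) by (auto simp: homeomorphism_def)
  have mem: "D (\<phi> x) = 0 \<longleftrightarrow> x \<in> M" if "x \<in> U" for x
  proof -
    have "x \<in> M \<longleftrightarrow> g x = 0" using g(2) *(3) that by blast
    also have "\<dots> \<longleftrightarrow> \<phi> x \<in> \<phi> ` {x \<in> U. g x = 0}" using that hom(1) by (auto simp: image_iff) metis
    also have "\<dots> \<longleftrightarrow> D (\<phi> x) = 0" using *(9) hom(1)[OF that] by blast
    finally show ?thesis by simp
  qed
  define H where "H = Dh ` ?K"
  have subH: "subspace H" unfolding H_def by (rule linear_subspace_image[OF linh subK])
  have injK: "inj_on Dh ?K"
    using linear_injective_on_subspace_0[OF linh subK] inj by auto
  have dimH: "dim H = dim ?K"
    unfolding H_def using dim_image_eq[OF linh, of ?K] injK subK by (metis span_eq_iff)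
  obtain A0 where A0: "linear A0" "\<And>v. v \<in> ?K \<Longrightarrow> A0 (Dh v) = v"
    using linear_exists_left_inverse_on[OF linh subK injK] by blast
  obtain P where P: "linear P" "\<And>x. P x \<in> H" "\<And>x. x \<in> H \<Longrightarrow> P x = x"
    using orthogonal_projection_exists[OF subH] by metis
  define A where "A y = A0 (P y)" for y
  have linA: "linear A" unfolding A_def using linear_compose[OF P(1) A0(1)] by (simp add: o_def)
  have AK: "A y \<in> ?K" "Dh (A y) = P y" for y
    using P(2)[of y] A0(2) unfolding A_def H_def by auto
  have ADh: "A (Dh v) = v" if "v \<in> ?K" for v
    using P(3) A0(2) that unfolding A_def H_def by auto
  define V0 where "V0 = V \<inter> \<psi> -` N"
  have V0: "open V0" unfolding V0_def
    using *(4,7) N by (simp add: continuous_open_preimage smooth_on_imp_continuous_on)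
  have \<psi>0: "\<psi> 0 = q" "0 \<in> V" using hom(1)[OF *(2)] *(8) by auto
  define T where "T = A -` V0"
  have T: "open T" unfolding T_def
    using V0 linA by (intro open_vimage) (auto simp: linear_continuous_on linear_conv_bounded_linear)
  have T0: "0 \<in> T" using \<psi>0 N linA by (simp add: T_def V0_def linear_0)
  define \<Psi> where "\<Psi> y = h (\<psi> (A y)) + (y - P y)" for y
  have "smooth_on T (\<lambda>y. \<psi> (A y))"
    by (rule smooth_on_compose[OF T *(4) _ _ *(7)])
       (use smooth_on_linear[OF linA T smooth_on_ident[OF T]] in \<open>auto simp: T_def V0_def\<close>)
  then have "smooth_on T (\<lambda>y. h (\<psi> (A y)))"
    by (rule smooth_on_compose[OF T S(1) _ _ h(1), rotated]) (use hom(2) *(3) in \<open>auto simp: T_def V0_def\<close>)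
  moreover have "smooth_on T (\<lambda>y. y - P y)"
    using smooth_on_linear[OF linear_compose_sub[OF linear_id P(1)] T smooth_on_ident[OF T]] by simp
  ultimately have smooth: "smooth_on T \<Psi>"
    unfolding \<Psi>_def by (intro smooth_on_add T)
  have der: "(\<Psi> has_derivative (\<lambda>v. v)) (at 0)"
  proof -
    have A': "(A has_derivative A) (at 0)"
      using linA by (simp add: linear_imp_has_derivative)
    have P': "(P has_derivative P) (at 0)"
      using P(1) by (simp add: linear_imp_has_derivative)
    have "((\<lambda>y. \<psi> (A y)) has_derivative (\<lambda>v. \<psi>' (A v))) (at 0)"
      using has_derivative_compose[OF A', of \<psi> \<psi>'] *(10) linA by (simp add: linear_0)
    moreover have "\<psi>' (A v) = A v" for v using AK(1)[of v] *(11) by simp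
    ultimately have "((\<lambda>y. h (\<psi> (A y))) has_derivative (\<lambda>v. Dh (A v))) (at 0)"
      using has_derivative_compose[of "\<lambda>y. \<psi> (A y)" A 0 UNIV h Dh] h(2) linA \<psi>0 by (simp add: linear_0)
    then have "(\<Psi> has_derivative (\<lambda>v. Dh (A v) + (v - P v))) (at 0)"
      unfolding \<Psi>_def by (intro has_derivative_add has_derivative_diff has_derivative_ident P')
    then show ?thesis by (simp add: AK)
  qed
  obtain W' W \<theta> where W: "open W'" "0 \<in> W'" "W' \<subseteq> T" "open W" "homeomorphism W' W \<Psi> \<theta>"
    "smooth_on W' \<Psi>" "smooth_on W \<theta>"
    using smooth_inverse_function_theorem[OF T T0 smooth der] by metis
  \<comment> \<open>chosen so that \<open>M \<inter> U1\<close> is parametrised exactly by \<open>W' \<inter> H\<close>\<close>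
  define U1 where "U1 = {x \<in> U. x \<in> N \<and> Dh (\<phi> x) \<in> W'}"
  have "U1 = (U \<inter> N) \<inter> (\<lambda>x. Dh (\<phi> x)) -` W'" by (auto simp: U1_def)
  moreover have "continuous_on (U \<inter> N) (\<lambda>x. Dh (\<phi> x))"
    using smooth_on_imp_continuous_on[OF smooth_on_linear[OF linh *(1,6)]] continuous_on_subset by blast
  ultimately have U1: "open U1"
    using *(1) N(1) W(1) by (simp add: continuous_open_preimage open_Int)
  have qU1: "q \<in> U1" using * N W(2) linh by (simp add: U1_def linear_0)
  have im: "h ` (M \<inter> U1) = \<Psi> ` (W' \<inter> H)"
  proof (intro set_eqI iffI)
    fix z assume "z \<in> h ` (M \<inter> U1)"
    then obtain x where x: "x \<in> M" "x \<in> U" "x \<in> N" "Dh (\<phi> x) \<in> W'" "z = h x" by (auto simp: U1_def)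
    have k: "\<phi> x \<in> ?K" using mem x by blast
    then have inH: "Dh (\<phi> x) \<in> H" by (auto simp: H_def)
    have "\<Psi> (Dh (\<phi> x)) = h x"
      unfolding \<Psi>_def using ADh[OF k] P(3)[OF inH] hom(1)[OF x(2)] by simp
    then show "z \<in> \<Psi> ` (W' \<inter> H)" using x inH by (metis IntI image_eqI)
  next
    fix z assume "z \<in> \<Psi> ` (W' \<inter> H)"
    then obtain y where y: "y \<in> W'" "y \<in> H" "z = \<Psi> y" by blast
    have AV: "A y \<in> V" "\<psi> (A y) \<in> N" using y(1) W(3) by (auto simp: T_def V0_def)
    let ?x = "\<psi> (A y)"
    have "?x \<in> U" "\<phi> ?x = A y" using hom(2)[OF AV(1)] by auto
    moreover then have "?x \<in> M" using mem[of ?x] AK(1)[of y] by simp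
    moreover have "Dh (A y) = y" using AK(2) P(3) y(2) by simp
    moreover have "z = h ?x" using y P(3) by (simp add: \<Psi>_def)
    ultimately show "z \<in> h ` (M \<inter> U1)" using AV y(1) by (auto simp: U1_def)
  qed
  have "\<Psi> ` (W' \<inter> H) \<subseteq> W" using W(5) by (auto simp: homeomorphism_def)
  moreover have "\<theta> ` (\<Psi> ` (W' \<inter> H)) = W' \<inter> H"
    using W(5) by (auto simp: homeomorphism_def image_image)
  moreover have "homeomorphism W W' \<theta> \<Psi>" using W(5) homeomorphism_symD by blast
  moreover have "U1 \<subseteq> N" by (auto simp: U1_def)
  ultimately show thesis
    using that[where H = H, OF U1 qU1 _ W(4) W(1) _ W(7) W(6) subH dimH] unfolding im by simp
qed

text \<open>In charts the inclusion of the patch into \<open>S\<close> is an injective continuous map between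
  open pieces of linear spaces of the same dimension, so invariance of domain applies.\<close>

lemma equidimensional_patch_open:
  fixes S :: "'a::euclidean_space set" and W' :: "'b::euclidean_space set"
  assumes S: "embedded_submanifold d S" and W: "open W" "open W'" "homeomorphism W W' \<phi> \<psi>"
    and H: "subspace H" "dim H = d" and B: "B \<subseteq> W" "\<phi> ` B = W' \<inter> H" "B \<subseteq> S" "p \<in> B"
  obtains O' where "open O'" "p \<in> O'" "S \<inter> O' \<subseteq> B"
proof -
  have "p \<in> S" using B by blast
  then obtain U U' \<alpha> \<beta> E where *: "open (U :: 'a set)" "p \<in> U" "open (U' :: 'a set)"
        "homeomorphism U U' \<alpha> \<beta>" "subspace E" "dim E = d" "\<alpha> ` (S \<inter> U) = U' \<inter> E"
    using S unfolding embedded_submanifold_def by metis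
  have h: "\<And>x. x \<in> U \<Longrightarrow> \<alpha> x \<in> U' \<and> \<beta> (\<alpha> x) = x" using *(4) by (auto simp: homeomorphism_def)
  have k: "\<And>x. x \<in> W \<Longrightarrow> \<phi> x \<in> W' \<and> \<psi> (\<phi> x) = x" "\<And>y. y \<in> W' \<Longrightarrow> \<psi> y \<in> W \<and> \<phi> (\<psi> y) = y"
    using W(3) by (auto simp: homeomorphism_def)
  have \<psi>B: "\<psi> y \<in> B" if "y \<in> W' \<inter> H" for y
  proof -
    from that B(2) obtain b where "b \<in> B" "y = \<phi> b" by (metis imageE)
    then show ?thesis using k(1) B(1) by auto
  qed
  define Y where "Y = (W' \<inter> \<psi> -` U) \<inter> H"
  have contW: "continuous_on W' \<psi>" using W(3) by (rule homeomorphism_cont2)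
  have opY: "openin (top_of_set H) Y"
    unfolding Y_def using continuous_open_preimage[OF contW W(2) *(1)]
    by (simp add: Int_commute openin_open_Int)
  have contY: "continuous_on Y (\<lambda>y. \<alpha> (\<psi> y))"
  proof (rule continuous_on_compose2[of U \<alpha>])
    show "continuous_on U \<alpha>" using *(4) by (rule homeomorphism_cont1)
    show "continuous_on Y \<psi>" by (rule continuous_on_subset[OF contW]) (auto simp: Y_def)
  qed (auto simp: Y_def)
  have YE: "(\<lambda>y. \<alpha> (\<psi> y)) \<in> Y \<rightarrow> E"
  proof
    fix y assume "y \<in> Y"
    then have "\<psi> y \<in> S \<inter> U" using \<psi>B B(3) by (auto simp: Y_def)
    then show "\<alpha> (\<psi> y) \<in> E" using *(7) by blast
  qed
  have injY: "inj_on (\<lambda>y. \<alpha> (\<psi> y)) Y"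
  proof (rule inj_onI)
    fix y z assume yz: "y \<in> Y" "z \<in> Y" "\<alpha> (\<psi> y) = \<alpha> (\<psi> z)"
    have mem: "\<psi> y \<in> U" "\<psi> z \<in> U" "y \<in> W'" "z \<in> W'" using yz(1,2) by (auto simp: Y_def)
    have "\<psi> y = \<psi> z" using h[OF mem(1)] h[OF mem(2)] yz(3) by metis
    then show "y = z" using k(2)[OF mem(3)] k(2)[OF mem(4)] by metis
  qed
  have "openin (top_of_set E) ((\<lambda>y. \<alpha> (\<psi> y)) ` Y)"
    
    using invariance_of_domain_subspaces[where f = "\<lambda>y. \<alpha> (\<psi> y)", OF opY H(1) *(5)] contY YE injY H(2) *(6)
    by simp
  then obtain O1 where O1: "open O1" "(\<lambda>y. \<alpha> (\<psi> y)) ` Y = E \<inter> O1"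
    by (auto simp: openin_open)
  define O' where "O' = U \<inter> \<alpha> -` O1"
  have "open O'" unfolding O'_def
    using *(1,4) O1(1) by (simp add: continuous_open_preimage homeomorphism_def)
  moreover have "p \<in> O'"
  proof -
    have "\<phi> p \<in> Y" using B k(1) *(2) by (auto simp: Y_def)
    moreover have "\<psi> (\<phi> p) = p" using B k(1) by blast
    ultimately have "\<alpha> p \<in> E \<inter> O1" using O1(2) by (metis image_eqI)
    then show ?thesis using *(2) by (simp add: O'_def)
  qed
  moreover have "S \<inter> O' \<subseteq> B"
  proof
    fix x assume x: "x \<in> S \<inter> O'"
    then have "\<alpha> x \<in> E \<inter> O1" using *(7) by (auto simp: O'_def)
    then obtain y where y: "y \<in> Y" "\<alpha> x = \<alpha> (\<psi> y)" unfolding O1(2)[symmetric] by (rule imageE) (rule that)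
    moreover have "x \<in> U" "\<psi> y \<in> U" using x y(1) by (auto simp: Y_def O'_def)
    ultimately have "x = \<psi> y" using h by metis
    then show "x \<in> B" using \<psi>B y(1) by (auto simp: Y_def)
  qed
  ultimately show thesis using that by blast
qed

section \<open>Evaluation of polynomials, ideals and minors\<close>

definition monom_eval :: "('v::finite \<Rightarrow>\<^sub>0 nat) \<Rightarrow> real ^ 'v \<Rightarrow> real" where
  "monom_eval m a = (\<Prod>v\<in>UNIV. a $ v ^ Poly_Mapping.lookup m v)"

lemma monom_eval_zero [simp]: "monom_eval 0 a = 1"
  by (simp add: monom_eval_def)

lemma monom_eval_add: "monom_eval (m + m') a = monom_eval m a * monom_eval m' a"
  by (simp add: monom_eval_def lookup_add power_add prod.distrib)

lemma monom_eval_single [simp]: "monom_eval (Poly_Mapping.single v k) a = a $ v ^ k"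
proof -
  have "monom_eval (Poly_Mapping.single v k) a = (\<Prod>w\<in>UNIV. if w = v then a $ v ^ k else 1)"
    unfolding monom_eval_def by (rule prod.cong) (auto simp: lookup_single when_def)
  then show ?thesis by simp
qed

lemma monom_eval_sum: "monom_eval (\<Sum>i\<in>I. m i) a = (\<Prod>i\<in>I. monom_eval (m i) a)"
  by (induction I rule: infinite_finite_induct) (auto simp: monom_eval_add)

lemma rpoly_eval_superset:
  assumes "finite A" "Poly_Mapping.keys P \<subseteq> A"
  shows "rpoly_eval P a = (\<Sum>m\<in>A. Poly_Mapping.lookup P m * monom_eval m a)"
  unfolding rpoly_eval_def monom_eval_def[symmetric]
  by (rule sum.mono_neutral_left[OF assms]) (auto simp: in_keys_iff)

lemma rpoly_eval_zero [simp]: "rpoly_eval 0 a = 0"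
  by (simp add: rpoly_eval_def)

lemma rpoly_eval_single [simp]: "rpoly_eval (Poly_Mapping.single m c) a = c * monom_eval m a"
  by (subst rpoly_eval_superset[of "{m}"]) auto

lemma rpoly_eval_one [simp]: "rpoly_eval 1 a = 1"
  using rpoly_eval_single[of 0 1 a] by simp

lemma rpoly_eval_add [simp]: "rpoly_eval (P + Q) a = rpoly_eval P a + rpoly_eval Q a"
proof -
  let ?A = "Poly_Mapping.keys P \<union> Poly_Mapping.keys Q"
  have "Poly_Mapping.keys (P + Q) \<subseteq> ?A" by (rule keys_add)
  then show ?thesis
    by (simp add: rpoly_eval_superset[of ?A] lookup_add distrib_right sum.distrib)
qed

lemma rpoly_eval_sum: "rpoly_eval (\<Sum>i\<in>I. P i) a = (\<Sum>i\<in>I. rpoly_eval (P i) a)"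
  by (induction I rule: infinite_finite_induct) auto

lemma poly_mapping_sum_single: "(\<Sum>m\<in>Poly_Mapping.keys P. Poly_Mapping.single m (Poly_Mapping.lookup P m)) = P"
  by (rule poly_mapping_eqI) (simp add: lookup_sum lookup_single when_def in_keys_iff)

lemma rpoly_eval_mult [simp]: "rpoly_eval (P * Q) a = rpoly_eval P a * rpoly_eval Q a"
proof -
  have s: "rpoly_eval (Poly_Mapping.single m c * Poly_Mapping.single m' d) a =
      rpoly_eval (Poly_Mapping.single m c) a * rpoly_eval (Poly_Mapping.single m' d) a" for m m' c d
    by (simp add: mult_single monom_eval_add)
  have "rpoly_eval ((\<Sum>m\<in>Poly_Mapping.keys P. Poly_Mapping.single m (Poly_Mapping.lookup P m)) *
      (\<Sum>m\<in>Poly_Mapping.keys Q. Poly_Mapping.single m (Poly_Mapping.lookup Q m))) a =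
     rpoly_eval (\<Sum>m\<in>Poly_Mapping.keys P. Poly_Mapping.single m (Poly_Mapping.lookup P m)) a *
     rpoly_eval (\<Sum>m\<in>Poly_Mapping.keys Q. Poly_Mapping.single m (Poly_Mapping.lookup Q m)) a"
    by (simp only: sum_product rpoly_eval_sum s)
  then show ?thesis by (simp only: poly_mapping_sum_single)
qed

lemma rpoly_eval_uminus [simp]: "rpoly_eval (- P) a = - rpoly_eval P a"
  using rpoly_eval_add[of P "-P" a] by simp

lemma rpoly_eval_diff [simp]: "rpoly_eval (P - Q) a = rpoly_eval P a - rpoly_eval Q a"
  using rpoly_eval_add[of P "-Q" a] by simp

lemma rpoly_eval_power [simp]: "rpoly_eval (P ^ k) a = rpoly_eval P a ^ k"
  by (induction k) auto

lemma rpoly_eval_prod: "rpoly_eval (\<Prod>i\<in>I. P i) a = (\<Prod>i\<in>I. rpoly_eval (P i) a)"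
  by (induction I rule: infinite_finite_induct) auto

lemma rpoly_eval_Var [simp]: "rpoly_eval (Var v) a = a $ v"
  by (simp add: Var_def)

lemma rpoly_eval_rename:
  fixes h :: "'v::finite \<Rightarrow> 'w::finite" and P :: "'v rpoly"
  shows "rpoly_eval (rename h P) a = rpoly_eval P (\<chi> v. a $ h v)"
proof -
  have "monom_eval (rename_monom h m) a = monom_eval m (\<chi> v. a $ h v)" for m :: "'v \<Rightarrow>\<^sub>0 nat"
  proof -
    have "monom_eval (rename_monom h m) a = (\<Prod>v\<in>Poly_Mapping.keys m. a $ h v ^ Poly_Mapping.lookup m v)"
      by (simp add: rename_monom_def monom_eval_sum)
    also have "\<dots> = (\<Prod>v\<in>UNIV. a $ h v ^ Poly_Mapping.lookup m v)"
      by (rule prod.mono_neutral_left) (auto simp: in_keys_iff)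
    finally show ?thesis by (simp add: monom_eval_def)
  qed
  then show ?thesis
    by (simp add: rename_def rpoly_eval_sum rpoly_eval_superset[OF finite_keys order_refl, of P])
qed

lemma ideal_gen_vanish:
  assumes "\<And>p. p \<in> S \<Longrightarrow> rpoly_eval p a = 0" "p \<in> ideal_gen S"
  shows "rpoly_eval p a = 0"
  using assms(2) unfolding ideal_gen_def
  by (rule module.span_induct_alt[OF module_mult_self, of p S "\<lambda>p. rpoly_eval p a = 0"]) (auto simp: assms(1))

lemma saturate_vanish:
  assumes "\<And>p. p \<in> I \<Longrightarrow> rpoly_eval p a = 0" "rpoly_eval h a \<noteq> 0" "p \<in> saturate I h"
  shows "rpoly_eval p a = 0"
proof -
  obtain k where "h ^ k * p \<in> I" using assms(3) by (auto simp: saturate_def)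
  from assms(1)[OF this] show ?thesis using assms(2) by simp
qed

lemma elimination_ideal_vanish:
  fixes N :: "'n::finite \<Rightarrow> 'v::finite rpoly"
  assumes I: "\<And>p. p \<in> I \<Longrightarrow> rpoly_eval p a = 0" and R: "\<And>j. R $ j = rpoly_eval (N j) a"
    and P: "P \<in> elimination_ideal N I"
  shows "rpoly_eval P R = 0"
proof -
  define b :: "real ^ ('v + 'n)" where "b = (\<chi> i. case i of Inl v \<Rightarrow> a $ v | Inr j \<Rightarrow> R $ j)"
  have l: "(\<chi> v. b $ Inl v) = a" and r: "(\<chi> j. b $ Inr j) = R"
    by (simp_all add: b_def vec_eq_iff)
  have "rpoly_eval (rename Inr P) b = 0"
  proof (rule ideal_gen_vanish)
    show "rename Inr P \<in> ideal_gen (rename Inl ` I \<union> range (\<lambda>j. Var (Inr j) - rename Inl (N j)))"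
      using P by (simp add: elimination_ideal_def)
    fix p assume "p \<in> rename Inl ` I \<union> range (\<lambda>j. Var (Inr j) - rename Inl (N j))"
    then show "rpoly_eval p b = 0"
      by (auto simp: rpoly_eval_rename l I R[symmetric]) (simp add: b_def)
  qed
  then show ?thesis by (simp add: rpoly_eval_rename r)
qed

text \<open>A linear dependence of the rows survives the permutation of the rows and any selection of columns.\<close>

lemma minors_vanish_rows:
  fixes A :: "real ^ 'c::finite ^ 'r::finite"
  assumes "rank A < CARD('r)" and \<rho>: "inj (\<rho> :: 'r \<Rightarrow> 'r)"
  shows "det (\<chi> i j. A $ \<rho> i $ \<sigma> j) = (0 :: real)"
proof -
  let ?B = "(\<chi> i j. A $ \<rho> i $ \<sigma> j) :: real ^ 'r ^ 'r"
  have "\<not> inj ((*v) (transpose A))"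
    using assms(1) full_rank_injective[of "transpose A"] by (simp add: rank_transpose)
  then obtain y where y: "y \<noteq> 0" "transpose A *v y = 0"
    using linear_injective_0[OF matrix_vector_mul_linear, of "transpose A"] by blast
  define w :: "real ^ 'r" where "w = (\<chi> i. y $ \<rho> i)"
  have bij: "bij \<rho>" using \<rho> by (simp add: bij_def finite_UNIV_inj_surj[OF finite])
  have "transpose ?B *v w = 0"
  proof (subst vec_eq_iff, intro allI)
    fix j
    have "(transpose ?B *v w) $ j = (\<Sum>i\<in>UNIV. A $ \<rho> i $ \<sigma> j * y $ \<rho> i)"
      by (simp add: matrix_vector_mult_def transpose_def w_def)
    also have "\<dots> = (\<Sum>i\<in>UNIV. A $ i $ \<sigma> j * y $ i)"
      using sum.reindex_bij_betw[OF bij, of "\<lambda>i. A $ i $ \<sigma> j * y $ i"] by simp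
    also have "\<dots> = (transpose A *v y) $ \<sigma> j"
      by (simp add: matrix_vector_mult_def transpose_def)
    finally show "(transpose ?B *v w) $ j = 0 $ j" using y(2) by simp
  qed
  moreover have "w \<noteq> 0"
  proof
    assume w0: "w = 0"
    have "y $ k = 0" for k
    proof -
      obtain i where "k = \<rho> i" using bij by (metis bij_pointE)
      then show ?thesis using w0 by (simp add: w_def vec_eq_iff)
    qed
    then show False using y(1) by (simp add: vec_eq_iff)
  qed
  ultimately have "\<not> invertible (transpose ?B)"
    using matrix_left_invertible_ker[of "transpose ?B"] invertible_left_inverse by blast
  then have "det (transpose ?B) = 0" using invertible_det_nz by blast
  then show ?thesis by (simp only: det_transpose)
qed

lemma minors_vanish_cols:
  fixes A :: "real ^ 'c::finite ^ 'r::finite"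
  assumes "rank A < CARD('c)" and \<sigma>: "inj (\<sigma> :: 'c \<Rightarrow> 'c)"
  shows "det (\<chi> i j. A $ \<rho> i $ \<sigma> j) = (0 :: real)"
proof -
  have "det (\<chi> i j. transpose A $ \<sigma> i $ \<rho> j) = (0 :: real)"
    using assms by (intro minors_vanish_rows) (simp_all add: rank_transpose)
  then have "det (transpose (\<chi> i j. A $ \<rho> i $ \<sigma> j)) = (0 :: real)"
    by (simp add: transpose_def)
  then show ?thesis by (simp only: det_transpose)
qed

section \<open>Regular functions on the torus\<close>

lemma open_torus: "open (torus :: (complex ^ 'n::finite) set)"
proof -
  have "torus = (\<Inter>j. {z :: complex ^ 'n. z $ j \<noteq> 0})" by (auto simp: torus_def)
  moreover have "open {z :: complex ^ 'n. z $ j \<noteq> 0}" for j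
    by (intro open_Collect_neq continuous_intros)
  ultimately show ?thesis by (metis finite open_INT)
qed

text \<open>The ring of real functions on the torus generated by the real coordinates and the inverses of the
  factors \<open>x\<^sub>j\<^sup>2 + y\<^sub>j\<^sup>2\<close>. Values outside the torus are
  irrelevant: the last rule makes membership depend on the restriction to the torus only, so that
  Jacobians, which are arbitrary outside, can be members.\<close>

inductive regular :: "(complex ^ 'n::finite \<Rightarrow> real) \<Rightarrow> bool" where
  regular_const: "regular (\<lambda>z. a)"
| regular_Re: "regular (\<lambda>z. Re (z $ j))"
| regular_Im: "regular (\<lambda>z. Im (z $ j))"
| regular_inverse: "regular (\<lambda>z. inverse ((Re (z $ j))\<^sup>2 + (Im (z $ j))\<^sup>2))"
| regular_add: "regular g \<Longrightarrow> regular h \<Longrightarrow> regular (\<lambda>z. g z + h z)"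
| regular_mult: "regular g \<Longrightarrow> regular h \<Longrightarrow> regular (\<lambda>z. g z * h z)"
| regular_cong: "regular g \<Longrightarrow> (\<And>z. z \<in> torus \<Longrightarrow> h z = g z) \<Longrightarrow> regular h"

lemma regular_uminus: "regular g \<Longrightarrow> regular (\<lambda>z. - g z)"
  using regular_mult[OF regular_const[of "-1"]] by simp

lemma regular_diff: "regular g \<Longrightarrow> regular h \<Longrightarrow> regular (\<lambda>z. g z - h z)"
  using regular_add[OF _ regular_uminus] by simp

lemma regular_sum: "(\<And>i. i \<in> I \<Longrightarrow> regular (g i)) \<Longrightarrow> regular (\<lambda>z. \<Sum>i\<in>I. g i z)"
  by (induction I rule: infinite_finite_induct) (auto intro: regular_const regular_add)

lemma regular_prod: "(\<And>i. i \<in> I \<Longrightarrow> regular (g i)) \<Longrightarrow> regular (\<lambda>z. \<Prod>i\<in>I. g i z)"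
  by (induction I rule: infinite_finite_induct) (auto intro: regular_const regular_mult)

lemma regular_det: "(\<And>i j. regular (\<lambda>z. M z $ i $ j)) \<Longrightarrow> regular (\<lambda>z. det (M z))"
  unfolding det_def by (intro regular_sum regular_mult regular_const regular_prod)

lemma norm_sq_nonzero: "z \<in> torus \<Longrightarrow> (Re (z $ j))\<^sup>2 + (Im (z $ j))\<^sup>2 \<noteq> 0"
  by (auto simp: torus_def complex_eq_iff)

lemma has_derivative_Re_nth: "((\<lambda>z. Re (z $ j)) has_derivative (\<lambda>v. Re (v $ j))) (at z)"
  by (rule bounded_linear_imp_has_derivative[OF bounded_linear_compose[OF bounded_linear_Re bounded_linear_vec_nth]])

lemma has_derivative_Im_nth: "((\<lambda>z. Im (z $ j)) has_derivative (\<lambda>v. Im (v $ j))) (at z)"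
  by (rule bounded_linear_imp_has_derivative[OF bounded_linear_compose[OF bounded_linear_Im bounded_linear_vec_nth]])

lemma has_derivative_norm_sq_nth:
  "((\<lambda>z. (Re (z $ j))\<^sup>2 + (Im (z $ j))\<^sup>2) has_derivative
    (\<lambda>v. 2 * (Re (z $ j) * Re (v $ j) + Im (z $ j) * Im (v $ j)))) (at z)"
proof -
  have "((\<lambda>z. Re (z $ j) * Re (z $ j) + Im (z $ j) * Im (z $ j)) has_derivative
    (\<lambda>v. (Re (z $ j) * Re (v $ j) + Re (v $ j) * Re (z $ j)) + (Im (z $ j) * Im (v $ j) + Im (v $ j) * Im (z $ j)))) (at z)"
    by (intro has_derivative_add has_derivative_mult has_derivative_Re_nth has_derivative_Im_nth)
  then show ?thesis by (simp add: power2_eq_square algebra_simps)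
qed

text \<open>The ring is closed under directional derivatives. This yields smoothness of its members as well as
  the membership of all entries of the Jacobian matrices.\<close>

lemma regular_derivative:
  "regular g \<Longrightarrow> \<exists>g'. (\<forall>v. regular (\<lambda>z. g' z v)) \<and> (\<forall>z\<in>torus. (g has_derivative g' z) (at z))"
proof (induction rule: regular.induct)
  case (regular_const a)
  show ?case
    by (rule exI[of _ "\<lambda>z v. 0"]) (auto intro: regular.regular_const has_derivative_const)
next
  case (regular_Re j)
  show ?case
    by (rule exI[of _ "\<lambda>z v. Re (v $ j)"]) (auto intro: regular_const has_derivative_Re_nth)
next
  case (regular_Im j)
  show ?case
    by (rule exI[of _ "\<lambda>z v. Im (v $ j)"]) (auto intro: regular_const has_derivative_Im_nth)
next
  case (regular_inverse j)
  let ?N = "\<lambda>z :: complex ^ 'a. (Re (z $ j))\<^sup>2 + (Im (z $ j))\<^sup>2"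
  let ?g' = "\<lambda>z v. - (inverse (?N z) * (2 * (Re (z $ j) * Re (v $ j) + Im (z $ j) * Im (v $ j))) * inverse (?N z))"
  have "regular (\<lambda>z. ?g' z v)" for v
    by (intro regular_uminus regular_mult regular_add regular_const regular_Re regular_Im regular.regular_inverse)
  moreover have "((\<lambda>z. inverse (?N z)) has_derivative ?g' z) (at z)" if "z \<in> torus" for z
    by (rule Deriv.has_derivative_inverse[OF norm_sq_nonzero[OF that] has_derivative_norm_sq_nth])
  ultimately show ?case by (intro exI[of _ ?g'] conjI allI ballI)
next
  case (regular_add g h)
  then obtain g' h' where "\<forall>v. regular (\<lambda>z. g' z v)" "\<forall>z\<in>torus. (g has_derivative g' z) (at z)"
    "\<forall>v. regular (\<lambda>z. h' z v)" "\<forall>z\<in>torus. (h has_derivative h' z) (at z)" by auto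
  then show ?case
    by (intro exI[of _ "\<lambda>z v. g' z v + h' z v"]) (auto intro: regular.regular_add has_derivative_add)
next
  case (regular_mult g h)
  then obtain g' h' where *: "\<forall>v. regular (\<lambda>z. g' z v)" "\<forall>z\<in>torus. (g has_derivative g' z) (at z)"
    "\<forall>v. regular (\<lambda>z. h' z v)" "\<forall>z\<in>torus. (h has_derivative h' z) (at z)" by auto
  have "((\<lambda>z. g z * h z) has_derivative (\<lambda>v. g z * h' z v + g' z v * h z)) (at z)" if "z \<in> torus" for z
    using * that by (intro has_derivative_mult) auto
  moreover have "regular (\<lambda>z. g z * h' z v + g' z v * h z)" for v
    using * regular_mult by (intro regular_add regular.regular_mult) auto
  ultimately show ?case by (intro exI[of _ "\<lambda>z v. g z * h' z v + g' z v * h z"]) auto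
next
  case (regular_cong g h)
  then obtain g' where "\<forall>v. regular (\<lambda>z. g' z v)" "\<forall>z\<in>torus. (g has_derivative g' z) (at z)" by auto
  moreover have "(h has_derivative g' z) (at z)" if "z \<in> torus" for z
    by (rule has_derivative_transform_within_open[OF _ open_torus that])
       (use calculation that regular_cong in auto)
  ultimately show ?case by blast
qed

lemma Ck_on_of_regular_derivative:
  assumes "\<And>v. regular (\<lambda>z. g' z v)" "\<And>z. z \<in> torus \<Longrightarrow> (g has_derivative g' z) (at z)"
  shows "Ck_on k g torus"
  using assms
proof (induction k arbitrary: g g')
  case 0
  then have "continuous_on torus g"
    by (intro continuous_at_imp_continuous_on ballI) (rule has_derivative_continuous)
  then show ?case by simp
next
  case (Suc k)
  show ?case
  proof (rule Ck_on_SucI[OF open_torus Suc.prems(2)])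
    fix v
    from regular_derivative[OF Suc.prems(1)[of v]] show "Ck_on k (\<lambda>z. g' z v) torus"
      using Suc.IH by blast
  qed
qed

lemma regular_smooth:
  assumes "regular g"
  shows "smooth_on torus g"
  using regular_derivative[OF assms] Ck_on_of_regular_derivative unfolding smooth_on_def by metis

text \<open>A product is cleared by the product of the cleared factors, a sum after multiplying each summand
  with the factors of the other one.\<close>

lemma regular_clears: "regular g \<Longrightarrow> \<exists>P. clears P g"
proof (induction rule: regular.induct)
  case (regular_const a)
  show ?case unfolding clears_def
    by (rule exI[of _ "Poly_Mapping.single 0 a"], rule exI[of _ "\<lambda>j. 0"]) simp
next
  case (regular_Re j)
  show ?case unfolding clears_def
    by (rule exI[of _ "Var (Inl j)"], rule exI[of _ "\<lambda>j. 0"]) (simp add: real_coords_def)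
next
  case (regular_Im j)
  show ?case unfolding clears_def
    by (rule exI[of _ "Var (Inr j)"], rule exI[of _ "\<lambda>j. 0"]) (simp add: real_coords_def)
next
  case (regular_inverse j)
  have "(\<Prod>i\<in>UNIV. ((Re (z $ i))\<^sup>2 + (Im (z $ i))\<^sup>2) ^ (if i = j then 1 else 0)) = (Re (z $ j))\<^sup>2 + (Im (z $ j))\<^sup>2"
    for z :: "complex ^ 'a"
  proof -
    have "(\<Prod>i\<in>UNIV. ((Re (z $ i))\<^sup>2 + (Im (z $ i))\<^sup>2) ^ (if i = j then 1 else 0)) =
        (\<Prod>i\<in>UNIV. if i = j then (Re (z $ j))\<^sup>2 + (Im (z $ j))\<^sup>2 else 1)"
      by (rule prod.cong) auto
    then show ?thesis by simp
  qed
  then show ?case unfolding clears_def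
    by (intro exI[of _ 1] exI[of _ "\<lambda>i. if i = j then 1 else 0"]) (simp add: right_inverse[OF norm_sq_nonzero])
next
  case (regular_add g h)
  then obtain P Q k m where
    P: "\<forall>z\<in>torus. rpoly_eval P (real_coords z) = (\<Prod>j\<in>UNIV. ((Re (z $ j))\<^sup>2 + (Im (z $ j))\<^sup>2) ^ k j) * g z" and
    Q: "\<forall>z\<in>torus. rpoly_eval Q (real_coords z) = (\<Prod>j\<in>UNIV. ((Re (z $ j))\<^sup>2 + (Im (z $ j))\<^sup>2) ^ m j) * h z"
    unfolding clears_def by blast
  define N where "N e = (\<Prod>j\<in>UNIV. (Var (Inl j) ^ 2 + Var (Inr j) ^ 2) ^ e j :: ('a + 'a) rpoly)" for e
  have N: "rpoly_eval (N e) (real_coords z) = (\<Prod>j\<in>UNIV. ((Re (z $ j))\<^sup>2 + (Im (z $ j))\<^sup>2) ^ e j)" for e z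
    by (simp add: N_def rpoly_eval_prod real_coords_def)
  show ?case unfolding clears_def
    by (rule exI[of _ "P * N m + Q * N k"], rule exI[of _ "\<lambda>j. k j + m j"])
       (auto simp: P Q N power_add prod.distrib algebra_simps)
next
  case (regular_mult g h)
  then obtain P Q k m where
    P: "\<forall>z\<in>torus. rpoly_eval P (real_coords z) = (\<Prod>j\<in>UNIV. ((Re (z $ j))\<^sup>2 + (Im (z $ j))\<^sup>2) ^ k j) * g z" and
    Q: "\<forall>z\<in>torus. rpoly_eval Q (real_coords z) = (\<Prod>j\<in>UNIV. ((Re (z $ j))\<^sup>2 + (Im (z $ j))\<^sup>2) ^ m j) * h z"
    unfolding clears_def by blast
  show ?case unfolding clears_def
    by (rule exI[of _ "P * Q"], rule exI[of _ "\<lambda>j. k j + m j"])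
       (auto simp: P Q power_add prod.distrib algebra_simps)
next
  case (regular_cong g h)
  then show ?case by (auto simp: clears_def)
qed

text \<open>Clearing denominators multiplies by factors without zeros on the torus.\<close>

lemma clearing_choice_zero_iff:
  assumes "clearing_choice c" "regular g" "z \<in> torus"
  shows "rpoly_eval (c g) (real_coords z) = 0 \<longleftrightarrow> g z = 0"
proof -
  have "clears (c g) g" using assms(1) regular_clears[OF assms(2)] by (auto simp: clearing_choice_def)
  then obtain k where "rpoly_eval (c g) (real_coords z) =
      (\<Prod>j\<in>UNIV. ((Re (z $ j))\<^sup>2 + (Im (z $ j))\<^sup>2) ^ k j) * g z"
    using assms(3) unfolding clears_def by blast
  moreover have "(\<Prod>j\<in>UNIV. ((Re (z $ j))\<^sup>2 + (Im (z $ j))\<^sup>2) ^ k j) \<noteq> 0"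
    using norm_sq_nonzero[OF assms(3)] by (simp only: prod_zero_iff finite power_eq_0_iff) blast
  ultimately show ?thesis by (simp only: mult_eq_0_iff)  blast
qed

definition cregular :: "(complex ^ 'n::finite \<Rightarrow> complex) \<Rightarrow> bool" where
  "cregular g \<longleftrightarrow> regular (\<lambda>z. Re (g z)) \<and> regular (\<lambda>z. Im (g z))"

lemma cregular_const: "cregular (\<lambda>z. a)"
  by (simp add: cregular_def regular_const)

lemma cregular_nth: "cregular (\<lambda>z. z $ j)"
  by (simp add: cregular_def regular_Re regular_Im)

lemma cregular_add: "cregular g \<Longrightarrow> cregular h \<Longrightarrow> cregular (\<lambda>z. g z + h z)"
  by (simp add: cregular_def regular_add)

lemma cregular_mult: "cregular g \<Longrightarrow> cregular h \<Longrightarrow> cregular (\<lambda>z. g z * h z)"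
  by (simp add: cregular_def regular_add regular_mult regular_diff)

lemma cregular_cnj: "cregular g \<Longrightarrow> cregular (\<lambda>z. cnj (g z))"
  by (simp add: cregular_def regular_uminus)

lemma cregular_inverse_nth: "cregular (\<lambda>z. inverse (z $ j))"
  unfolding cregular_def
  by (auto simp: divide_inverse intro!: regular_mult regular_uminus regular_Re regular_Im regular_inverse)

lemma cregular_cong: "cregular g \<Longrightarrow> (\<And>z. z \<in> torus \<Longrightarrow> h z = g z) \<Longrightarrow> cregular h"
  unfolding cregular_def
  by (auto intro: regular_cong[of "\<lambda>z. Re (g z)"] regular_cong[of "\<lambda>z. Im (g z)"])

text \<open>The class \<open>cregular\<close> is closed under complex conjugation, so membership does not give
  complex derivatives. Here the complex linear derivative is part of the condition, with
  coefficients that are regular again; they turn out to be the functions \<open>partial_deriv j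
  g\<close>.\<close>

definition holomorphic_regular :: "(complex ^ 'n::finite \<Rightarrow> complex) \<Rightarrow> bool" where
  "holomorphic_regular g \<longleftrightarrow> cregular g \<and> (\<exists>g'. (\<forall>j. cregular (g' j)) \<and>
     (\<forall>z\<in>torus. (g has_derivative (\<lambda>v. \<Sum>j\<in>UNIV. g' j z * v $ j)) (at z)))"

lemma holomorphic_regular_const: "holomorphic_regular (\<lambda>z. a)"
  unfolding holomorphic_regular_def
  by (auto intro!: exI[of _ "\<lambda>j z. 0"] cregular_const has_derivative_const)

lemma sum_delta_mult_nth: "(\<Sum>i\<in>UNIV. (if i = j then a else 0) * v $ i) = (a::complex) * v $ (j::'n::finite)"
proof -
  have "(\<Sum>i\<in>UNIV. (if i = j then a else 0) * v $ i) = (\<Sum>i\<in>UNIV. if i = j then a * v $ j else 0)"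
    by (rule sum.cong) auto
  then show ?thesis by simp
qed

lemma holomorphic_regular_nth: "holomorphic_regular (\<lambda>z. z $ j)"
proof -
  have "((\<lambda>z. z $ j) has_derivative (\<lambda>v. v $ j)) (at z)" for z :: "complex ^ 'a"
    by (rule bounded_linear_imp_has_derivative[OF bounded_linear_vec_nth])
  then show ?thesis
    unfolding holomorphic_regular_def
    by (intro conjI cregular_nth exI[of _ "\<lambda>i z. if i = j then 1 else 0"])
       (auto simp: sum_delta_mult_nth cregular_const)
qed

lemma holomorphic_regular_inverse_nth: "holomorphic_regular (\<lambda>z. inverse (z $ j))"
proof -
  have *: "((\<lambda>z. inverse (z $ j)) has_derivative (\<lambda>v. - (inverse (z $ j) * v $ j * inverse (z $ j)))) (at z)"
    if "z \<in> torus" for z :: "complex ^ 'a"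
    using that
    by (intro Deriv.has_derivative_inverse bounded_linear_imp_has_derivative[OF bounded_linear_vec_nth])
       (auto simp: torus_def)
  let ?d = "\<lambda>i z. if i = j then - (inverse (z $ j) * inverse (z $ j)) else 0"
  have "cregular (\<lambda>z. - 1 * (inverse (z $ j) * inverse (z $ j)))"
    by (intro cregular_mult cregular_const cregular_inverse_nth)
  then have "cregular (?d i)" for i by (cases "i = j") (simp_all add: cregular_const)
  moreover have "(\<lambda>v. - (inverse (z $ j) * v $ j * inverse (z $ j))) = (\<lambda>v. \<Sum>i\<in>UNIV. ?d i z * v $ i)"
    for z :: "complex ^ 'a"
    unfolding sum_delta_mult_nth by (simp add: mult_ac)
  ultimately show ?thesis
    unfolding holomorphic_regular_def using *
    by (intro conjI cregular_inverse_nth exI[of _ ?d]) auto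
qed

lemma holomorphic_regular_add:
  assumes "holomorphic_regular g" "holomorphic_regular h"
  shows "holomorphic_regular (\<lambda>z. g z + h z)"
proof -
  from assms obtain g' h' where *: "cregular g" "cregular h" "\<forall>j. cregular (g' j)" "\<forall>j. cregular (h' j)"
    "\<forall>z\<in>torus. (g has_derivative (\<lambda>v. \<Sum>j\<in>UNIV. g' j z * v $ j)) (at z)"
    "\<forall>z\<in>torus. (h has_derivative (\<lambda>v. \<Sum>j\<in>UNIV. h' j z * v $ j)) (at z)"
    unfolding holomorphic_regular_def by blast
  have "((\<lambda>z. g z + h z) has_derivative (\<lambda>v. \<Sum>j\<in>UNIV. (g' j z + h' j z) * v $ j)) (at z)"
    if "z \<in> torus" for z
    using has_derivative_add[OF *(5)[rule_format, OF that] *(6)[rule_format, OF that]]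
    by (simp add: distrib_right sum.distrib)
  then show ?thesis unfolding holomorphic_regular_def
    using * by (intro conjI cregular_add exI[of _ "\<lambda>j z. g' j z + h' j z"]) (auto intro: cregular_add)
qed

lemma holomorphic_regular_mult:
  assumes "holomorphic_regular g" "holomorphic_regular h"
  shows "holomorphic_regular (\<lambda>z. g z * h z)"
proof -
  from assms obtain g' h' where *: "cregular g" "cregular h" "\<forall>j. cregular (g' j)" "\<forall>j. cregular (h' j)"
    "\<forall>z\<in>torus. (g has_derivative (\<lambda>v. \<Sum>j\<in>UNIV. g' j z * v $ j)) (at z)"
    "\<forall>z\<in>torus. (h has_derivative (\<lambda>v. \<Sum>j\<in>UNIV. h' j z * v $ j)) (at z)"
    unfolding holomorphic_regular_def by blast
  have "((\<lambda>z. g z * h z) has_derivative (\<lambda>v. \<Sum>j\<in>UNIV. (g z * h' j z + h z * g' j z) * v $ j)) (at z)"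
    if "z \<in> torus" for z
  proof -
    have "(\<lambda>v. g z * (\<Sum>j\<in>UNIV. h' j z * v $ j) + (\<Sum>j\<in>UNIV. g' j z * v $ j) * h z) =
        (\<lambda>v. \<Sum>j\<in>UNIV. (g z * h' j z + h z * g' j z) * v $ j)"
      by (simp add: sum.distrib[symmetric] sum_distrib_left sum_distrib_right algebra_simps)
    then show ?thesis
      using has_derivative_mult[OF *(5)[rule_format, OF that] *(6)[rule_format, OF that]] by simp
  qed
  then show ?thesis unfolding holomorphic_regular_def
    using * by (intro conjI exI[of _ "\<lambda>j z. g z * h' j z + h z * g' j z"] allI cregular_add cregular_mult) auto
qed

lemma holomorphic_regular_sum: "(\<And>i. i \<in> I \<Longrightarrow> holomorphic_regular (g i)) \<Longrightarrow> holomorphic_regular (\<lambda>z. \<Sum>i\<in>I. g i z)"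
  by (induction I rule: infinite_finite_induct) (auto intro: holomorphic_regular_const holomorphic_regular_add)

lemma holomorphic_regular_prod: "(\<And>i. i \<in> I \<Longrightarrow> holomorphic_regular (g i)) \<Longrightarrow> holomorphic_regular (\<lambda>z. \<Prod>i\<in>I. g i z)"
  by (induction I rule: infinite_finite_induct) (auto intro: holomorphic_regular_const holomorphic_regular_mult)

lemma holomorphic_regular_powi_nth: "holomorphic_regular (\<lambda>z. z $ j powi k)"
proof (cases "k \<ge> 0")
  case True
  have "holomorphic_regular (\<lambda>z. \<Prod>i\<in>{..<nat k}. z $ j)"
    by (intro holomorphic_regular_prod holomorphic_regular_nth)
  then show ?thesis using True by (simp add: power_int_def)
next
  case False
  have "holomorphic_regular (\<lambda>z. \<Prod>i\<in>{..<nat (- k)}. inverse (z $ j))"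
    by (intro holomorphic_regular_prod holomorphic_regular_inverse_nth)
  then show ?thesis using False by (simp add: power_int_def)
qed

lemma holomorphic_regular_laurent_eval: "holomorphic_regular (laurent_eval f)"
  unfolding laurent_eval_def[abs_def]
  by (intro holomorphic_regular_sum holomorphic_regular_mult holomorphic_regular_const
      holomorphic_regular_prod holomorphic_regular_powi_nth)

lemma partial_deriv_eqI:
  assumes "(g has_derivative (\<lambda>v. \<Sum>j\<in>UNIV. a j * v $ j)) (at z)"
  shows "partial_deriv j g z = a j"
proof -
  have "((\<lambda>w. \<chi> i. if i = j then w else z $ i) has_derivative (\<lambda>w. axis j w)) (at (z $ j))"
  proof -
    have "bounded_linear (\<lambda>w::complex. axis j w)"
      unfolding linear_conv_bounded_linear[symmetric]
      by (rule linearI) (simp_all add: vec_eq_iff axis_def)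
    from bounded_linear_imp_has_derivative[OF this]
    have "((\<lambda>w. axis j w + (\<chi> i. if i = j then 0 else z $ i)) has_derivative (\<lambda>w. axis j w + 0)) (at (z $ j))"
      by (intro has_derivative_add has_derivative_const)
    moreover have "axis j w + (\<chi> i. if i = j then 0 else z $ i) = (\<chi> i. if i = j then w else z $ i)" for w
      by (simp add: vec_eq_iff axis_def)
    ultimately show ?thesis by simp
  qed
  moreover have "(\<chi> i. if i = j then z $ j else z $ i) = z" by (simp add: vec_eq_iff)
  ultimately have "((\<lambda>w. g (\<chi> i. if i = j then w else z $ i)) has_derivative
      (\<lambda>w. \<Sum>i\<in>UNIV. a i * (axis j w) $ i)) (at (z $ j))"
    using has_derivative_compose[of "\<lambda>w. \<chi> i. if i = j then w else z $ i" _ "z $ j" UNIV g] assms by simp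
  moreover have "(\<Sum>i\<in>UNIV. a i * (axis j w) $ i) = a j * w" for w
  proof -
    have "(\<Sum>i\<in>UNIV. a i * (axis j w) $ i) = (\<Sum>i\<in>UNIV. if i = j then a j * w else 0)"
      by (rule sum.cong) (auto simp: axis_def)
    then show ?thesis by simp
  qed
  ultimately have "((\<lambda>w. g (\<chi> i. if i = j then w else z $ i)) has_field_derivative a j) (at (z $ j))"
    by (simp add: has_field_derivative_def)
  then show ?thesis unfolding partial_deriv_def by (rule DERIV_imp_deriv)
qed

lemma laurent_eval_derivative:
  assumes "z \<in> torus"
  shows "(laurent_eval f has_derivative (\<lambda>v. \<Sum>j\<in>UNIV. partial_deriv j (laurent_eval f) z * v $ j)) (at z)"
proof -
  obtain g' where g': "(laurent_eval f has_derivative (\<lambda>v. \<Sum>j\<in>UNIV. g' j z * v $ j)) (at z)"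
    using holomorphic_regular_laurent_eval[of f] assms unfolding holomorphic_regular_def by blast
  then show ?thesis using partial_deriv_eqI[OF g'] by simp
qed

lemma cregular_laurent_eval: "cregular (laurent_eval f)"
  using holomorphic_regular_laurent_eval unfolding holomorphic_regular_def by blast

lemma cregular_F: "cregular (F f j)"
proof -
  obtain g' where g': "\<forall>j. cregular (g' j)"
    "\<forall>z\<in>torus. (laurent_eval f has_derivative (\<lambda>v. \<Sum>j\<in>UNIV. g' j z * v $ j)) (at z)"
    using holomorphic_regular_laurent_eval[of f] unfolding holomorphic_regular_def by blast
  show ?thesis
  proof (rule cregular_cong)
    show "cregular (\<lambda>z. z $ j * g' j z)" using g' by (intro cregular_mult cregular_nth) auto
    show "F f j z = z $ j * g' j z" if "z \<in> torus" for z
      using partial_deriv_eqI[OF g'(2)[rule_format, OF that]] by (simp add: F_def)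
  qed
qed

lemma regular_G: "regular (\<lambda>z. G f l z $ i)"
proof (cases i)
  case None
  then show ?thesis using cregular_laurent_eval[of f] by (simp add: G_def cregular_def)
next
  case (Some j)
  have "cregular (\<lambda>z. F f j z * cnj (F f l z))" by (intro cregular_mult cregular_cnj cregular_F)
  then show ?thesis using Some cregular_laurent_eval[of f]
    by (cases "j = l") (simp_all add: G_def cregular_def)
qed

lemma regular_chart: "regular (\<lambda>z. (cmod (F f l z))\<^sup>2)"
proof -
  have "cregular (\<lambda>z. F f l z * cnj (F f l z))" by (intro cregular_mult cregular_cnj cregular_F)
  then show ?thesis by (simp add: cregular_def complex_mult_cnj cmod_power2)
qed

lemma has_derivative_vec:
  fixes f :: "'a::real_normed_vector \<Rightarrow> real ^ 'm::finite"
  assumes "\<And>i. ((\<lambda>z. f z $ i) has_derivative (\<lambda>v. D v $ i)) (at z)"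
  shows "(f has_derivative D) (at z)"
  by (subst has_derivative_componentwise_within)
     (auto simp: Basis_vec_def inner_axis assms)

lemma smooth_on_vec:
  fixes f :: "'a::real_normed_vector \<Rightarrow> real ^ 'm::finite"
  assumes "open S" "\<And>i. smooth_on S (\<lambda>z. f z $ i)"
  shows "smooth_on S f"
proof -
  have Ck: "Ck_on k (\<lambda>z. \<Sum>i\<in>UNIV. (f z $ i) *\<^sub>R axis i 1) S" for k
    using assms by (intro Ck_on_sum Ck_on_scaleR Ck_on_const) (auto simp: smooth_on_def)
  have "(\<Sum>i\<in>UNIV. (f z $ i) *\<^sub>R axis i 1) = f z" for z
    using basis_expansion[of "f z"] by (simp add: scalar_mult_eq_scaleR)
  then show ?thesis unfolding smooth_on_def using Ck_on_cong[OF assms(1) _ Ck] by blast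
qed

lemma smooth_G: "smooth_on torus (G f l)"
  by (intro smooth_on_vec open_torus regular_smooth regular_G)

text \<open>The derivative of \<open>Log\<close>: its \<open>j\<close>-th component is \<open>Re (v\<^sub>j /
  z\<^sub>j)\<close>, written without division so that its regularity is visible.\<close>

definition dLog :: "complex ^ 'n::finite \<Rightarrow> complex ^ 'n \<Rightarrow> real ^ 'n" where
  "dLog z v = (\<chi> j. (Re (z $ j) * Re (v $ j) + Im (z $ j) * Im (v $ j)) * inverse ((Re (z $ j))\<^sup>2 + (Im (z $ j))\<^sup>2))"

lemma Log_nth_has_derivative:
  assumes "z \<in> torus"
  shows "((\<lambda>z. Log z $ j) has_derivative (\<lambda>v. dLog z v $ j)) (at z)"
proof -
  let ?N = "\<lambda>z :: complex ^ 'a. (Re (z $ j))\<^sup>2 + (Im (z $ j))\<^sup>2"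
  have pos: "?N z > 0" using norm_sq_nonzero[OF assms, of j] by (simp add: sum_power2_gt_zero_iff sum_power2_eq_zero_iff)
  have "((\<lambda>z. ln (?N z) / 2) has_derivative
      (\<lambda>v. (2 * (Re (z $ j) * Re (v $ j) + Im (z $ j) * Im (v $ j))) * inverse (?N z) / 2)) (at z)"
    
    by (intro bounded_linear.has_derivative[OF bounded_linear_divide] has_derivative_ln[where g = ?N and x = z, OF pos]
        has_derivative_norm_sq_nth)
  moreover have "ln (?N z) / 2 = Log z $ j" for z
    by (simp add: Log_def cmod_def ln_sqrt)
  moreover have "(2 * (Re (z $ j) * Re (v $ j) + Im (z $ j) * Im (v $ j))) * inverse (?N z) / 2 = dLog z v $ j" for v
    by (simp add: dLog_def)
  ultimately show ?thesis by simp
qed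

lemma Log_has_derivative: "z \<in> torus \<Longrightarrow> (Log has_derivative dLog z) (at z)"
  by (intro has_derivative_vec Log_nth_has_derivative)

lemma regular_dLog: "regular (\<lambda>z. dLog z v $ j)"
  unfolding dLog_def
  by (simp, intro regular_mult regular_add regular_Re regular_Im regular_const regular_inverse)

lemma smooth_Log: "smooth_on torus Log"
proof (rule smooth_on_vec[OF open_torus])
  show "smooth_on torus (\<lambda>z. Log z $ i)" for i
    using Ck_on_of_regular_derivative[OF regular_dLog Log_nth_has_derivative] unfolding smooth_on_def by blast
qed

lemma G_derivative:
  obtains D where "\<And>z. z \<in> torus \<Longrightarrow> (G f l has_derivative D z) (at z)"
    "\<And>v i. regular (\<lambda>z. D z v $ i)"
proof -
  have "\<forall>i. \<exists>g'. (\<forall>v. regular (\<lambda>z. g' z v)) \<and> (\<forall>z\<in>torus. ((\<lambda>z. G f l z $ i) has_derivative g' z) (at z))"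
    using regular_derivative[OF regular_G] by blast
  then obtain g' where g': "\<And>i v. regular (\<lambda>z. g' i z v)" "\<And>i z. z \<in> torus \<Longrightarrow> ((\<lambda>z. G f l z $ i) has_derivative g' i z) (at z)"
    by metis
  show thesis
  proof (rule that[of "\<lambda>z v. \<chi> i. g' i z v"])
    show "(G f l has_derivative (\<lambda>v. \<chi> i. g' i z v)) (at z)" if "z \<in> torus" for z
      by (rule has_derivative_vec) (simp add: g'(2)[OF that])
  qed (simp add: g')
qed

lemma linear_of_real_coords: "linear of_real_coords"
  by (rule linearI) (simp_all add: of_real_coords_def vec_eq_iff complex_eq_iff)

lemma of_real_coords_real_coords [simp]: "of_real_coords (real_coords z) = z"
  by (simp add: of_real_coords_def real_coords_def vec_eq_iff complex_eq_iff)

text \<open>This transfers rank conditions on Jacobian matrices to coordinate-free derivatives, in terms of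
  which the results on level sets are formulated.\<close>

lemma real_jacobian_mult:
  assumes "(h has_derivative D) (at z)"
  shows "real_jacobian h z *v X = D (of_real_coords X)"
proof -
  have der: "((\<lambda>X. h (of_real_coords X)) has_derivative (\<lambda>X. D (of_real_coords X))) (at (real_coords z))"
    by (rule has_derivative_compose[OF linear_imp_has_derivative[OF linear_of_real_coords]]) (simp add: assms)
  then have "((\<lambda>X. h (of_real_coords X)) has_derivative (\<lambda>X. real_jacobian h z *v X)) (at (real_coords z))"
    unfolding real_jacobian_def jacobian_works[symmetric] by (rule differentiableI)
  from fun_cong[OF has_derivative_unique[OF this der], of X] show ?thesis .
qed

lemma real_jacobian_entry:
  assumes "(h has_derivative D) (at z)"
  shows "real_jacobian h z $ a $ b = D (of_real_coords (axis b 1)) $ a"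
  using arg_cong[OF real_jacobian_mult[OF assms, of "axis b 1"], of "\<lambda>y. y $ a"]
  by (simp add: matrix_vector_mult_basis column_def)

lemma regular_DG: "regular (\<lambda>z. DG f l z $ a $ b)"
proof -
  obtain D where D: "\<And>z. z \<in> torus \<Longrightarrow> (G f l has_derivative D z) (at z)" "\<And>v i. regular (\<lambda>z. D z v $ i)"
    by (rule G_derivative[of f l]) (rule that)
  show ?thesis unfolding DG_def
    by (rule regular_cong[OF D(2) real_jacobian_entry[OF D(1)]])
qed

lemma regular_DG_DLog: "regular (\<lambda>z. DG_DLog f l z $ a $ b)"
proof (cases a)
  case (Inl i)
  then show ?thesis by (simp add: DG_DLog_def regular_DG)
next
  case (Inr j)
  have "regular (\<lambda>z. real_jacobian Log z $ j $ b)"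
    by (rule regular_cong[OF regular_dLog real_jacobian_entry[OF Log_has_derivative]])
  then show ?thesis using Inr by (simp add: DG_DLog_def)
qed

section \<open>The critical equations\<close>

lemma smooth_laurent_eval: "smooth_on torus (laurent_eval f)"
proof -
  have 1: "smooth_on torus (\<lambda>z. complex_of_real (Re (laurent_eval f z)))"
    "smooth_on torus (\<lambda>z. \<i> * complex_of_real (Im (laurent_eval f z)))"
    using cregular_laurent_eval[of f] unfolding cregular_def
    by (auto intro!: smooth_on_linear[OF _ open_torus, where L = complex_of_real]
        smooth_on_linear[OF _ open_torus, where L = "\<lambda>r. \<i> * complex_of_real r"] regular_smooth
        linearI simp: scaleR_conv_of_real algebra_simps)
  show ?thesis
    by (rule smooth_on_cong[OF open_torus _ smooth_on_add[OF open_torus 1]]) (simp add: complex_eq_iff)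
qed

lemma tangent_space_hypersurface:
  assumes "q \<in> hypersurface f" "F f l q \<noteq> 0"
  shows "tangent_space (hypersurface f) q =
    {v. (\<Sum>j\<in>UNIV. partial_deriv j (laurent_eval f) q * v $ j) = 0}"
proof -
  have qt: "q \<in> torus" using assms by (simp add: hypersurface_def)
  let ?d = "\<lambda>j. partial_deriv j (laurent_eval f) q"
  have "?d l \<noteq> 0" using assms(2) by (auto simp: F_def)
  have "surj (\<lambda>v. \<Sum>j\<in>UNIV. ?d j * v $ j)"
  proof
    show "UNIV \<subseteq> range (\<lambda>v. \<Sum>j\<in>UNIV. ?d j * v $ j)"
    proof
      fix w
      have "(\<Sum>j\<in>UNIV. ?d j * (axis l (w / ?d l)) $ j) = (\<Sum>j\<in>UNIV. if j = l then w else 0)"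
        using \<open>?d l \<noteq> 0\<close> by (intro sum.cong) (auto simp: axis_def)
      then have "w = (\<Sum>j\<in>UNIV. ?d j * (axis l (w / ?d l)) $ j)" by simp
      then show "w \<in> range (\<lambda>v. \<Sum>j\<in>UNIV. ?d j * v $ j)" by (rule range_eqI)
    qed
  qed simp
  moreover have "hypersurface f \<inter> torus = {x \<in> torus. laurent_eval f x = 0}"
    by (auto simp: hypersurface_def)
  ultimately show ?thesis
    by (intro tangent_space_level_set[OF open_torus qt smooth_laurent_eval _ assms(1) laurent_eval_derivative[OF qt]])
qed

lemma dLog_mult: "q \<in> torus \<Longrightarrow> dLog q (\<chi> j. q $ j * w $ j) $ j = Re (w $ j)"
  using norm_sq_nonzero[of q j] by (simp add: dLog_def field_simps power2_eq_square)

text \<open>In logarithmic coordinates \<open>w\<^sub>j = v\<^sub>j / q\<^sub>j\<close> the tangent space is cut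
  out by \<open>\<Sum>\<^sub>j F\<^sub>j w\<^sub>j = 0\<close>, and the differential of
  \<open>Log\<close> takes the real part.\<close>

lemma differential_image_Log_hypersurface:
  assumes "q \<in> hypersurface f" "F f l q \<noteq> 0"
  shows "differential_image Log (hypersurface f) q =
    {a. \<exists>w. (\<Sum>j\<in>UNIV. F f j q * w $ j) = 0 \<and> (\<forall>j. a $ j = Re (w $ j))}"
proof -
  have qt: "q \<in> torus" using assms by (simp add: hypersurface_def)
  have fr: "frechet_derivative Log (at q) = dLog q"
    using frechet_derivative_at[OF Log_has_derivative[OF qt]] by simp
  have sub: "(\<Sum>j\<in>UNIV. partial_deriv j (laurent_eval f) q * (q $ j * w $ j)) = (\<Sum>j\<in>UNIV. F f j q * w $ j)" for w :: "complex ^ 'a"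
    by (simp add: F_def mult_ac)
  show ?thesis
    unfolding differential_image_def tangent_space_hypersurface[OF assms] fr
  proof (intro set_eqI iffI)
    fix a assume "a \<in> dLog q ` {v. (\<Sum>j\<in>UNIV. partial_deriv j (laurent_eval f) q * v $ j) = 0}"
    then obtain v where v: "a = dLog q v" "(\<Sum>j\<in>UNIV. partial_deriv j (laurent_eval f) q * v $ j) = 0" by blast
    define w where "w = (\<chi> j. v $ j / q $ j)"
    have vw: "v = (\<chi> j. q $ j * w $ j)" using qt by (simp add: vec_eq_iff w_def torus_def)
    have "(\<Sum>j\<in>UNIV. F f j q * w $ j) = 0" using v(2) sub[of w] by (simp add: vw)
    moreover have "a $ j = Re (w $ j)" for j unfolding v(1) vw by (rule dLog_mult[OF qt])
    ultimately show "a \<in> {a. \<exists>w. (\<Sum>j\<in>UNIV. F f j q * w $ j) = 0 \<and> (\<forall>j. a $ j = Re (w $ j))}" by blast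
  next
    fix a :: "real ^ 'a" assume "a \<in> {a. \<exists>w. (\<Sum>j\<in>UNIV. F f j q * w $ j) = 0 \<and> (\<forall>j. a $ j = Re (w $ j))}"
    then obtain w :: "complex ^ 'a" where w: "(\<Sum>j\<in>UNIV. F f j q * w $ j) = 0" "\<forall>j. a $ j = Re (w $ j)" by blast
    have "a = dLog q (\<chi> j. q $ j * w $ j)"
      using w(2) dLog_mult[OF qt, of w] by (simp add: vec_eq_iff)
    moreover have "(\<Sum>j\<in>UNIV. partial_deriv j (laurent_eval f) q * (\<chi> j. q $ j * w $ j) $ j) = 0"
      using w(1) sub[of w] by simp
    ultimately show "a \<in> dLog q ` {v. (\<Sum>j\<in>UNIV. partial_deriv j (laurent_eval f) q * v $ j) = 0}" by blast
  qed
qed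

text \<open>Cramer's rule for two complex numbers that are independent over the reals.\<close>

lemma real_combination:
  assumes "Im (A * cnj B) \<noteq> 0"
  obtains a b :: real where "A * of_real a + B * of_real b = s"
proof -
  let ?t = "Im (A * cnj B)"
  have "A * of_real (Im (s * cnj B)) - B * of_real (Im (s * cnj A)) = s * of_real ?t"
    by (simp add: complex_eq_iff algebra_simps)
  then have "A * of_real (Im (s * cnj B) / ?t) + B * of_real (- Im (s * cnj A) / ?t) = s"
    using assms by (simp add: field_simps del: complex_mult_cnj times_complex.sel)
  then show thesis by (rule that)
qed

text \<open>The real parts \<open>Re (w\<^sub>j)\<close> of the solutions of \<open>\<Sum>\<^sub>j F\<^sub>j
  w\<^sub>j = 0\<close> are arbitrary unless all \<open>F\<^sub>j\<close> lie on one real line. If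
  they do, multiplying by \<open>cnj F\<^sub>l\<close> makes the coefficients real and gives a
  linear relation between the real parts, which excludes the vector \<open>axis l 1\<close>. If
  \<open>F\<^sub>k\<close> and \<open>F\<^sub>l\<close> are independent over the reals, the
  imaginary parts of \<open>w\<^sub>k\<close> and \<open>w\<^sub>l\<close> can compensate any choice
  of real parts.\<close>

lemma Crit_iff:
  assumes "q \<in> hypersurface f" "F f l q \<noteq> 0"
  shows "q \<in> Crit f \<longleftrightarrow> (\<forall>j. Im (F f j q * cnj (F f l q)) = 0)"
proof -
  let ?F = "\<lambda>j. F f j q"
  let ?A = "{a. \<exists>w. (\<Sum>j\<in>UNIV. ?F j * w $ j) = 0 \<and> (\<forall>j. a $ j = Re (w $ j))}"
  have "?A \<noteq> UNIV \<longleftrightarrow> (\<forall>j. Im (?F j * cnj (?F l)) = 0)"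
  proof
    assume R: "\<forall>j. Im (?F j * cnj (?F l)) = 0"
    show "?A \<noteq> UNIV"
    proof
      assume "?A = UNIV"
      then have "axis l 1 \<in> ?A" by blast
      then obtain w :: "complex ^ 'a" where w: "(\<Sum>j\<in>UNIV. ?F j * w $ j) = 0" "\<forall>j. axis l 1 $ j = Re (w $ j)" by blast
      have "0 = Re (cnj (?F l) * (\<Sum>j\<in>UNIV. ?F j * w $ j))" using w(1) by simp
      also have "\<dots> = (\<Sum>j\<in>UNIV. Re ((?F j * cnj (?F l)) * w $ j))"
        by (simp only: sum_distrib_left Re_sum mult_ac)
      also have "\<dots> = (\<Sum>j\<in>UNIV. if j = l then (cmod (?F l))\<^sup>2 else 0)"
      proof (rule sum.cong[OF refl])
        fix j
        have "Re ((?F j * cnj (?F l)) * w $ j) = Re (?F j * cnj (?F l)) * Re (w $ j)"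
          using R by (simp only: times_complex.sel(1)[of "?F j * cnj (?F l)"] mult_zero_left diff_zero)
        also have "\<dots> = (if j = l then (cmod (?F l))\<^sup>2 else 0)"
          using w(2)[rule_format, of j, symmetric]
          by (simp add: axis_def complex_norm_square[symmetric] del: complex_mult_cnj times_complex.sel)
        finally show "Re ((?F j * cnj (?F l)) * w $ j) = (if j = l then (cmod (?F l))\<^sup>2 else 0)" .
      qed
      finally show False using assms(2) by simp
    qed
  next
    assume ne: "?A \<noteq> UNIV"
    show "\<forall>j. Im (?F j * cnj (?F l)) = 0"
    proof (rule ccontr)
      assume "\<not> (\<forall>j. Im (?F j * cnj (?F l)) = 0)"
      then obtain k where k: "Im (?F k * cnj (?F l)) \<noteq> 0" by blast
      then have kl: "k \<noteq> l" by auto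
      have "a \<in> ?A" for a
      proof -
        obtain b b' where b: "?F k * of_real b + ?F l * of_real b' = \<i> * (\<Sum>j\<in>UNIV. ?F j * of_real (a $ j))"
          by (rule real_combination[OF k])
        define w where "w = (\<chi> j. of_real (a $ j) + (if j = k then \<i> * of_real b else 0) + (if j = l then \<i> * of_real b' else 0))"
        have "?F j * w $ j = ?F j * of_real (a $ j) + (if j = k then \<i> * (?F k * of_real b) else 0) +
            (if j = l then \<i> * (?F l * of_real b') else 0)" for j
          by (simp add: w_def algebra_simps)
        then have "(\<Sum>j\<in>UNIV. ?F j * w $ j) =
            (\<Sum>j\<in>UNIV. ?F j * of_real (a $ j)) + \<i> * (?F k * of_real b) + \<i> * (?F l * of_real b')"
          by (simp add: sum.distrib)
        also have "\<dots> = (\<Sum>j\<in>UNIV. ?F j * of_real (a $ j)) + \<i> * (?F k * of_real b + ?F l * of_real b')"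
          by (simp add: algebra_simps)
        also have "\<dots> = 0" unfolding b by (simp add: mult.assoc[symmetric])
        finally have "(\<Sum>j\<in>UNIV. ?F j * w $ j) = 0" .
        moreover have "a $ j = Re (w $ j)" for j by (simp add: w_def)
        ultimately show "a \<in> ?A" by blast
      qed
      then show False using ne by blast
    qed
  qed
  then show ?thesis
    unfolding Crit_def mem_Collect_eq differential_image_Log_hypersurface[OF assms] using assms(1) by blast
qed

lemma G_eq_0_iff:
  "G f l q = 0 \<longleftrightarrow> laurent_eval f q = 0 \<and> (\<forall>j. Im (F f j q * cnj (F f l q)) = 0)"
proof -
  have "G f l q = 0 \<longleftrightarrow> Re (laurent_eval f q) = 0 \<and>
      (\<forall>j. (if j = l then Im (laurent_eval f q) else Im (F f j q * cnj (F f l q))) = 0)"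
    unfolding vec_eq_iff G_def split_option_all by simp
  also have "\<dots> \<longleftrightarrow> Re (laurent_eval f q) = 0 \<and> Im (laurent_eval f q) = 0 \<and>
      (\<forall>j. Im (F f j q * cnj (F f l q)) = 0)"
  proof -
    have "Im (F f l q * cnj (F f l q)) = 0" by simp
    then show ?thesis by metis
  qed
  also have "\<dots> \<longleftrightarrow> laurent_eval f q = 0 \<and> (\<forall>j. Im (F f j q * cnj (F f l q)) = 0)"
    by (simp only: complex_eq_iff zero_complex.sel conj_assoc)
  finally show ?thesis .
qed

lemma Crit_chart_iff: "q \<in> chart f l \<Longrightarrow> q \<in> Crit f \<longleftrightarrow> G f l q = 0"
proof -
  assume q: "q \<in> chart f l"
  show ?thesis
  proof (cases "laurent_eval f q = 0")
    case True
    then have "q \<in> hypersurface f" "F f l q \<noteq> 0" using q by (auto simp: chart_def hypersurface_def)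
    from Crit_iff[OF this] show ?thesis unfolding G_eq_0_iff using True by simp
  next
    case False
    then have "q \<notin> Crit f" by (simp add: Crit_def hypersurface_def)
    then show ?thesis unfolding G_eq_0_iff using False by simp
  qed
qed

lemma Crit_in_chart:
  assumes "smooth_hypersurface f" "q \<in> Crit f"
  obtains l where "q \<in> chart f l" "G f l q = 0"
proof -
  have h: "q \<in> hypersurface f" using assms(2) by (simp add: Crit_def)
  then obtain l where "partial_deriv l (laurent_eval f) q \<noteq> 0"
    using assms(1) unfolding smooth_hypersurface_def by blast
  then have "q \<in> chart f l" using h by (simp add: chart_def hypersurface_def F_def torus_def)
  then show thesis using that Crit_chart_iff assms(2) by blast
qed

lemma Crit_subset_torus: "Crit f \<subseteq> torus"
  by (auto simp: Crit_def hypersurface_def)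

section \<open>From exact projections to elimination sets\<close>

lemma half_log_abs_squares:
  assumes "q \<in> torus"
  shows "half_log (abs_squares q) = Log q"
  using assms by (simp add: half_log_def abs_squares_def Log_def vec_eq_iff torus_def ln_realpow)

lemma abs_squares_eq_of_Log_eq:
  assumes "q \<in> torus" "r \<in> torus" "Log q = Log r"
  shows "abs_squares q = abs_squares r"
proof -
  have "cmod (q $ j) = cmod (r $ j)" for j
  proof -
    have "ln (cmod (q $ j)) = ln (cmod (r $ j))" using assms(3) by (simp add: Log_def vec_eq_iff)
    then show ?thesis using assms(1,2) by (simp add: torus_def)
  qed
  then show ?thesis by (simp add: abs_squares_def)
qed

lemma abs_squares_pos: "q \<in> torus \<Longrightarrow> abs_squares q $ j > 0"
  by (simp add: abs_squares_def torus_def)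

lemma rpoly_eval_norm_sq_poly: "rpoly_eval (norm_sq_poly j) (real_coords q) = abs_squares q $ j"
  by (simp add: norm_sq_poly_def real_coords_def abs_squares_def cmod_power2)

lemma I_Sigma_vanish:
  assumes "clearing_choice c" "q \<in> torus" "G f l q = 0" "p \<in> I_Sigma c f l"
  shows "rpoly_eval p (real_coords q) = 0"
proof (rule ideal_gen_vanish)
  show "p \<in> ideal_gen (range (\<lambda>i. c (\<lambda>z. G f l z $ i)))" using assms(4) by (simp add: I_Sigma_def)
  fix r assume "r \<in> range (\<lambda>i. c (\<lambda>z. G f l z $ i))"
  then obtain i where "r = c (\<lambda>z. G f l z $ i)" by blast
  then show "rpoly_eval r (real_coords q) = 0"
    using clearing_choice_zero_iff[OF assms(1) regular_G assms(2)] assms(3) by simp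
qed

lemma chart_poly_nonzero:
  assumes "clearing_choice c" "q \<in> chart f l"
  shows "rpoly_eval (chart_poly c f l) (real_coords q) \<noteq> 0"
  using clearing_choice_zero_iff[OF assms(1) regular_chart, of q f l] assms(2)
  by (simp add: chart_poly_def chart_def)

text \<open>The common part of the two degenerate cases, where \<open>T\<close> stands for the cleared minors:
  the point \<open>real_coords q\<close> together with \<open>R = abs_squares q\<close> is a zero of
  all generators, hence of the elimination ideal.\<close>

lemma positive_zero_of_saturated_ideal:
  fixes f :: "'n::finite laurent"
  assumes c: "clearing_choice c" and q: "q \<in> chart f l" "G f l q = 0"
    and T: "\<And>p. p \<in> T \<Longrightarrow> rpoly_eval p (real_coords q) = 0"
  shows "abs_squares q \<in> positive_zeros
    (elimination_ideal norm_sq_poly (saturate (ideal_gen (I_Sigma c f l \<union> T)) (chart_poly c f l)))"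
proof -
  have qt: "q \<in> torus" using q by (simp add: chart_def)
  have "rpoly_eval p (real_coords q) = 0"
    if "p \<in> saturate (ideal_gen (I_Sigma c f l \<union> T)) (chart_poly c f l)" for p
  proof (rule saturate_vanish[OF _ chart_poly_nonzero[OF c q(1)] that])
    show "rpoly_eval p (real_coords q) = 0" if "p \<in> ideal_gen (I_Sigma c f l \<union> T)" for p
      by (rule ideal_gen_vanish[OF _ that]) (use T I_Sigma_vanish[OF c qt q(2)] in auto)
  qed
  from elimination_ideal_vanish[of _ "real_coords q", OF this]
  have "rpoly_eval P (abs_squares q) = 0"
    if "P \<in> elimination_ideal norm_sq_poly (saturate (ideal_gen (I_Sigma c f l \<union> T)) (chart_poly c f l))" for P
    using that rpoly_eval_norm_sq_poly by metis
  then show ?thesis using abs_squares_pos[OF qt] by (simp add: positive_zeros_def)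
qed

lemma E_deg_ex_subset_E_deg:
  fixes f :: "'n::finite laurent"
  assumes c: "clearing_choice c"
  shows "E_deg_ex f \<subseteq> E_deg c f"
proof
  fix R assume "R \<in> E_deg_ex f"
  then obtain q l where q: "R = abs_squares q" "q \<in> chart f l" "G f l q = 0"
    and r: "rank (DG f l q) < CARD('n) + 1 \<or> rank (DG_DLog f l q) < 2 * CARD('n)"
    unfolding E_deg_ex_def by blast
  have qt: "q \<in> torus" using q by (simp add: chart_def)
  from r have "R \<in> positive_zeros (elimination_ideal norm_sq_poly (I_sing c f l)) \<or>
    R \<in> positive_zeros (elimination_ideal norm_sq_poly (I_imm c f l))"
  proof
    assume r: "rank (DG f l q) < CARD('n) + 1"
    have "rpoly_eval p (real_coords q) = 0" if p: "p \<in> c ` minors TYPE('n option) (DG f l)" for p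
    proof -
      obtain \<rho> :: "'n option \<Rightarrow> 'n option" and \<sigma> :: "'n option \<Rightarrow> 'n + 'n"
        where m: "p = c (\<lambda>z. det (\<chi> i j. DG f l z $ \<rho> i $ \<sigma> j))" "inj \<rho>"
        using p unfolding minors_def by auto
      have "regular (\<lambda>z. det (\<chi> i j. DG f l z $ \<rho> i $ \<sigma> j))"
        by (rule regular_det) (simp add: regular_DG)
      moreover have "det (\<chi> i j. DG f l q $ \<rho> i $ \<sigma> j) = 0"
        using r by (intro minors_vanish_rows[OF _ m(2)]) simp
      ultimately show ?thesis using clearing_choice_zero_iff[OF c _ qt] m(1) by blast
    qed
    from positive_zero_of_saturated_ideal[OF c q(2,3) this] show ?thesis
      unfolding I_sing_def q(1) by blast
  next
    assume r: "rank (DG_DLog f l q) < 2 * CARD('n)"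
    have "rpoly_eval p (real_coords q) = 0" if p: "p \<in> c ` minors TYPE('n + 'n) (DG_DLog f l)" for p
    proof -
      obtain \<rho> :: "'n + 'n \<Rightarrow> 'n option + 'n" and \<sigma> :: "'n + 'n \<Rightarrow> 'n + 'n"
        where m: "p = c (\<lambda>z. det (\<chi> i j. DG_DLog f l z $ \<rho> i $ \<sigma> j))" "inj \<sigma>"
        using p unfolding minors_def by blast
      have "regular (\<lambda>z. det (\<chi> i j. DG_DLog f l z $ \<rho> i $ \<sigma> j))"
        by (rule regular_det) (simp add: regular_DG_DLog)
      moreover have "det (\<chi> i j. DG_DLog f l q $ \<rho> i $ \<sigma> j) = 0"
        using r by (intro minors_vanish_cols[OF _ m(2)]) simp
      ultimately show ?thesis using clearing_choice_zero_iff[OF c _ qt] m(1) by blast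
    qed
    from positive_zero_of_saturated_ideal[OF c q(2,3) this] show ?thesis
      unfolding I_imm_def q(1) by blast
  qed
  then show "R \<in> E_deg c f" unfolding E_deg_def by blast
qed

text \<open>The same evaluation argument at the pair \<open>(q, q')\<close>; here \<open>q \<noteq> q'\<close>
  is used to see that \<open>delta\<close> does not vanish at it.\<close>

lemma E_mult_ex_subset_E_mult:
  fixes f :: "'n::finite laurent"
  assumes c: "clearing_choice c" and f: "smooth_hypersurface f"
  shows "E_mult_ex f \<subseteq> E_mult c f"
proof
  fix R assume "R \<in> E_mult_ex f"
  then obtain q q' where q: "q \<in> Crit f" "q' \<in> Crit f" "q \<noteq> q'" "R = abs_squares q" "R = abs_squares q'"
    unfolding E_mult_ex_def by blast
  obtain l where l: "q \<in> chart f l" "G f l q = 0" using Crit_in_chart[OF f q(1)] by blast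
  obtain m where m: "q' \<in> chart f m" "G f m q' = 0" using Crit_in_chart[OF f q(2)] by blast
  have qt: "q \<in> torus" "q' \<in> torus" using q(1,2) Crit_subset_torus by blast+
  define Y :: "real ^ (('n + 'n) + ('n + 'n))" where
    "Y = (\<chi> i. case i of Inl a \<Rightarrow> real_coords q $ a | Inr a \<Rightarrow> real_coords q' $ a)"
  have L: "(\<chi> v. Y $ Inl v) = real_coords q" "(\<chi> v. Y $ Inr v) = real_coords q'"
    by (simp_all add: Y_def vec_eq_iff)
  have gen: "rpoly_eval p Y = 0"
    if "p \<in> ideal_gen (rename Inl ` I_Sigma c f l \<union> rename Inr ` I_Sigma c f m \<union>
            range (\<lambda>j. rename Inl (norm_sq_poly j) - rename Inr (norm_sq_poly j)))" for p
  proof (rule ideal_gen_vanish[OF _ that])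
    fix r assume "r \<in> rename Inl ` I_Sigma c f l \<union> rename Inr ` I_Sigma c f m \<union>
            range (\<lambda>j. rename Inl (norm_sq_poly j) - rename Inr (norm_sq_poly j))"
    then show "rpoly_eval r Y = 0"
      using I_Sigma_vanish[OF c qt(1) l(2)] I_Sigma_vanish[OF c qt(2) m(2)] q(4,5)
      by (auto simp: rpoly_eval_rename L rpoly_eval_norm_sq_poly)
  qed
  have nz: "rpoly_eval (rename Inl (chart_poly c f l)) Y \<noteq> 0" "rpoly_eval (rename Inr (chart_poly c f m)) Y \<noteq> 0"
    using chart_poly_nonzero[OF c l(1)] chart_poly_nonzero[OF c m(1)] by (simp_all add: rpoly_eval_rename L)
  have d: "rpoly_eval delta Y \<noteq> 0"
  proof
    assume "rpoly_eval delta Y = 0"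
    then have "(\<Sum>j\<in>UNIV. (Re (q $ j) - Re (q' $ j))\<^sup>2 + (Im (q $ j) - Im (q' $ j))\<^sup>2) = 0"
      by (simp add: delta_def rpoly_eval_sum Y_def real_coords_def)
    then have "\<forall>j. (Re (q $ j) - Re (q' $ j))\<^sup>2 + (Im (q $ j) - Im (q' $ j))\<^sup>2 = 0"
      by (subst (asm) sum_nonneg_eq_0_iff) auto
    then have "q = q'" by (simp add: sum_power2_eq_zero_iff vec_eq_iff complex_eq_iff)
    then show False using q(3) by simp
  qed
  have I: "rpoly_eval p Y = 0" if "p \<in> I_mult_off c f l m" for p
    using that unfolding I_mult_off_def I_mult_def
    by (intro saturate_vanish[OF saturate_vanish[OF saturate_vanish[OF gen nz(1)] nz(2)] d])
  have "rpoly_eval P R = 0" if "P \<in> elimination_ideal (\<lambda>j. rename Inl (norm_sq_poly j)) (I_mult_off c f l m)" for P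
    by (rule elimination_ideal_vanish[OF I _ that]) (simp_all add: rpoly_eval_rename L rpoly_eval_norm_sq_poly q(4))
  then have "R \<in> positive_zeros (elimination_ideal (\<lambda>j. rename Inl (norm_sq_poly j)) (I_mult_off c f l m))"
    using abs_squares_pos[OF qt(1)] q(4) by (simp add: positive_zeros_def)
  then show "R \<in> E_mult c f" unfolding E_mult_def by blast
qed

section \<open>Lifts of full rank\<close>

definition full_rank_lift :: "'n::finite laurent \<Rightarrow> 'n \<Rightarrow> complex ^ 'n \<Rightarrow> bool" where
  "full_rank_lift f l q \<longleftrightarrow> q \<in> chart f l \<and> G f l q = 0 \<and>
     rank (DG f l q) = CARD('n) + 1 \<and> rank (DG_DLog f l q) = 2 * CARD('n)"

lemma open_chart: "open (chart f l)"
proof -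
  have "continuous_on torus (\<lambda>z. (cmod (F f l z))\<^sup>2)"
    by (rule smooth_on_imp_continuous_on[OF regular_smooth[OF regular_chart]])
  then have "open (torus \<inter> (\<lambda>z. (cmod (F f l z))\<^sup>2) -` (- {0}))"
    by (intro continuous_open_preimage open_torus) auto
  moreover have "torus \<inter> (\<lambda>z. (cmod (F f l z))\<^sup>2) -` (- {0}) = chart f l"
    by (auto simp: chart_def)
  ultimately show ?thesis by simp
qed

text \<open>A vector killed by both derivatives is a null vector of the stacked matrix, and the kernel of
  \<open>D\<close> has dimension \<open>2 n - (n + 1)\<close> by rank and nullity.\<close>

lemma full_rank_lift_derivative:
  fixes f :: "'n::finite laurent"
  assumes "full_rank_lift f l q"
  obtains D where "(G f l has_derivative D) (at q)" "surj D"
    "\<And>v. D v = 0 \<Longrightarrow> dLog q v = 0 \<Longrightarrow> v = 0" "dim {v. D v = 0} = CARD('n) - 1"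
proof -
  have q: "q \<in> torus" using assms by (simp add: full_rank_lift_def chart_def)
  obtain D' where "\<And>z. z \<in> torus \<Longrightarrow> (G f l has_derivative D' z) (at z)"
    by (rule G_derivative[of f l]) (rule that)
  then have D: "(G f l has_derivative D' q) (at q)" (is "(_ has_derivative ?D) _") using q by blast
  have DG: "DG f l q *v X = ?D (of_real_coords X)" for X
    unfolding DG_def by (rule real_jacobian_mult[OF D])
  have surj: "surj ?D"
  proof -
    have "rank (DG f l q) = CARD('n option)" using assms by (simp add: full_rank_lift_def)
    then have "surj ((*v) (DG f l q))" by (simp only: full_rank_surjective)
    then have "\<exists>X. y = DG f l q *v X" for y by (metis surjD)
    then show ?thesis unfolding DG by (metis surjI surj_def)
  qed
  have inj: "v = 0" if v: "?D v = 0" "dLog q v = 0" for v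
  proof -
    have "rank (DG_DLog f l q) = CARD('n + 'n)" using assms by (simp add: full_rank_lift_def)
    then have inj: "inj ((*v) (DG_DLog f l q))" by (simp only: full_rank_injective)
    have L: "real_jacobian Log q *v real_coords v = dLog q v"
      using real_jacobian_mult[OF Log_has_derivative[OF q], of "real_coords v"] by simp
    have "(DG_DLog f l q *v real_coords v) $ a = 0" for a
    proof (cases a)
      case (Inl i)
      have "(DG_DLog f l q *v real_coords v) $ a = (DG f l q *v real_coords v) $ i"
        by (simp add: matrix_vector_mult_def DG_DLog_def Inl)
      then show ?thesis using v(1) by (simp add: DG)
    next
      case (Inr j)
      have "(DG_DLog f l q *v real_coords v) $ a = (real_jacobian Log q *v real_coords v) $ j"
        by (simp add: matrix_vector_mult_def DG_DLog_def Inr)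
      then show ?thesis using v(2) by (simp add: L)
    qed
    then have "DG_DLog f l q *v real_coords v = DG_DLog f l q *v 0"
      by (simp add: vec_eq_iff)
    then have "real_coords v = 0" using inj by (metis injD)
    then have "of_real_coords (real_coords v) = of_real_coords 0" by simp
    then show ?thesis by (simp add: linear_0[OF linear_of_real_coords])
  qed
  have "dim {v. ?D v = 0} + (CARD('n) + 1) = CARD('n) * 2"
    using dim_kernel_surj[OF has_derivative_linear[OF D] surj] by simp
  then show thesis using that[OF D surj inj] by simp
qed

lemma Crit_Int_chart: "Crit f \<inter> chart f l = {x \<in> chart f l. G f l x = 0}"
  using Crit_chart_iff by blast

lemma smooth_on_chart:
  shows "smooth_on (chart f l) (G f l)" "smooth_on (chart f l) Log"
proof -
  have "chart f l \<subseteq> torus" by (auto simp: chart_def)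
  then show "smooth_on (chart f l) (G f l)" "smooth_on (chart f l) Log"
    by (rule smooth_on_subset[OF smooth_G], rule smooth_on_subset[OF smooth_Log])
qed

lemma full_rank_imp_nondegenerate:
  fixes f :: "'n::finite laurent"
  assumes "full_rank_lift f l q"
  shows "nondegenerate_lift f q"
proof -
  have q: "q \<in> chart f l" "G f l q = 0" using assms by (auto simp: full_rank_lift_def)
  have qt: "q \<in> torus" using q by (simp add: chart_def)
  have qC: "q \<in> Crit f" using q Crit_chart_iff by blast
  obtain D where D: "(G f l has_derivative D) (at q)" "surj D"
    "\<And>v. D v = 0 \<Longrightarrow> dLog q v = 0 \<Longrightarrow> v = 0" "dim {v. D v = 0} = CARD('n) - 1"
    using full_rank_lift_derivative[OF assms] by blast
  have "\<exists>U d. open U \<and> q \<in> U \<and> embedded_submanifold d (Crit f \<inter> U)"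
    by (rule embedded_submanifold_level_set[OF open_chart q(1) smooth_on_chart(1) Crit_Int_chart qC D(1,2)]) blast
  moreover have "dim (differential_image Log (Crit f) q) = CARD('n) - 1"
  proof -
    have fr: "frechet_derivative Log (at q) = dLog q"
      using frechet_derivative_at[OF Log_has_derivative[OF qt]] by simp
    have T: "tangent_space (Crit f) q = {v. D v = 0}"
      by (rule tangent_space_level_set[OF open_chart q(1) smooth_on_chart(1) Crit_Int_chart qC D(1,2)])
    have sub: "subspace {v. D v = 0}" by (rule subspace_kernel[OF has_derivative_linear[OF D(1)]])
    have lin: "linear (dLog q)" by (rule has_derivative_linear[OF Log_has_derivative[OF qt]])
    have "inj_on (dLog q) {v. D v = 0}"
      using linear_injective_on_subspace_0[OF lin sub] D(3) by simp
    moreover have "span {v. D v = 0} = {v. D v = 0}" using sub by (simp only: span_eq_iff)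
    ultimately have "inj_on (dLog q) (span {v. D v = 0})" by (simp only:)
    then have "dim (dLog q ` {v. D v = 0}) = dim {v. D v = 0}" by (rule dim_image_eq[OF lin])
    then show ?thesis using D(4) by (simp add: differential_image_def fr T)
  qed
  ultimately show ?thesis by (simp add: nondegenerate_lift_def)
qed

lemma full_rank_local_image:
  fixes f :: "'n::finite laurent"
  assumes "full_rank_lift f l q" "open N" "q \<in> N"
  obtains U W W' \<phi> \<psi> and H :: "(real ^ 'n) set" where "open U" "q \<in> U" "U \<subseteq> N" "open W" "open W'"
    "homeomorphism W W' \<phi> \<psi>" "smooth_on W \<phi>" "smooth_on W' \<psi>" "subspace H" "dim H = CARD('n) - 1"
    "Log ` (Crit f \<inter> U) \<subseteq> W" "\<phi> ` (Log ` (Crit f \<inter> U)) = W' \<inter> H"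
proof -
  have q: "q \<in> chart f l" "G f l q = 0" using assms by (auto simp: full_rank_lift_def)
  have qt: "q \<in> torus" using q by (simp add: chart_def)
  have qC: "q \<in> Crit f" using q Crit_chart_iff by blast
  obtain D where D: "(G f l has_derivative D) (at q)" "surj D"
    "\<And>v. D v = 0 \<Longrightarrow> dLog q v = 0 \<Longrightarrow> v = 0" "dim {v. D v = 0} = CARD('n) - 1"
    using full_rank_lift_derivative[OF assms(1)] by blast
  show thesis
    by (rule immersed_level_set_image[OF open_chart q(1) smooth_on_chart(1) Crit_Int_chart qC D(1,2)
        smooth_on_chart(2) Log_has_derivative[OF qt] D(3) assms(2,3)])
       (simp_all only: D(4), rule that)
qed

text \<open>The equations with all pairs \<open>j, k\<close> avoid the choice of a chart and so describe the
  critical set as a closed subset of the whole torus.\<close>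

lemma Crit_iff_equations:
  assumes "smooth_hypersurface f" "z \<in> torus"
  shows "z \<in> Crit f \<longleftrightarrow> laurent_eval f z = 0 \<and> (\<forall>j k. Im (F f j z * cnj (F f k z)) = 0)"
proof
  assume "z \<in> Crit f"
  then obtain l where l: "z \<in> chart f l" "G f l z = 0" using Crit_in_chart[OF assms(1)] by blast
  let ?B = "F f l z"
  have G: "laurent_eval f z = 0" "\<And>j. Im (F f j z * cnj ?B) = 0" using l(2) by (simp_all only: G_eq_0_iff)
  have "Im (F f j z * cnj (F f k z)) = 0" for j k
  proof -
    have "(F f j z * cnj (F f k z)) * complex_of_real ((cmod ?B)\<^sup>2) = (F f j z * cnj ?B) * cnj (F f k z * cnj ?B)"
      by (simp only: complex_norm_square complex_cnj_mult complex_cnj_cnj mult_ac)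
    from arg_cong[OF this, of Im]
    have "Im ((F f j z * cnj (F f k z)) * complex_of_real ((cmod ?B)\<^sup>2)) = Im ((F f j z * cnj ?B) * cnj (F f k z * cnj ?B))" .
    also have "\<dots> = 0" using G(2)[of j] G(2)[of k]
      by (simp only: times_complex.sel(2)[of "F f j z * cnj ?B"] cnj.sel)
    finally have "Im (F f j z * cnj (F f k z)) * (cmod ?B)\<^sup>2 = 0"
      by (simp only: times_complex.sel(2)[of "F f j z * cnj (F f k z)"] Re_complex_of_real Im_complex_of_real)
    then show ?thesis using l(1) by (simp only: mult_eq_0_iff) (simp add: chart_def)
  qed
  then show "laurent_eval f z = 0 \<and> (\<forall>j k. Im (F f j z * cnj (F f k z)) = 0)" using G(1) by blast
next
  assume *: "laurent_eval f z = 0 \<and> (\<forall>j k. Im (F f j z * cnj (F f k z)) = 0)"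
  then have h: "z \<in> hypersurface f" using assms(2) by (simp add: hypersurface_def)
  then obtain l where "partial_deriv l (laurent_eval f) z \<noteq> 0"
    using assms(1) unfolding smooth_hypersurface_def by blast
  then have "F f l z \<noteq> 0" using assms(2) by (simp add: F_def torus_def)
  then show "z \<in> Crit f" using Crit_iff[OF h] * by blast
qed

lemma compact_Crit_Int:
  assumes f: "smooth_hypersurface f" and K: "compact K" "K \<subseteq> torus"
  shows "compact (Crit f \<inter> K)"
proof -
  have cont: "continuous_on K g" if "regular g" for g
    using smooth_on_imp_continuous_on[OF regular_smooth[OF that]] K(2) continuous_on_subset by blast
  have cl: "closed {z \<in> K. g z = 0}" if "regular g" for g
    using continuous_closed_preimage_constant[OF cont[OF that] compact_imp_closed[OF K(1)]] .
  have r: "regular (\<lambda>z. Im (F f j z * cnj (F f k z)))" for j k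
  proof -
    have "cregular (\<lambda>z. F f j z * cnj (F f k z))" by (intro cregular_mult cregular_cnj cregular_F)
    then show ?thesis unfolding cregular_def by blast
  qed
  have rf: "regular (\<lambda>z. Re (laurent_eval f z))" "regular (\<lambda>z. Im (laurent_eval f z))"
    using cregular_laurent_eval[of f] unfolding cregular_def by auto
  have "Crit f \<inter> K = {z \<in> K. Re (laurent_eval f z) = 0} \<inter> {z \<in> K. Im (laurent_eval f z) = 0} \<inter>
      (\<Inter>j. \<Inter>k. {z \<in> K. Im (F f j z * cnj (F f k z)) = 0})" (is "_ = ?R")
  proof -
    have eq: "z \<in> Crit f \<longleftrightarrow> Re (laurent_eval f z) = 0 \<and> Im (laurent_eval f z) = 0 \<and> (\<forall>j k. Im (F f j z * cnj (F f k z)) = 0)"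
      if "z \<in> K" for z
      using Crit_iff_equations[OF f, of z] that K(2) by (simp only: complex_eq_iff zero_complex.sel conj_assoc subsetD)
    show ?thesis
    proof (rule set_eqI)
      show "z \<in> Crit f \<inter> K \<longleftrightarrow> z \<in> ?R" for z
        by (cases "z \<in> K") (simp_all only: eq Int_iff INT_iff mem_Collect_eq UNIV_I ball_UNIV conj_assoc simp_thms)
    qed
  qed
  moreover have "closed ?R"
    by (intro closed_Int closed_INT ballI cl r rf)
  ultimately have "closed (Crit f \<inter> K)" by simp
  from compact_Int_closed[OF K(1) this] show ?thesis by (simp add: Int_commute Int_left_commute)
qed

text \<open>Points of the contour close to \<open>p\<close> have critical lifts in the compact set
  \<open>K\<close>. The part of \<open>Crit f \<inter> K\<close> outside \<open>U\<close> has a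
  compact image that misses \<open>p\<close>.\<close>

lemma contour_locally_image:
  fixes f :: "'n::finite laurent"
  assumes f: "smooth_hypersurface f" and U: "open U" "critical_lifts f p \<subseteq> U"
  obtains W where "open W" "p \<in> W" "contour f \<inter> W \<subseteq> Log ` (Crit f \<inter> U)"
proof -
  define K :: "(complex ^ 'n) set" where "K = {z. \<forall>j. exp (p $ j - 1) \<le> cmod (z $ j) \<and> cmod (z $ j) \<le> exp (p $ j + 1)}"
  have Kt: "K \<subseteq> torus"
  proof
    fix z assume "z \<in> K"
    then have "exp (p $ j - 1) \<le> cmod (z $ j)" for j by (simp add: K_def)
    then have "cmod (z $ j) > 0" for j by (meson exp_gt_zero less_le_trans)
    then show "z \<in> torus" by (simp add: torus_def)
  qed
  have "closed K"
    unfolding K_def by (intro closed_Collect_all closed_Collect_conj closed_Collect_le continuous_intros)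
  moreover have "bounded K"
  proof (rule boundedI)
    fix z assume "z \<in> K"
    then have "cmod (z $ j) \<le> exp (p $ j + 1)" for j by (simp add: K_def)
    then have "(\<Sum>j\<in>UNIV. norm (z $ j)) \<le> (\<Sum>j\<in>UNIV. exp (p $ j + 1))" by (intro sum_mono) auto
    then show "norm z \<le> (\<Sum>j\<in>UNIV. exp (p $ j + 1))"
      using L2_set_le_sum[of UNIV "\<lambda>j. norm (z $ j)"] by (simp add: norm_vec_def)
  qed
  ultimately have "compact K" by (simp add: compact_eq_bounded_closed)
  then have "compact (Crit f \<inter> K - U)" using compact_Crit_Int[OF f _ Kt] U(1) by (simp add: compact_diff)
  moreover have "continuous_on (Crit f \<inter> K - U) Log"
    by (rule continuous_on_subset[OF smooth_on_imp_continuous_on[OF smooth_Log]]) (use Kt in blast)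
  ultimately have "compact (Log ` (Crit f \<inter> K - U))" by (intro compact_continuous_image)
  then have cl: "closed (Log ` (Crit f \<inter> K - U))" by (rule compact_imp_closed)
  define W where "W = {x. \<forall>j. \<bar>x $ j - p $ j\<bar> < 1} \<inter> - (Log ` (Crit f \<inter> K - U))"
  have "open {x. \<forall>j. \<bar>x $ j - p $ j\<bar> < 1}"
  proof -
    have eq: "{x. \<forall>j. \<bar>x $ j - p $ j\<bar> < 1} = (\<Inter>j. {x. \<bar>x $ j - p $ j\<bar> < 1})" by auto
    show ?thesis unfolding eq
      by (intro open_INT finite ballI open_Collect_less continuous_intros)
  qed
  then have "open W" unfolding W_def using cl by (intro open_Int) auto
  moreover have "p \<in> W" unfolding W_def using U(2) by (auto simp: critical_lifts_def)
  moreover have "contour f \<inter> W \<subseteq> Log ` (Crit f \<inter> U)"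
  proof
    fix x assume x: "x \<in> contour f \<inter> W"
    then obtain z where z: "z \<in> Crit f" "x = Log z" by (auto simp: contour_def)
    have zt: "z \<in> torus" using z Crit_subset_torus by blast
    have "exp (p $ j - 1) \<le> cmod (z $ j) \<and> cmod (z $ j) \<le> exp (p $ j + 1)" for j
    proof -
      have "\<bar>ln (cmod (z $ j)) - p $ j\<bar> < 1" using x by (simp add: z(2) W_def Log_def)
      then have "p $ j - 1 \<le> ln (cmod (z $ j))" "ln (cmod (z $ j)) \<le> p $ j + 1" by auto
      moreover have "cmod (z $ j) > 0" using zt by (simp add: torus_def)
      ultimately show ?thesis by (metis exp_le_cancel_iff exp_ln)
    qed
    then have "z \<in> K" by (simp add: K_def)
    then have "z \<in> U" using x z by (auto simp: W_def)
    then show "x \<in> Log ` (Crit f \<inter> U)" using z by blast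
  qed
  ultimately show thesis by (rule that)
qed

lemma regular_point_of_single_full_rank_lift:
  fixes f :: "'n::finite laurent"
  assumes f: "smooth_hypersurface f" and q: "full_rank_lift f l q" and one: "critical_lifts f p \<subseteq> {q}" and "Log q = p"
  shows "smooth_hypersurface_germ (contour f) p"
proof -
  obtain U W W' \<phi> \<psi> and H :: "(real ^ 'n) set" where *: "open U" "q \<in> U" "U \<subseteq> UNIV" "open W" "open W'"
    "homeomorphism W W' \<phi> \<psi>" "smooth_on W \<phi>" "smooth_on W' \<psi>" "subspace H" "dim H = CARD('n) - 1"
    "Log ` (Crit f \<inter> U) \<subseteq> W" "\<phi> ` (Log ` (Crit f \<inter> U)) = W' \<inter> H"
    by (rule full_rank_local_image[OF q open_UNIV UNIV_I]) (rule that)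
  have "critical_lifts f p \<subseteq> U" using one *(2) by blast
  then obtain O' where O': "open O'" "p \<in> O'" "contour f \<inter> O' \<subseteq> Log ` (Crit f \<inter> U)"
    using contour_locally_image[OF f *(1)] by blast
  have "embedded_submanifold (CARD('n) - 1) (Log ` (Crit f \<inter> U))"
    using embedded_submanifold_single_chart[OF *(4,11,5-9,12)] *(10) by simp
  then have "embedded_submanifold (CARD('n) - 1) (Log ` (Crit f \<inter> U) \<inter> O')"
    using O'(1) by (rule embedded_submanifold_Int_open)
  moreover have "Log ` (Crit f \<inter> U) \<inter> O' = contour f \<inter> O'" using O'(3) by (auto simp: contour_def)
  ultimately show ?thesis unfolding smooth_hypersurface_germ_def using O'(1,2) by auto
qed

text \<open>The image of a small neighbourhood of \<open>q\<close> is a patch of full dimension in the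
  hypersurface formed by the contour, hence contains all points of the contour close to \<open>Log
  q\<close>.\<close>

lemma local_image_germ_of_regular_point:
  fixes f :: "'n::finite laurent"
  assumes q: "full_rank_lift f l q" and p: "smooth_hypersurface_germ (contour f) (Log q)"
  shows "local_image_germ f q (contour f)"
proof -
  have qC: "q \<in> Crit f" using q Crit_chart_iff by (auto simp: full_rank_lift_def)
  have qt: "q \<in> torus" using qC Crit_subset_torus by blast
  obtain V where V: "open V" "Log q \<in> V" "embedded_submanifold (CARD('n) - 1) (contour f \<inter> V)"
    using p unfolding smooth_hypersurface_germ_def by auto
  have "germ_eq (Log q) (Log ` (Crit f \<inter> N)) (contour f)" if N: "open N" "q \<in> N" for N
  proof -
    \<comment> \<open>shrink \<open>N\<close> so that its image lies in the part of the contour that is a submanifold\<close>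
    let ?N = "N \<inter> (torus \<inter> Log -` V)"
    have "open (torus \<inter> Log -` V)"
      using continuous_open_preimage[OF smooth_on_imp_continuous_on[OF smooth_Log] open_torus V(1)] .
    then have N': "open ?N" "q \<in> ?N" using N qt V(2) by auto
    obtain U W W' \<phi> \<psi> and H :: "(real ^ 'n) set" where *: "open U" "q \<in> U" "U \<subseteq> ?N" "open W" "open W'"
      "homeomorphism W W' \<phi> \<psi>" "smooth_on W \<phi>" "smooth_on W' \<psi>" "subspace H" "dim H = CARD('n) - 1"
      "Log ` (Crit f \<inter> U) \<subseteq> W" "\<phi> ` (Log ` (Crit f \<inter> U)) = W' \<inter> H"
      by (rule full_rank_local_image[OF q N']) (rule that)
    have "Log ` (Crit f \<inter> U) \<subseteq> contour f \<inter> V" using *(3) by (auto simp: contour_def)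
    moreover have "Log q \<in> Log ` (Crit f \<inter> U)" using qC *(2) by blast
    ultimately obtain O' where O': "open O'" "Log q \<in> O'" "contour f \<inter> V \<inter> O' \<subseteq> Log ` (Crit f \<inter> U)"
      using equidimensional_patch_open[OF V(3) *(4-6,9-12)] by blast
    have "x \<in> Log ` (Crit f \<inter> N) \<longleftrightarrow> x \<in> contour f" if "x \<in> V \<inter> O'" for x
    proof
      assume "x \<in> contour f"
      then have "x \<in> Log ` (Crit f \<inter> U)" using that O'(3) by blast
      then show "x \<in> Log ` (Crit f \<inter> N)" using *(3) by blast
    qed (auto simp: contour_def)
    moreover have "open (V \<inter> O')" "Log q \<in> V \<inter> O'" using V O' by auto
    ultimately show ?thesis unfolding germ_eq_def eventually_nhds by blast
  qed
  then show ?thesis unfolding local_image_germ_def by (intro exI[of _ UNIV]) auto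
qed

section \<open>Singular points of the contour\<close>

lemma full_rank_lift_if_not_E_deg_ex:
  fixes f :: "'n::finite laurent"
  assumes f: "smooth_hypersurface f" and q: "q \<in> Crit f" "abs_squares q \<notin> E_deg_ex f"
  obtains l where "full_rank_lift f l q"
proof -
  obtain l where l: "q \<in> chart f l" "G f l q = 0" using Crit_in_chart[OF f q(1)] by blast
  then have "\<not> (rank (DG f l q) < CARD('n) + 1 \<or> rank (DG_DLog f l q) < 2 * CARD('n))"
    using q(2) unfolding E_deg_ex_def by blast
  moreover have "rank (DG f l q) \<le> CARD('n) + 1" "rank (DG_DLog f l q) \<le> 2 * CARD('n)"
    using rank_bound[of "DG f l q"] rank_bound[of "DG_DLog f l q"] by simp_all
  ultimately have "full_rank_lift f l q" using l by (simp add: full_rank_lift_def)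
  then show thesis by (rule that)
qed

text \<open>If neither a rank drops at a lift nor another lift exists, the contour is a single hypersurface
  patch near the point.\<close>

lemma Sing_contour_subset_exact:
  fixes f :: "'n::finite laurent"
  assumes f: "smooth_hypersurface f"
  shows "Sing_contour f \<subseteq> half_log ` (E_deg_ex f \<union> E_mult_ex f)"
proof
  fix p assume p: "p \<in> Sing_contour f"
  then obtain q where q: "q \<in> Crit f" "p = Log q" by (auto simp: Sing_contour_def contour_def)
  have pq: "p = half_log (abs_squares q)"
    using half_log_abs_squares[OF subsetD[OF Crit_subset_torus q(1)]] q(2) by simp
  show "p \<in> half_log ` (E_deg_ex f \<union> E_mult_ex f)"
  proof (cases "abs_squares q \<in> E_deg_ex f \<union> E_mult_ex f")
    case False
    then obtain l where l: "full_rank_lift f l q" using full_rank_lift_if_not_E_deg_ex[OF f q(1)] by blast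
    have "critical_lifts f p \<subseteq> {q}"
    proof
      fix q' assume "q' \<in> critical_lifts f p"
      then have q': "q' \<in> Crit f" "Log q' = Log q" using q by (auto simp: critical_lifts_def)
      have "abs_squares q' = abs_squares q"
        using q q' Crit_subset_torus by (intro abs_squares_eq_of_Log_eq) auto
      then have "q' = q" using False q(1) q'(1) unfolding E_mult_ex_def by auto
      then show "q' \<in> {q}" by simp
    qed
    then have "smooth_hypersurface_germ (contour f) p"
      using regular_point_of_single_full_rank_lift[OF f l] q(2) by blast
    then show ?thesis using p by (simp add: Sing_contour_def)
  qed (use pq in blast)
qed

text \<open>A regular point coming from a multiple fibre of full rank would give all its lifts the same local
  image germ, namely that of the contour.\<close>

lemma exact_subset_Sing_contour:
  fixes f :: "'n::finite laurent"
  assumes f: "smooth_hypersurface f" and a: "multiple_fibers_separate f"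
    and b: "\<forall>R\<in>E_deg_ex f. \<not> smooth_hypersurface_germ (contour f) (half_log R)"
  shows "half_log ` (E_deg_ex f \<union> E_mult_ex f) \<subseteq> Sing_contour f"
proof -
  have deg: "half_log R \<in> Sing_contour f" if R: "R \<in> E_deg_ex f" for R
  proof -
    obtain q l where q: "R = abs_squares q" "q \<in> chart f l" "G f l q = 0" using R unfolding E_deg_ex_def by blast
    then have "q \<in> Crit f" "q \<in> torus" using Crit_chart_iff by (auto simp: chart_def)
    then have "half_log R \<in> contour f" using q(1) half_log_abs_squares by (auto simp: contour_def)
    then show ?thesis using b R by (simp add: Sing_contour_def)
  qed
  have mult: "half_log R \<in> Sing_contour f" if R: "R \<in> E_mult_ex f" "R \<notin> E_deg_ex f" for R
  proof -
    obtain q q' where q: "q \<in> Crit f" "q' \<in> Crit f" "q \<noteq> q'" "R = abs_squares q" "R = abs_squares q'"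
      using R(1) unfolding E_mult_ex_def by blast
    let ?p = "half_log R"
    have t: "q \<in> torus" "q' \<in> torus" using q Crit_subset_torus by blast+
    have lifts: "q \<in> critical_lifts f ?p" "q' \<in> critical_lifts f ?p"
      using q(1,2) half_log_abs_squares[OF t(1)] half_log_abs_squares[OF t(2)]
      by (simp_all add: critical_lifts_def flip: q(4,5))
    have pc: "?p \<in> contour f" 
      using lifts(1) image_eqI[of ?p Log q "Crit f"] by (simp add: critical_lifts_def contour_def)
    have full: "\<exists>l. full_rank_lift f l r" if r: "r \<in> critical_lifts f ?p" for r
    proof -
      have rC: "r \<in> Crit f" "Log r = Log q" using r lifts(1) by (auto simp: critical_lifts_def)
      then have "abs_squares r = R"
        using t Crit_subset_torus unfolding q(4) by (intro abs_squares_eq_of_Log_eq) auto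
      then show ?thesis using full_rank_lift_if_not_E_deg_ex[OF f rC(1)] R(2) by blast
    qed
    have "\<not> smooth_hypersurface_germ (contour f) ?p"
    proof
      assume s: "smooth_hypersurface_germ (contour f) ?p"
      have "local_image_germ f r (contour f)" if r: "r \<in> critical_lifts f ?p" for r
      proof -
        have "Log r = ?p" using r by (simp add: critical_lifts_def)
        then show ?thesis using full[OF r] local_image_germ_of_regular_point s by metis
      qed
      moreover have "\<forall>r\<in>critical_lifts f ?p. nondegenerate_lift f r"
        using full full_rank_imp_nondegenerate by blast
      ultimately show False using a pc lifts q(3) unfolding multiple_fibers_separate_def by blast
    qed
    then show ?thesis using pc by (simp add: Sing_contour_def)
  qed
  show ?thesis using deg mult by blast
qed

theorem theorem3p1:
  fixes f :: "'n::finite laurent"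
    and c :: "'n clearing"
  assumes "smooth_hypersurface f"
    and "\<forall>p\<in>contour f. locally_proper f p \<and> finite (critical_lifts f p)"
    and "clearing_choice c"
  shows "Sing_contour f \<subseteq> half_log ` (E_deg c f \<union> E_mult c f) \<and>
    (multiple_fibers_separate f \<and>
     (\<forall>R\<in>E_deg_ex f. \<not> smooth_hypersurface_germ (contour f) (half_log R))
     \<longrightarrow> Sing_contour f = half_log ` (E_deg_ex f \<union> E_mult_ex f))"
proof (intro conjI impI)
  show "Sing_contour f \<subseteq> half_log ` (E_deg c f \<union> E_mult c f)"
    using Sing_contour_subset_exact[OF assms(1)] E_deg_ex_subset_E_deg[OF assms(3)]
      E_mult_ex_subset_E_mult[OF assms(3,1)] by blast
  assume "multiple_fibers_separate f \<and>
     (\<forall>R\<in>E_deg_ex f. \<not> smooth_hypersurface_germ (contour f) (half_log R))"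
  then show "Sing_contour f = half_log ` (E_deg_ex f \<union> E_mult_ex f)"
    using Sing_contour_subset_exact[OF assms(1)] exact_subset_Sing_contour[OF assms(1)] by blast
qed

end
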